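(* Consider the $Mp^c$-structure on $\mathbb CP^n=SU(n+1)/K$ defined by the character $\chi_k=\det^k$, $k\in\mathbb Z$, of $K\simeq U(n)$. Let $V_\lambda$ be an irreducible representation of $SU(n+1)$ of highest weight $\lambda$ and $l\ge0$. The elliptic operator $\mathcal P=-i(DD_J-D_JD)$ acts on the subspace of spinor fields $V_\lambda\otimes\mathrm{Hom}_{K,(k)}(V_\lambda,S^l(\mathbb C^n))$ (when it does not vanish) as a multiple of the identity given by $$\frac1\hbar\Bigl(\langle\lambda,2\rho_{\mathfrak{su}(n+1)}+\lambda\rangle_{\widetilde B}+\langle\beta,2\rho_{\mathfrak k}+\beta\rangle_{\widetilde B}-4\langle\gamma,2\rho_{\mathfrak k}+\gamma\rangle_{\widetilde B}\Bigr),$$ where $\beta=\left(2l+\frac{n+1}2\right)\epsilon_1+l\epsilon_2+\dots+l\epsilon_n$ and $\gamma=\beta-\frac{2k+n+1}4\epsilon_1$.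
   Context: Fix $\hbar>0$. $K=\{\tilde q(A)=\mathrm{diag}(\det A^{-1},A)\mid A\in U(n)\}\subset SU(n+1)$, $\mathbb CP^n=SU(n+1)/K$. $\mathfrak{su}(n+1)=\mathfrak k\oplus\mathfrak p$ with $\mathfrak p=\{q(\alpha)=\begin{pmatrix}0&-\bar\alpha^T\\ \alpha&0\end{pmatrix}\mid\alpha\in\mathbb C^n\}\simeq\mathbb C^n$. $\widetilde B(x,y)=-\frac12\mathrm{Tr}(xy)$ on $\mathfrak{su}(n+1)$, with restriction $B$ to $\mathfrak p$, $B(q(\alpha),q(\beta))=\mathrm{Re}(\alpha^T\bar\beta)$; $j(q(\alpha))=q(i\alpha)$; $\Omega(q(\alpha),q(\beta))=B(jq(\alpha),q(\beta))=-\mathrm{Im}(\alpha^T\bar\beta)$. $J$ is the induced invariant complex structure on $\mathbb CP^n$. Polynomial spinor fields. For the homogeneous $Mp^c$-structure defined by $\chi_k$, spinor fields with values in the space $S^l(\mathbb C^n)$ of homogeneous polynomials of degree $l$ in $n$ complex variables are the smooth functions $\varphi:SU(n+1)\to S^l(\mathbb C^n)$ with $(\varphi(g\tilde q(B)))(z)=\det^{l-k}(B)\,\varphi(g)(Bz)$ for $B\in U(n)$. Let $\mathrm{Hom}_{K,(k)}(V_\lambda,S^l(\mathbb C^n))$ be the space of $K$-intertwining maps from $(V_\lambda,\pi_\lambda|_K)$ to $S^l(\mathbb C^n)$ with $K$-action $(\rho'(\tilde q(B))f)(z)=\det^{k-l}(B)f(B^{-1}z)$; $v\otimes L\in V_\lambda\otimes\mathrm{Hom}_{K,(k)}(V_\lambda,S^l(\mathbb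 C^n))$ is identified with the spinor field $g\mapsto L(\pi_\lambda(g^{-1})v)$. Operators. For $\beta\in\mathbb C^n$ and a polynomial $f$, $(cl(q(\beta))f)(z)=\frac1{2\hbar}z^T\bar\beta f(z)-\sum_r\beta^r\partial_{z^r}f(z)$. With a basis $X_a$ of $\mathfrak p$, $\Omega^{ab}$, $B^{ab}$ the inverse matrices of $\Omega(X_a,X_b)$, $B(X_a,X_b)$, and $\widetilde X$ the left invariant vector field on $SU(n+1)$ defined by $X$: $D\varphi=-\sum_{a,b}\Omega^{ab}cl(X_a)\widetilde{X_b}\varphi$ and $D_J\varphi=\sum_{a,b}B^{ab}cl(X_a)\widetilde{X_b}\varphi$ (symplectic Dirac operators for the symmetric connection, acting on functions with polynomial values). Weights. With the diagonal maximal torus, $b_1\epsilon_1+\dots+b_n\epsilon_n$ is the linear form $\mathrm{diag}(i\theta_1,\dots,i\theta_{n+1})\mapsto i(b_1\theta_1+\dots+b_n\theta_n)$ and $\epsilon_{n+1}=-(\epsilon_1+\dots+\epsilon_n)$. Positive roots: $\epsilon_i-\epsilon_j$, $1\le i<j\le n+1$, for $\mathfrak{su}(n+1)$ and $2\le i<j\le n+1$ for $\mathfrak k$; $2\rho$ is the sum of positive roots: $2\rho_{\mathfrak{su}(n+1)}=2n\epsilon_1+2(n-1)\epsilon_2+\dots+2\epsilon_n$, $2\rho_{\mathfrak k}=(n-1)\epsilon_1+2(n-1)\epsilon_2+2(n-2)\epsilon_3+\dots+2\epsilon_n$. The form induced by $\widetilde B$ (extended complex bilinearly) on imaginary-valued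 weights is, for $\kappa=\sum k_j\epsilon_j$, $\kappa'=\sum k'_j\epsilon_j$ ($1\le j\le n$), $\langle\kappa,\kappa'\rangle_{\widetilde B}=-2\left(\sum_jk_jk'_j-\frac1{n+1}\sum_jk_j\sum_ik'_i\right)$. *)

theory Defs
  imports "HOL-Analysis.Analysis" "HOL-Library.Option_ord"
begin

text \<open>
  Conventions. The dimension of the projective space is \<open>n = CARD('n)\<close>, and
  \<open>(n+1) \<times> (n+1)\<close> matrices are indexed by \<open>'n option\<close>, ordered with \<open>None\<close>
  first: \<open>None\<close> is the index 1, and the \<open>Some r\<close> are the indices 2 to n+1, in the order of \<open>'n\<close>.
  Functions on the group SU(n+1) are functions on all matrices of which only the values on the group
  are ever used.
\<close>

section \<open>Smooth functions on subsets of Euclidean spaces\<close>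

primrec Ck_on :: "nat \<Rightarrow> 'a::euclidean_space set \<Rightarrow> ('a \<Rightarrow> 'b::euclidean_space) \<Rightarrow> bool" where
  "Ck_on 0 U f \<longleftrightarrow> continuous_on U f"
| "Ck_on (Suc m) U f \<longleftrightarrow> (\<forall>x\<in>U. f differentiable (at x)) \<and>
     (\<forall>v. Ck_on m U (\<lambda>x. frechet_derivative f (at x) v))"

text \<open>For an embedded submanifold \<open>S\<close>, such as SU(n+1) in the space of matrices, the following is
  smoothness on the manifold \<open>S\<close>.\<close>

definition smooth_on_set :: "'a::euclidean_space set \<Rightarrow> ('a \<Rightarrow> 'b::euclidean_space) \<Rightarrow> bool" where
  "smooth_on_set S f \<longleftrightarrow>
     (\<forall>x\<in>S. \<exists>U F. open U \<and> x \<in> U \<and> (\<forall>m. Ck_on m U F) \<and> (\<forall>y\<in>S \<inter> U. F y = f y))"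

section \<open>Matrices\<close>

definition adj :: "complex^'m^'m \<Rightarrow> complex^'m^'m" where
  "adj A = (\<chi> i j. cnj (A $ j $ i))"

definition unitary_group :: "(complex^'m^'m) set" where
  "unitary_group = {A. adj A ** A = mat 1}"

definition SU :: "(complex^'m^'m) set" where
  "SU = {A \<in> unitary_group. det A = 1}"

definition su :: "(complex^'m^'m) set" where
  "su = {X. adj X = - X \<and> trace X = 0}"

text \<open>The matrix exponential is the usual power series; powers are iterated \<open>**\<close>, since \<open>^\<close> on
  matrices is the componentwise power.\<close>

definition mexp :: "complex^'m^'m \<Rightarrow> complex^'m^'m" where
  "mexp A = (\<Sum>j. (1 / fact j) *\<^sub>R (((**) A ^^ j) (mat 1)))"

section \<open>The pair SU(n+1), K and the tangent space \<open>\<pp>\<close>\<close>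

definition qtilde :: "complex^'n^'n \<Rightarrow> complex^'n::finite option^'n option" where
  "qtilde A = (\<chi> i j. case (i, j) of
      (None, None) \<Rightarrow> inverse (det A)
    | (Some r, Some s) \<Rightarrow> A $ r $ s
    | _ \<Rightarrow> 0)"

definition q :: "complex^'n::finite \<Rightarrow> complex^'n option^'n option" where
  "q \<alpha> = (\<chi> i j. case (i, j) of
      (None, Some s) \<Rightarrow> - cnj (\<alpha> $ s)
    | (Some r, None) \<Rightarrow> \<alpha> $ r
    | _ \<Rightarrow> 0)"

text \<open>On su(n+1) the number \<open>trace (X ** Y)\<close> is real, so that \<open>Re\<close> loses nothing there.\<close>

definition Btilde :: "complex^'m^'m \<Rightarrow> complex^'m^'m \<Rightarrow> real" where
  "Btilde X Y = - Re (trace (X ** Y)) / 2"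

definition j_str :: "complex^'n::finite option^'n option \<Rightarrow> complex^'n option^'n option" where
  "j_str X = q (\<i> *s inv q X)"

definition Omega :: "complex^'n::finite option^'n option \<Rightarrow> complex^'n option^'n option \<Rightarrow> real" where
  "Omega X Y = Btilde (j_str X) Y"

text \<open>The above definitions have the following values in the coordinates of \<open>\<pp>\<close>.\<close>

lemma inv_q [simp]: "inv q (q \<alpha>) = \<alpha>"
proof -
  have "inj (q :: complex^'n::finite \<Rightarrow> complex^'n option^'n option)"
    by (rule injI) (auto simp: q_def vec_eq_iff split: option.splits)
  then show ?thesis
    by (rule inv_f_f)
qed

lemma sum_option_UNIV: "(\<Sum>i\<in>UNIV. f i) = f None + (\<Sum>r\<in>UNIV. f (Some r))"
  for f :: "'a::finite option \<Rightarrow> 'b::comm_monoid_add"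
  by (simp add: UNIV_option_conv sum.reindex)

lemma Btilde_q: "Btilde (q \<alpha>) (q \<beta>) = Re (\<Sum>r\<in>UNIV. \<alpha> $ r * cnj (\<beta> $ r))"
  by (simp add: Btilde_def trace_def matrix_matrix_mult_def q_def sum_option_UNIV sum_negf
        sum.distrib algebra_simps)

lemma Omega_q: "Omega (q \<alpha>) (q \<beta>) = - Im (\<Sum>r\<in>UNIV. \<alpha> $ r * cnj (\<beta> $ r))"
  by (simp add: Omega_def j_str_def Btilde_q vector_scalar_mult_def sum_negf[symmetric] algebra_simps)

definition p_basis :: "('b::finite \<Rightarrow> complex^'n::finite option^'n option) \<Rightarrow> bool" where
  "p_basis X \<longleftrightarrow> inj X \<and> independent (range X) \<and> span (range X) = range q"

section \<open>Polynomial spinor fields\<close>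

definition hom_poly :: "nat \<Rightarrow> (complex^'n \<Rightarrow> complex) set" where
  "hom_poly l = {f. \<exists>c :: ('n \<Rightarrow> nat) \<Rightarrow> complex.
     f = (\<lambda>z. \<Sum>a | sum a UNIV = l. c a * (\<Prod>r\<in>UNIV. (z $ r) ^ a r))}"

text \<open>Since the space of values is finite dimensional, smoothness is the smoothness of
  \<open>g \<mapsto> \<phi> g z\<close> for all \<open>z\<close>; the same applies to derivatives of fields below.\<close>

definition spinor_fields ::
    "int \<Rightarrow> nat \<Rightarrow> (complex^'n::finite option^'n option \<Rightarrow> complex^'n \<Rightarrow> complex) set" where
  "spinor_fields k l = {\<phi>.
     (\<forall>g\<in>SU. \<phi> g \<in> hom_poly l) \<and>
     (\<forall>z. smooth_on_set SU (\<lambda>g. \<phi> g z)) \<and>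
     (\<forall>g\<in>SU. \<forall>A\<in>unitary_group. \<forall>z.
        \<phi> (g ** qtilde A) z = det A powi (int l - k) * \<phi> g (A *v z))}"

definition left_inv_deriv :: "complex^'m^'m \<Rightarrow>
    (complex^'m^'m \<Rightarrow> 'z \<Rightarrow> complex) \<Rightarrow> (complex^'m^'m \<Rightarrow> 'z \<Rightarrow> complex)" where
  "left_inv_deriv X \<phi> g z = vector_derivative (\<lambda>t. \<phi> (g ** mexp (t *\<^sub>R X)) z) (at 0)"

definition partial_deriv :: "'n \<Rightarrow> (complex^'n \<Rightarrow> complex) \<Rightarrow> (complex^'n \<Rightarrow> complex)" where
  "partial_deriv r f z = deriv (\<lambda>w. f (\<chi> s. if s = r then w else z $ s)) (z $ r)"

definition cl :: "real \<Rightarrow> complex^'n::finite option^'n option \<Rightarrow>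
    (complex^'n \<Rightarrow> complex) \<Rightarrow> (complex^'n \<Rightarrow> complex)" where
  "cl hbar X f z = (let \<beta> = inv q X in
     1 / (2 * of_real hbar) * (\<Sum>r\<in>UNIV. z $ r * cnj (\<beta> $ r)) * f z
     - (\<Sum>r\<in>UNIV. \<beta> $ r * partial_deriv r f z))"

section \<open>Symplectic Dirac operators\<close>

definition dirac :: "real \<Rightarrow> ('b::finite \<Rightarrow> complex^'n::finite option^'n option) \<Rightarrow>
    (complex^'n::finite option^'n option \<Rightarrow> complex^'n \<Rightarrow> complex) \<Rightarrow>
    (complex^'n::finite option^'n option \<Rightarrow> complex^'n \<Rightarrow> complex)" where
  "dirac hbar X \<phi> g z = - (\<Sum>a\<in>UNIV. \<Sum>b\<in>UNIV.
     of_real (matrix_inv (\<chi> c d. Omega (X c) (X d)) $ a $ b) *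
     cl hbar (X a) (left_inv_deriv (X b) \<phi> g) z)"

definition dirac_J :: "real \<Rightarrow> ('b::finite \<Rightarrow> complex^'n::finite option^'n option) \<Rightarrow>
    (complex^'n::finite option^'n option \<Rightarrow> complex^'n \<Rightarrow> complex) \<Rightarrow>
    (complex^'n::finite option^'n option \<Rightarrow> complex^'n \<Rightarrow> complex)" where
  "dirac_J hbar X \<phi> g z = (\<Sum>a\<in>UNIV. \<Sum>b\<in>UNIV.
     of_real (matrix_inv (\<chi> c d. Btilde (X c) (X d)) $ a $ b) *
     cl hbar (X a) (left_inv_deriv (X b) \<phi> g) z)"

definition P_op :: "real \<Rightarrow> ('b::finite \<Rightarrow> complex^'n::finite option^'n option) \<Rightarrow>
    (complex^'n::finite option^'n option \<Rightarrow> complex^'n \<Rightarrow> complex) \<Rightarrow>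
    (complex^'n::finite option^'n option \<Rightarrow> complex^'n \<Rightarrow> complex)" where
  "P_op hbar X \<phi> g z =
     - \<i> * (dirac hbar X (dirac_J hbar X \<phi>) g z - dirac_J hbar X (dirac hbar X \<phi>) g z)"

section \<open>Representations of SU(n+1)\<close>

text \<open>Finite-dimensional complex representations, as smooth homomorphisms to \<open>GL(d, \<complex>)\<close>
  acting on \<open>\<complex>\<^sup>d\<close> with \<open>d = CARD('d)\<close>.\<close>

definition SU_rep :: "(complex^'m^'m \<Rightarrow> complex^'d^'d) \<Rightarrow> bool" where
  "SU_rep \<pi> \<longleftrightarrow> smooth_on_set SU \<pi> \<and> \<pi> (mat 1) = mat 1 \<and>
     (\<forall>g\<in>SU. \<forall>h\<in>SU. \<pi> (g ** h) = \<pi> g ** \<pi> h)"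

definition irreducible_rep :: "(complex^'m^'m \<Rightarrow> complex^'d^'d) \<Rightarrow> bool" where
  "irreducible_rep \<pi> \<longleftrightarrow> SU_rep \<pi> \<and>
     (\<forall>W. vec.subspace W \<and> (\<forall>g\<in>SU. \<forall>v\<in>W. \<pi> g *v v \<in> W) \<longrightarrow> W = {0} \<or> W = UNIV)"

definition Hom_K :: "int \<Rightarrow> nat \<Rightarrow> (complex^'n::finite option^'n option \<Rightarrow> complex^'d^'d) \<Rightarrow>
    (complex^'d \<Rightarrow> complex^'n \<Rightarrow> complex) set" where
  "Hom_K k l \<pi> = {L.
     (\<forall>v. L v \<in> hom_poly l) \<and>
     (\<forall>v w z. L (v + w) z = L v z + L w z) \<and>
     (\<forall>c v z. L (c *s v) z = c * L v z) \<and>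
     (\<forall>A\<in>unitary_group. \<forall>v z.
        L (\<pi> (qtilde A) *v v) z = det A powi (k - int l) * L v (matrix_inv A *v z))}"

text \<open>The image of \<open>V \<otimes> Hom\<close> in the space of fields: the finite sums of the fields
  of pure tensors \<open>v \<otimes> L\<close>.\<close>

definition tensor_fields :: "int \<Rightarrow> nat \<Rightarrow> (complex^'n::finite option^'n option \<Rightarrow> complex^'d^'d) \<Rightarrow>
    (complex^'n::finite option^'n option \<Rightarrow> complex^'n \<Rightarrow> complex) set" where
  "tensor_fields k l \<pi> =
     {(\<lambda>g z. \<Sum>i<N. L i (\<pi> (matrix_inv g) *v v i) z) | (N::nat) v L. \<forall>i<N. L i \<in> Hom_K k l \<pi>}"

section \<open>Weights\<close>

text \<open>The function \<open>b\<close> stands for the weight \<open>b 1 \<epsilon>\<^sub>1 + \<dots> + b n \<epsilon>\<^sub>n\<close>; its values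
  outside \<open>{1..n}\<close> are irrelevant.\<close>

type_synonym weight = "nat \<Rightarrow> real"

definition eps :: "nat \<Rightarrow> nat \<Rightarrow> weight" where
  "eps n i = (\<lambda>m. if i = n + 1 then - 1 else if m = i then 1 else 0)"

definition nth_index :: "nat \<Rightarrow> 'm::{finite,linorder}" where
  "nth_index i = sorted_list_of_set UNIV ! (i - 1)"

definition cartan :: "(complex^'m^'m) set" where
  "cartan = {H \<in> su. \<forall>i j. i \<noteq> j \<longrightarrow> H $ i $ j = 0}"

definition weight_form ::
    "weight \<Rightarrow> complex^'n::{finite,linorder} option^'n option \<Rightarrow> complex" where
  "weight_form b H = (\<Sum>i=1..CARD('n). of_real (b i) * H $ nth_index i $ nth_index i)"

definition weight_of ::
    "(complex^'n::{finite,linorder} option^'n option \<Rightarrow> complex^'d^'d) \<Rightarrow> weight \<Rightarrow> bool" where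
  "weight_of \<pi> b \<longleftrightarrow> (\<exists>v. v \<noteq> 0 \<and> (\<forall>H\<in>cartan. \<pi> (mexp H) *v v = exp (weight_form b H) *s v))"

text \<open>The pair \<open>(i, j)\<close> stands for the root \<open>\<epsilon>\<^sub>i - \<epsilon>\<^sub>j\<close>.\<close>

definition root_weight :: "nat \<Rightarrow> nat \<times> nat \<Rightarrow> weight" where
  "root_weight n = (\<lambda>(i, j) m. eps n i m - eps n j m)"

definition pos_roots_su :: "nat \<Rightarrow> (nat \<times> nat) set" where
  "pos_roots_su n = {(i, j). 1 \<le> i \<and> i < j \<and> j \<le> n + 1}"

definition pos_roots_k :: "nat \<Rightarrow> (nat \<times> nat) set" where
  "pos_roots_k n = {(i, j). 2 \<le> i \<and> i < j \<and> j \<le> n + 1}"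

definition two_rho_su :: "nat \<Rightarrow> weight" where
  "two_rho_su n m = (\<Sum>r\<in>pos_roots_su n. root_weight n r m)"

definition two_rho_k :: "nat \<Rightarrow> weight" where
  "two_rho_k n m = (\<Sum>r\<in>pos_roots_k n. root_weight n r m)"

text \<open>A weight is the highest one if every weight is obtained from it by subtracting a combination
  of positive roots with natural coefficients.\<close>

definition highest_weight ::
    "(complex^'n::{finite,linorder} option^'n option \<Rightarrow> complex^'d^'d) \<Rightarrow> weight \<Rightarrow> bool" where
  "highest_weight \<pi> b \<longleftrightarrow> weight_of \<pi> b \<and>
     (\<forall>b'. weight_of \<pi> b' \<longrightarrow> (\<exists>c :: nat \<times> nat \<Rightarrow> nat. \<forall>m\<in>{1..CARD('n)}.
        b m - b' m = (\<Sum>r\<in>pos_roots_su CARD('n). of_nat (c r) * root_weight CARD('n) r m)))"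

text \<open>The form on the imaginary-valued weights induced by the complex bilinear extension of
  \<open>Btilde\<close>; it is negative definite.\<close>

definition weight_inner :: "nat \<Rightarrow> weight \<Rightarrow> weight \<Rightarrow> real" where
  "weight_inner n b b' =
     - 2 * ((\<Sum>i=1..n. b i * b' i) - 1 / (real n + 1) * (\<Sum>i=1..n. b i) * (\<Sum>i=1..n. b' i))"

definition beta_weight :: "nat \<Rightarrow> nat \<Rightarrow> weight" where
  "beta_weight n l = (\<lambda>m. if m = 1 then 2 * real l + (real n + 1) / 2 else real l)"

definition gamma_weight :: "nat \<Rightarrow> int \<Rightarrow> nat \<Rightarrow> weight" where
  "gamma_weight n k l =
     (\<lambda>m. beta_weight n l m - (2 * of_int k + real n + 1) / 4 * eps n 1 m)"

end

theory Submission
  imports Defs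
begin

text \<open>
  A field in \<open>V \<otimes> Hom\<close> has the form \<open>g \<mapsto> T (\<pi> (g\<^sup>-\<^sup>1))\<close> with \<open>T\<close> a linear map from the endomorphisms
  of \<open>V\<close> to the polynomials, and the left invariant vector field of \<open>Y\<close> changes \<open>T\<close> into
  \<open>A \<mapsto> - T (d\<pi>(Y) A)\<close>. Let 0 be the first index, let \<open>E\<^sub>i\<^sub>j\<close> be the matrix units, acting through the
  complex linear extension of \<open>d\<pi>\<close>, and put
  \<open>(U T)(A) = 1/(2\<hbar>) \<Sum>\<^sub>r z\<^sub>r T(E\<^sub>r\<^sub>0 A)\<close> and \<open>(W T)(A) = \<Sum>\<^sub>r \<partial>\<^sub>r T(E\<^sub>0\<^sub>r A)\<close>. In an orthonormal basis of the tangent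
  space one finds \<open>D = -2i (U - W)\<close> and \<open>D\<^sub>J = -2 (U + W)\<close>, hence \<open>\<P> = 8 (U W - W U)\<close>.

  By K-equivariance the complexified isotropy algebra acts on \<open>T\<close> by the operators \<open>z\<^sub>s \<partial>\<^sub>r\<close> and
  constants. With Euler's identity this leaves in \<open>U W - W U\<close>, apart from constants, only the operator
  \<open>T(\<Sum>\<^sub>r E\<^sub>r\<^sub>0 E\<^sub>0\<^sub>r A)\<close>. Twice this sum is the Casimir operator \<open>\<Sum>\<^sub>i\<^sub>j E\<^sub>i\<^sub>j E\<^sub>j\<^sub>i\<close> of \<open>SU(n+1)\<close> up to
  terms from the isotropy algebra. The Casimir operator commutes with the irreducible representation, so it
  is the scalar by which it acts on a highest weight vector.
\<close>

section \<open>Matrix calculus\<close>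

text \<open>A Dirac operator leaves the space of spinor fields of degree l, since its values mix the
  degrees l + 1 and l - 1. The second operator therefore has to be evaluated on a larger class.
  Linear maps T into polynomials of arbitrary degree form one: a derivative along the group becomes
  a left multiplication of the argument, so a composite of two Dirac operators is pure algebra, and
  equivariance is imposed only on the original T. Nested operators multiply in reverse order: U W T
  contains T(E_0s E_r0 A).

  The extension of the differential to all matrices kills the identity. Hence single diagonal units
  may be used although they are not traceless; the price is the scalar by which E_00 acts.

  The contribution of lambda has coefficient exactly 1/hbar for this reason: 8 (U W - W U) contains
  -(4/hbar) T(sum_r E_r0 E_0r A), half a Casimir operator up to isotropy terms, and the form on
  weights is -2 times the standard one, so that the Casimir operator acts by -1/2 times the pairing
  of lambda with 2 rho + lambda.\<close>

definition cscale :: "complex \<Rightarrow> complex^'m^'k \<Rightarrow> complex^'m^'k" where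
  "cscale c A = (\<chi> i j. c * A $ i $ j)"

lemma cscale_nth [simp]: "cscale c A $ i $ j = c * A $ i $ j"
  by (simp add: cscale_def)

text \<open>On a matrix \<open>*s\<close> would take a row as its scalar, hence the separate
  operation \<open>cscale\<close>. Real scalars are turned back into \<open>scaleR\<close>, in which
  real linearity is expressed.\<close>

lemma cscale_simps [simp]:
  "cscale 0 A = 0" "cscale 1 A = A" "cscale c 0 = 0"
  "cscale c (cscale d A) = cscale (c * d) A" "cscale (of_real r) A = r *\<^sub>R A"
  by (simp_all add: vec_eq_iff mult_ac scaleR_conv_of_real[where 'a = complex])

lemma cscale_add_right: "cscale c (A + B) = cscale c A + cscale c B"
  and cscale_add_left: "cscale (c + d) A = cscale c A + cscale d A"
  and cscale_diff_right: "cscale c (A - B) = cscale c A - cscale c B"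
  and cscale_uminus: "cscale (- c) A = - cscale c A"
  and cscale_uminus_right: "cscale c (- A) = - cscale c A"
  and cscale_scaleR: "cscale c (r *\<^sub>R A) = r *\<^sub>R cscale c A"
  by (simp_all add: vec_eq_iff algebra_simps)

lemma cscale_mult_left: "cscale c A ** B = cscale c (A ** B)"
  and cscale_mult_right: "A ** cscale c B = cscale c (A ** B)"
  by (simp_all add: vec_eq_iff matrix_matrix_mult_def sum_distrib_left mult_ac)

lemma cscale_mult_vec: "cscale c A *v v = c *s (A *v v)"
  by (simp add: vec_eq_iff matrix_vector_mult_def sum_distrib_left mult_ac)

lemma matrix_mult_algebra:
  fixes A B :: "complex^'m^'k" and C D :: "complex^'l^'m"
  shows matrix_mult_add_left: "(A + B) ** C = A ** C + B ** C"
    and matrix_mult_add_right: "A ** (C + D) = A ** C + A ** D"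
    and matrix_mult_diff_left: "(A - B) ** C = A ** C - B ** C"
    and matrix_mult_diff_right: "A ** (C - D) = A ** C - A ** D"
    and matrix_mult_minus_left: "(- A) ** C = - (A ** C)"
    and matrix_mult_minus_right: "A ** (- C) = - (A ** C)"
    and matrix_mult_scaleR_left: "(r *\<^sub>R A) ** C = r *\<^sub>R (A ** C)"
    and matrix_mult_scaleR_right: "A ** (r *\<^sub>R C) = r *\<^sub>R (A ** C)"
    and matrix_mult_zero_left: "0 ** C = (0 :: complex^'l^'k)"
    and matrix_mult_zero_right: "A ** (0 :: complex^'l^'m) = 0"
  by (simp_all add: vec_eq_iff matrix_matrix_mult_def algebra_simps sum.distrib sum_subtractf
        sum_negf scaleR_sum_right)

lemma matrix_mult_sum_left: "sum f S ** C = (\<Sum>i\<in>S. f i ** C)"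
  for C :: "complex^'l^'m"
  by (induction S rule: infinite_finite_induct)
    (simp_all add: matrix_mult_add_left matrix_mult_zero_left)

lemma matrix_mult_sum_right: "A ** sum f S = (\<Sum>i\<in>S. A ** f i)"
  for A :: "complex^'m^'k"
  by (induction S rule: infinite_finite_induct)
    (simp_all add: matrix_mult_add_right matrix_mult_zero_right)

lemma bounded_bilinear_matrix_mult:
  "bounded_bilinear ((**) :: complex^'m^'k \<Rightarrow> complex^'l^'m \<Rightarrow> complex^'l^'k)"
  unfolding bilinear_conv_bounded_bilinear[symmetric] bilinear_def
  by (auto intro!: linearI simp: matrix_mult_algebra)

lemma bounded_bilinear_matrix_vector_mult:
  "bounded_bilinear ((*v) :: complex^'m^'k \<Rightarrow> complex^'m \<Rightarrow> complex^'k)"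
  unfolding bilinear_conv_bounded_bilinear[symmetric] bilinear_def
  by (auto intro!: linearI simp: vec_eq_iff matrix_vector_mult_def algebra_simps sum.distrib
        scaleR_sum_right)

lemma has_vector_derivative_matrix_mult:
  assumes "(A has_vector_derivative A') (at t)" "(B has_vector_derivative B') (at t)"
  shows "((\<lambda>t. A t ** B t :: complex^'l^'k) has_vector_derivative (A t ** B' + A' ** B t)) (at t)"
  by (rule bounded_bilinear.has_vector_derivative[OF bounded_bilinear_matrix_mult assms])

lemma has_vector_derivative_matrix_vector_mult:
  assumes "(A has_vector_derivative A') (at t)" "(v has_vector_derivative v') (at t)"
  shows "((\<lambda>t. A t *v v t :: complex^'k) has_vector_derivative (A t *v v' + A' *v v t)) (at t)"
  by (rule bounded_bilinear.has_vector_derivative[OF bounded_bilinear_matrix_vector_mult assms])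

lemma has_vector_derivative_vecI:
  fixes f :: "real \<Rightarrow> 'a::euclidean_space^'m"
  assumes "\<And>i. ((\<lambda>t. f t $ i) has_vector_derivative f' $ i) (at t)"
  shows "(f has_vector_derivative f') (at t)"
proof -
  have lin: "linear (axis i :: 'a \<Rightarrow> 'a^'m)" for i
    by (auto intro!: linearI simp: vec_eq_iff axis_def)
  have eq: "x = (\<Sum>i\<in>UNIV. axis i (x $ i))" for x :: "'a^'m"
    by (simp add: vec_eq_iff axis_def if_distrib if_distribR cong: if_cong)
  have "((\<lambda>t. \<Sum>i\<in>UNIV. axis i (f t $ i)) has_vector_derivative (\<Sum>i\<in>UNIV. axis i (f' $ i))) (at t)"
    by (intro has_vector_derivative_sum
        bounded_linear.has_vector_derivative[OF linear_conv_bounded_linear[THEN iffD1, OF lin]] assms)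
  then show ?thesis
    by (simp only: eq[symmetric])
qed

lemma has_vector_derivative_matrixI:
  fixes f :: "real \<Rightarrow> 'a::euclidean_space^'m^'k"
  assumes "\<And>i j. ((\<lambda>t. f t $ i $ j) has_vector_derivative f' $ i $ j) (at t)"
  shows "(f has_vector_derivative f') (at t)"
  by (intro has_vector_derivative_vecI assms)

lemma has_vector_derivative_nth:
  "(f has_vector_derivative f') (at t) \<Longrightarrow> ((\<lambda>t. f t $ i) has_vector_derivative f' $ i) (at t)"
  for f :: "real \<Rightarrow> 'a::euclidean_space^'m"
  by (rule bounded_linear.has_vector_derivative[OF bounded_linear_vec_nth])

lemma has_vector_derivative_linear:
  fixes L :: "'a::euclidean_space \<Rightarrow> 'b::real_normed_vector"
  assumes "linear L" "(f has_vector_derivative f') (at t)"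
  shows "((\<lambda>t. L (f t)) has_vector_derivative L f') (at t)"
  using bounded_linear.has_vector_derivative assms linear_conv_bounded_linear by blast

lemma vector_derivative_unique:
  "(f has_vector_derivative a) (at t) \<Longrightarrow> (f has_vector_derivative b) (at t) \<Longrightarrow> a = b"
  for t :: real
  using vector_derivative_at by blast

lemma has_vector_derivative_zero_const:
  assumes "\<And>t. (f has_vector_derivative 0) (at t)"
  shows "f s = f (t::real)"
proof -
  have "\<exists>c. \<forall>x\<in>UNIV. f x = c"
    using has_vector_derivative_zero_constant[of UNIV f] assms by (metis UNIV_I convex_UNIV has_vector_derivative_at_within)
  then show ?thesis
    by auto
qed

subsection \<open>The exponential of a matrix\<close>

text \<open>Boundedness of the bilinear matrix product gives |AB| <= K |A| |B|, which is enough for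
  geometric growth of the powers, with ratio K |A|.\<close>

lemma matrix_power_norm_bound:
  fixes A :: "complex^'m^'m"
  obtains M where "\<And>j. norm ((((**) A ^^ j) (mat 1)) :: complex^'m^'m) \<le> norm (mat 1 :: complex^'m^'m) * M ^ j"
proof -
  obtain K where K: "K > 0" "\<And>a b. norm ((a::complex^'m^'m) ** b) \<le> norm a * norm (b::complex^'m^'m) * K"
    using bounded_bilinear.pos_bounded[OF bounded_bilinear_matrix_mult] by blast
  have "norm ((((**) A ^^ j) (mat 1)) :: complex^'m^'m) \<le> norm (mat 1 :: complex^'m^'m) * (norm A * K) ^ j" for j
  proof (induction j)
    case (Suc j)
    have "norm ((((**) A ^^ Suc j) (mat 1)) :: complex^'m^'m) \<le> norm A * norm (((**) A ^^ j) (mat 1)) * K"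
      using K(2) by simp
    also have "\<dots> \<le> norm A * (norm (mat 1 :: complex^'m^'m) * (norm A * K) ^ j) * K"
      using Suc K(1) by (intro mult_left_mono mult_right_mono) auto
    finally show ?case
      by (simp add: mult_ac)
  qed simp
  then show ?thesis
    using that by blast
qed

lemma summable_mexp_entry:
  fixes A :: "complex^'m^'m"
  shows "summable (\<lambda>j. (((**) A ^^ j) (mat 1)) $ i $ k / fact j * x ^ j)"
proof -
  obtain M where M: "\<And>j. norm ((((**) A ^^ j) (mat 1)) :: complex^'m^'m) \<le> norm (mat 1 :: complex^'m^'m) * M ^ j"
    using matrix_power_norm_bound[of A] by blast
  have "summable (\<lambda>j. norm (mat 1 :: complex^'m^'m) * ((M * norm x) ^ j /\<^sub>R fact j))"
    by (intro summable_mult summable_exp_generic)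
  then show ?thesis
  proof (rule summable_comparison_test'[where N = 0])
    fix j :: nat
    have "norm ((((**) A ^^ j) (mat 1)) $ i $ k) \<le> norm (mat 1 :: complex^'m^'m) * M ^ j"
      using M[of j] Finite_Cartesian_Product.norm_nth_le order_trans by metis
    then have "norm ((((**) A ^^ j) (mat 1)) $ i $ k) * norm x ^ j / fact j
        \<le> (norm (mat 1 :: complex^'m^'m) * M ^ j) * norm x ^ j / fact j"
      by (intro divide_right_mono mult_right_mono) auto
    then show "norm ((((**) A ^^ j) (mat 1)) $ i $ k / fact j * x ^ j)
        \<le> norm (mat 1 :: complex^'m^'m) * ((M * norm x) ^ j /\<^sub>R fact j)"
      by (simp add: norm_mult norm_divide norm_power power_mult_distrib field_simps)
  qed
qed

lemma suminf_sum_mult: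
  fixes f :: "'m::finite \<Rightarrow> nat \<Rightarrow> complex"
  assumes "\<And>m. summable (f m)"
  shows "(\<Sum>j. \<Sum>m\<in>UNIV. a m * f m j) = (\<Sum>m\<in>UNIV. a m * (\<Sum>j. f m j))"
  using assms by (subst suminf_sum) (auto intro!: summable_mult sum.cong suminf_mult)

lemma matrix_power_scaleR:
  "((**) (t *\<^sub>R A) ^^ j) (mat 1) = t ^ j *\<^sub>R (((**) A ^^ j) (mat 1) :: complex^'m^'m)"
  by (induction j) (simp_all add: matrix_mult_scaleR_left matrix_mult_scaleR_right)

text \<open>Entrywise, the one-parameter group is a scalar power series in t. Convergence and
  termwise differentiation can then be taken from scalar power series.\<close>

lemma mexp_entry:
  fixes A :: "complex^'m^'m"
  shows "mexp (t *\<^sub>R A) $ i $ k = (\<Sum>j. (((**) A ^^ j) (mat 1)) $ i $ k / fact j * of_real t ^ j)"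
proof -
  let ?f = "\<lambda>j. (1 / fact j) *\<^sub>R (((**) (t *\<^sub>R A) ^^ j) (mat 1))"
  have f: "?f j $ i $ k = (((**) A ^^ j) (mat 1)) $ i $ k / fact j * of_real t ^ j" for i k j
    by (simp add: matrix_power_scaleR scaleR_conv_of_real[where 'a = complex] mult_ac)
  have sm: "?f sums (\<chi> i k. \<Sum>j. ?f j $ i $ k)"
    unfolding sums_def
    by (intro vec_tendstoI) (simp only: vec_lambda_beta sum_component flip: sums_def, simp only: f summable_sums[OF summable_mexp_entry])
  have "mexp (t *\<^sub>R A) = (\<chi> i k. \<Sum>j. ?f j $ i $ k)"
    unfolding mexp_def using sums_unique[OF sm] by simp
  then show ?thesis
    by (simp only: f vec_lambda_beta)
qed

lemma has_vector_derivative_mexp: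
  fixes A :: "complex^'m^'m"
  shows "((\<lambda>t. mexp (t *\<^sub>R A)) has_vector_derivative A ** mexp (t *\<^sub>R A)) (at t)"
proof (rule has_vector_derivative_matrixI)
  fix i k
  let ?c = "\<lambda>i j. (((**) A ^^ j) (mat 1)) $ i $ k / fact j :: complex"
  have d: "diffs (?c i) j = (\<Sum>m\<in>UNIV. A $ i $ m * ?c m j)" for j
    by (simp add: diffs_def matrix_matrix_mult_def sum_divide_distrib sum_distrib_left field_simps
        del: of_nat_Suc)
  have "(\<Sum>j. diffs (?c i) j * of_real t ^ j) = (\<Sum>j. \<Sum>m\<in>UNIV. A $ i $ m * (?c m j * of_real t ^ j))"
    by (simp add: d sum_distrib_left sum_distrib_right mult_ac)
  also have "\<dots> = (\<Sum>m\<in>UNIV. A $ i $ m * (\<Sum>j. ?c m j * of_real t ^ j))"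
    by (rule suminf_sum_mult[OF summable_mexp_entry])
  also have "\<dots> = (A ** mexp (t *\<^sub>R A)) $ i $ k"
    by (simp add: matrix_matrix_mult_def mexp_entry)
  finally have e: "(\<Sum>j. diffs (?c i) j * of_real t ^ j) = (A ** mexp (t *\<^sub>R A)) $ i $ k" .
  have "((\<lambda>x. \<Sum>j. ?c i j * x ^ j) has_field_derivative (A ** mexp (t *\<^sub>R A)) $ i $ k) (at (of_real t))"
    unfolding e[symmetric]
    by (rule termdiffs_strong_converges_everywhere) (rule summable_mexp_entry)
  from has_vector_derivative_real_field[OF this]
  show "((\<lambda>t. mexp (t *\<^sub>R A) $ i $ k) has_vector_derivative (A ** mexp (t *\<^sub>R A)) $ i $ k) (at t)"
    by (simp add: mexp_entry)
qed

lemma mexp_zero [simp]: "mexp 0 = (mat 1 :: complex^'m^'m)"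
proof -
  have "(\<Sum>j. (1 / fact j) *\<^sub>R (((**) (0 :: complex^'m^'m) ^^ j) (mat 1))) =
      (\<Sum>j\<in>{0}. (1 / fact j) *\<^sub>R (((**) (0 :: complex^'m^'m) ^^ j) (mat 1 :: complex^'m^'m)))"
  proof (rule suminf_finite)
    fix j :: nat assume "j \<notin> {0}"
    then obtain m where "j = Suc m"
      by (cases j) auto
    then have "((**) (0 :: complex^'m^'m) ^^ j) (mat 1 :: complex^'m^'m) = 0 ** (((**) (0 :: complex^'m^'m) ^^ m) (mat 1))"
      by (simp only: funpow.simps o_apply)
    then show "(1 / fact j) *\<^sub>R (((**) (0 :: complex^'m^'m) ^^ j) (mat 1 :: complex^'m^'m)) = 0"
      by (simp only: matrix_mult_zero_left scaleR_zero_right)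
  qed simp
  then show ?thesis
    unfolding mexp_def by simp
qed

lemma mexp_commute: "A ** mexp (t *\<^sub>R A) = mexp (t *\<^sub>R A) ** (A :: complex^'m^'m)"
proof -
  have c: "((**) A ^^ j) (mat 1) ** A = A ** ((**) A ^^ j) (mat 1)" for j
    by (induction j) (simp_all add: matrix_mul_assoc[symmetric])
    have "(\<Sum>m\<in>UNIV. (\<Sum>j. ((((**) A ^^ j) (mat 1)) $ i $ m / fact j * of_real t ^ j)) * A $ m $ k)
        = (\<Sum>m\<in>UNIV. A $ i $ m * (\<Sum>j. ((((**) A ^^ j) (mat 1)) $ m $ k / fact j * of_real t ^ j)))"
      (is "?l = ?r") for i k
    proof -
      have "?l = (\<Sum>m\<in>UNIV. A $ m $ k * (\<Sum>j. ((((**) A ^^ j) (mat 1)) $ i $ m / fact j * of_real t ^ j)))"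
        by (simp only: mult.commute)
      also have "\<dots> = (\<Sum>j. \<Sum>m\<in>UNIV. A $ m $ k * ((((**) A ^^ j) (mat 1)) $ i $ m / fact j * of_real t ^ j))"
        by (rule suminf_sum_mult[OF summable_mexp_entry, symmetric])
      also have "\<dots> = (\<Sum>j. (((**) A ^^ j) (mat 1) ** A) $ i $ k / fact j * of_real t ^ j)"
        by (simp add: matrix_matrix_mult_def sum_distrib_left sum_distrib_right sum_divide_distrib mult_ac)
      also have "\<dots> = (\<Sum>j. (A ** ((**) A ^^ j) (mat 1)) $ i $ k / fact j * of_real t ^ j)"
        by (simp only: c)
      also have "\<dots> = (\<Sum>j. \<Sum>m\<in>UNIV. A $ i $ m * ((((**) A ^^ j) (mat 1)) $ m $ k / fact j * of_real t ^ j))"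
        by (simp add: matrix_matrix_mult_def sum_distrib_left sum_distrib_right sum_divide_distrib mult_ac)
      also have "\<dots> = ?r"
        by (rule suminf_sum_mult[OF summable_mexp_entry])
      finally show ?thesis .
    qed
  then show ?thesis
    by (simp add: vec_eq_iff matrix_matrix_mult_def mexp_entry)
qed

lemma has_vector_derivative_shift: "((\<lambda>t. s + t) has_vector_derivative 1) (at (t::real))"
  by (auto simp: has_vector_derivative_def intro!: derivative_eq_intros)

text \<open>The product exp((s+t)A) exp(-tA) has derivative 0 in t, hence equals its value exp(sA)
  at t = 0. The case s = 0 shows that exp(-tA) is inverse to exp(tA).\<close>

lemma mexp_add:
  "mexp ((s + t) *\<^sub>R A) = mexp (s *\<^sub>R A) ** mexp (t *\<^sub>R (A :: complex^'m^'m))"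
proof -
  have uminus: "((\<lambda>t. mexp (- t *\<^sub>R A)) has_vector_derivative - (A ** mexp (- t *\<^sub>R A))) (at t)" for t
    using has_vector_derivative_mexp[of "- A" t] by (simp add: matrix_mult_minus_left)
  have 1: "mexp ((s + t) *\<^sub>R A) ** mexp (- t *\<^sub>R A) = mexp (s *\<^sub>R A)" for s t
  proof -
    have shift: "((\<lambda>t. mexp ((s + t) *\<^sub>R A)) has_vector_derivative A ** mexp ((s + t) *\<^sub>R A)) (at t)" for t
      using vector_diff_chain_at[of "\<lambda>t. s + t" 1 t "\<lambda>t. mexp (t *\<^sub>R A)",
          OF has_vector_derivative_shift has_vector_derivative_mexp]
      by (simp add: o_def)
    have "mexp ((s + t) *\<^sub>R A) ** mexp (- t *\<^sub>R A) = mexp ((s + 0) *\<^sub>R A) ** mexp (- 0 *\<^sub>R A)"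
    proof (rule has_vector_derivative_zero_const)
      fix t
      show "((\<lambda>t. mexp ((s + t) *\<^sub>R A) ** mexp (- t *\<^sub>R A)) has_vector_derivative 0) (at t)"
        using has_vector_derivative_matrix_mult[OF shift uminus, of t]
        by (simp add: matrix_mul_assoc mexp_commute matrix_mult_minus_right)
    qed
    then show ?thesis
      by simp
  qed
  have "mexp (s *\<^sub>R A) ** mexp (t *\<^sub>R A) =
      mexp ((s + t) *\<^sub>R A) ** (mexp (- t *\<^sub>R A) ** mexp (t *\<^sub>R A))"
    using 1[of s t] by (simp add: matrix_mul_assoc)
  also have "mexp (- t *\<^sub>R A) ** mexp (t *\<^sub>R A) = mat 1"
    using 1[of 0 "- t"] by simp
  finally show ?thesis
    by simp
qed

lemma mexp_mult_minus: "mexp A ** mexp (- A) = (mat 1 :: complex^'m^'m)"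
  using mexp_add[of 1 "-1" A] by simp

lemma mexp_diagonal:
  fixes H :: "complex^'m^'m"
  assumes H: "\<And>i j. i \<noteq> j \<Longrightarrow> H $ i $ j = 0"
  shows "mexp H = (\<chi> i j. if i = j then exp (H $ i $ i) else 0)"
proof -
  have p: "((**) H ^^ m) (mat 1) = (\<chi> i j. if i = j then (H $ i $ i) ^ m else 0)" for m
  proof (induction m)
    case (Suc m)
    have "(\<Sum>k\<in>UNIV. H $ i $ k * (if k = j then (H $ k $ k) ^ m else 0)) =
        (if i = j then (H $ i $ i) ^ Suc m else 0)" for i j
      using H[of i j] by (simp add: if_distrib cong: if_cong)
    then show ?case
      using Suc by (simp add: vec_eq_iff matrix_matrix_mult_def)
  qed (simp add: vec_eq_iff mat_def)
  have "mexp H $ i $ j = (\<Sum>m. (if i = j then (H $ i $ i) ^ m else 0) / fact m)" for i j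
    using mexp_entry[of 1 H i j] by (simp add: p)
  then show ?thesis
    by (auto simp: vec_eq_iff exp_def scaleR_conv_of_real divide_inverse mult_ac)
qed

subsection \<open>Adjoints, determinants and the special unitary group\<close>

lemma adj_nth [simp]: "adj A $ i $ j = cnj (A $ j $ i)"
  by (simp add: adj_def)

lemma adj_add: "adj (A + B) = adj A + adj B"
  and adj_diff: "adj (A - B) = adj A - adj B"
  and adj_minus: "adj (- A) = - adj A"
  and adj_scaleR: "adj (r *\<^sub>R A) = r *\<^sub>R adj A"
  and adj_cscale: "adj (cscale c A) = cscale (cnj c) (adj A)"
  and adj_adj [simp]: "adj (adj A) = A"
  and adj_mat1 [simp]: "adj (mat 1) = mat 1"
  by (simp_all add: vec_eq_iff mat_def)

lemma adj_mult: "adj (A ** B) = adj B ** adj A"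
  by (simp add: vec_eq_iff matrix_matrix_mult_def mult.commute)

lemma linear_adj: "linear adj"
  by (rule linearI) (simp_all add: adj_add adj_scaleR)

lemma trace_cscale: "trace (cscale c A) = c * trace A"
  by (simp add: trace_def sum_distrib_left)

lemma trace_scaleR: "trace (r *\<^sub>R A) = of_real r * trace A" for A :: "complex^'m^'m"
  by (simp add: trace_def sum_distrib_left scaleR_conv_of_real[where 'a = complex])

lemma trace_uminus: "trace (- A) = - trace A" for A :: "complex^'m^'m"
  by (simp add: trace_def sum_negf)

lemma trace_adj: "trace (adj A) = cnj (trace A)"
  by (simp add: trace_def)

lemma trace_commutator: "trace (A ** B - B ** A) = 0" for A B :: "complex^'m^'m"
  by (simp add: trace_sub trace_mul_sym[of A])

lemma unitary_groupD:
  assumes "A \<in> unitary_group"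
  shows "adj A ** A = mat 1" "A ** adj A = mat 1" "matrix_inv A = adj A" "adj A \<in> unitary_group"
proof -
  show 1: "adj A ** A = mat 1"
    using assms by (simp add: unitary_group_def)
  then show 2: "A ** adj A = mat 1"
    by (simp add: matrix_left_right_inverse)
  then show "adj A \<in> unitary_group"
    by (simp add: unitary_group_def)
  have "A ** matrix_inv A = mat 1 \<and> matrix_inv A ** A = mat 1"
    unfolding matrix_inv_def by (rule someI[of _ "adj A"]) (simp add: 1 2)
  then have "matrix_inv A = (adj A ** A) ** matrix_inv A" "A ** matrix_inv A = mat 1"
    using 1 by simp_all
  then show "matrix_inv A = adj A"
    by (simp only: matrix_mul_assoc[symmetric] matrix_mul_rid)
qed

lemma det_adj: "det (adj A) = cnj (det A)"
proof -
  have "det (adj A) = det (transpose (adj A))"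
    by simp
  also have "\<dots> = cnj (det A)"
    by (simp add: det_def transpose_def adj_def)
  finally show ?thesis .
qed

lemma det_unitary_nonzero: "A \<in> unitary_group \<Longrightarrow> det A \<noteq> 0"
  using det_mul[of "adj A" A] by (auto simp: unitary_group_def)

lemma det_unitary_adj: "A \<in> unitary_group \<Longrightarrow> det (adj A) = inverse (det A)"
  using det_mul[of "adj A" A] det_unitary_nonzero[of A]
  by (auto simp: unitary_group_def field_simps)

lemma unitary_group_mult: "A \<in> unitary_group \<Longrightarrow> B \<in> unitary_group \<Longrightarrow> A ** B \<in> unitary_group"
  by (simp add: unitary_group_def adj_mult matrix_mul_assoc)
    (metis matrix_mul_assoc matrix_mul_rid)

lemma SU_unitary: "A \<in> SU \<Longrightarrow> A \<in> unitary_group"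
  by (simp add: SU_def)

lemma SU_mult: "A \<in> SU \<Longrightarrow> B \<in> SU \<Longrightarrow> A ** B \<in> SU"
  by (simp add: SU_def unitary_group_mult det_mul)

lemma SU_adj: "A \<in> SU \<Longrightarrow> adj A \<in> SU"
  using unitary_groupD(4)[of A] by (simp add: SU_def det_adj)

lemma SU_mat1: "mat 1 \<in> SU"
  by (simp add: SU_def unitary_group_def)

text \<open>In the Leibniz expansion at the identity only the identity permutation contributes: any
  other one moves at least two points, so after differentiating one factor an off-diagonal zero
  remains.\<close>

lemma has_vector_derivative_det:
  fixes c :: "real \<Rightarrow> complex^'m^'m"
  assumes c: "(c has_vector_derivative X) (at t)" and ct: "c t = mat 1"
  shows "((\<lambda>s. det (c s)) has_vector_derivative trace X) (at t)"
proof -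
  have p: "((\<lambda>s. \<Prod>i\<in>UNIV. c s $ i $ p i) has_vector_derivative (if p = id then trace X else 0)) (at t)"
    if "p permutes UNIV" for p
  proof -
    have "((\<lambda>s. \<Prod>i\<in>UNIV. c s $ i $ p i) has_derivative
        (\<lambda>h. \<Sum>i\<in>UNIV. (h *\<^sub>R X $ i $ p i) * (\<Prod>j\<in>UNIV - {i}. c t $ j $ p j))) (at t)"
    proof (rule has_derivative_prod)
      fix i
      show "((\<lambda>s. c s $ i $ p i) has_derivative (\<lambda>h. h *\<^sub>R X $ i $ p i)) (at t)"
        using has_vector_derivative_nth[OF has_vector_derivative_nth[OF c]]
        by (simp add: has_vector_derivative_def)
    qed
    moreover have "(X $ i $ p i) * (\<Prod>j\<in>UNIV - {i}. c t $ j $ p j) = (if p = id then X $ i $ i else 0)" for i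
    proof (cases "p = id")
      case True
      then show ?thesis
        by (simp add: ct mat_def)
    next
      case False
      \<comment> \<open>If \<open>p\<close> fixed every point except possibly \<open>i\<close>,
        injectivity would force it to fix \<open>i\<close> as well.\<close>
      have "\<exists>j. j \<noteq> i \<and> p j \<noteq> j"
      proof (rule ccontr)
        assume "\<not> ?thesis"
        then have a: "\<And>j. j \<noteq> i \<Longrightarrow> p j = j"
          by auto
        then have "p i = i"
          using permutes_inj[OF that] by (metis injD)
        then show False
          using a False by fastforce
      qed
      then obtain j where j: "j \<noteq> i" "j \<noteq> p j"
        by metis
      then have "(\<Prod>j\<in>UNIV - {i}. c t $ j $ p j) = 0"
        by (intro prod_zero bexI[of _ j]) (simp_all add: ct mat_def)
      then show ?thesis
        using False by simp
    qed
    ultimately have "((\<lambda>s. \<Prod>i\<in>UNIV. c s $ i $ p i) has_derivative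
        (\<lambda>h. \<Sum>i\<in>UNIV. h *\<^sub>R (if p = id then X $ i $ i else 0))) (at t)"
      by simp
    moreover have "(\<Sum>i\<in>UNIV. h *\<^sub>R (if p = id then X $ i $ i else 0)) =
        h *\<^sub>R (if p = id then trace X else 0)" for h
      by (simp add: trace_def scaleR_sum_right)
    ultimately show ?thesis
      by (simp only: has_vector_derivative_def)
  qed
  let ?D = "\<lambda>p :: 'm \<Rightarrow> 'm. of_int (sign p) * (if p = id then trace X else 0)"
  have "((\<lambda>s. det (c s)) has_vector_derivative (\<Sum>p | p permutes UNIV. ?D p)) (at t)"
    unfolding det_def
    by (rule has_vector_derivative_sum, rule has_vector_derivative_mult_right, rule p, simp)
  also have "(\<Sum>p | p permutes UNIV. ?D p) = trace X"
    by (subst sum.remove[of _ id]) (auto simp: permutes_id finite_permutations)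
  finally show ?thesis .
qed

text \<open>Splitting off the constant factor det(exp(tX)) moves the point of differentiation to the
  identity, where the derivative of the determinant is the trace.\<close>

lemma det_mexp:
  fixes X :: "complex^'m^'m"
  assumes "trace X = 0"
  shows "det (mexp X) = 1"
proof -
  have "((\<lambda>t. det (mexp (t *\<^sub>R X))) has_vector_derivative 0) (at t)" for t
  proof -
    have "((\<lambda>s. mexp ((s - t) *\<^sub>R X)) has_vector_derivative X) (at t)" for t :: real
      using vector_diff_chain_at[of "\<lambda>s. - t + s" 1 t "\<lambda>t. mexp (t *\<^sub>R X)",
          OF has_vector_derivative_shift has_vector_derivative_mexp]
      by (simp add: o_def)
    then have "((\<lambda>s. det (mexp ((s - t) *\<^sub>R X))) has_vector_derivative trace X) (at t)"
      by (rule has_vector_derivative_det) simp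
    then have "((\<lambda>s. det (mexp ((s - t) *\<^sub>R X)) * det (mexp (t *\<^sub>R X))) has_vector_derivative 0) (at t)"
      using has_vector_derivative_mult_left assms by fastforce
    moreover have "det (mexp ((s - t) *\<^sub>R X)) * det (mexp (t *\<^sub>R X)) = det (mexp (s *\<^sub>R X))" for s
      using mexp_add[of "s - t" t X] by (simp add: det_mul)
    ultimately show ?thesis
      by simp
  qed
  from has_vector_derivative_zero_const[OF this, of 1 0] show ?thesis
    by simp
qed

lemma mexp_unitary:
  fixes X :: "complex^'m^'m"
  assumes "adj X = - X"
  shows "mexp X \<in> unitary_group"
proof -
  have "((\<lambda>t. adj (mexp (t *\<^sub>R X)) ** mexp (t *\<^sub>R X)) has_vector_derivative 0) (at t)" for t
    using has_vector_derivative_matrix_mult[OF has_vector_derivative_linear[OF linear_adj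
          has_vector_derivative_mexp[of X t]] has_vector_derivative_mexp[of X t]] assms
    by (simp add: adj_mult matrix_mult_minus_right matrix_mult_minus_left matrix_mul_assoc)
  from has_vector_derivative_zero_const[OF this, of 1 0] show ?thesis
    by (simp add: unitary_group_def)
qed

lemma adj_mexp:
  fixes X :: "complex^'m^'m"
  assumes "adj X = - X"
  shows "adj (mexp X) = mexp (- X)"
proof -
  have "adj (mexp X) = adj (mexp X) ** (mexp X ** mexp (- X))"
    by (simp add: mexp_mult_minus)
  also have "\<dots> = mexp (- X)"
    using unitary_groupD(1)[OF mexp_unitary[OF assms]] by (simp add: matrix_mul_assoc)
  finally show ?thesis .
qed

lemma mexp_SU: "X \<in> su \<Longrightarrow> mexp X \<in> SU"
  by (simp add: su_def SU_def mexp_unitary det_mexp)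

lemma su_scaleR: "X \<in> su \<Longrightarrow> t *\<^sub>R X \<in> su"
  by (simp add: su_def adj_scaleR trace_scaleR)

section \<open>Smooth maps and the derivative of a representation\<close>

text \<open>The derivative formulas for composites below hold only at points of \<open>U\<close>,
  whereas \<open>frechet_derivative\<close> is a total function; openness of \<open>U\<close> makes
  its values there depend on the function on \<open>U\<close> alone.\<close>

lemma Ck_on_cong:
  assumes "open U" "\<And>x. x \<in> U \<Longrightarrow> f x = g x" "Ck_on m U f"
  shows "Ck_on m U g"
  using assms(2,3)
proof (induction m arbitrary: f g)
  case 0
  then show ?case
    using continuous_on_cong[of U U f g] by auto
next
  case (Suc m)
  have d: "(g has_derivative frechet_derivative f (at x)) (at x)"
    if "f differentiable (at x)" "x \<in> U" for x
    using has_derivative_transform_within_open[OF _ assms(1) that(2) Suc.prems(1)] that(1)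
    by (simp add: frechet_derivative_works)
  have "Ck_on m U (\<lambda>x. frechet_derivative g (at x) v)" for v
  proof (rule Suc.IH)
    show "Ck_on m U (\<lambda>x. frechet_derivative f (at x) v)"
      using Suc.prems(2) by simp
    fix x assume "x \<in> U"
    then show "frechet_derivative f (at x) v = frechet_derivative g (at x) v"
      using d[of x] Suc.prems(2) frechet_derivative_at by fastforce
  qed
  moreover have "g differentiable (at x)" if "x \<in> U" for x
    using d[OF _ that] Suc.prems(2) that by (auto simp: differentiable_def[of g])
  ultimately show ?case
    by simp
qed

lemma Ck_on_linear_left:
  assumes "open U" "linear L" "Ck_on m U f"
  shows "Ck_on m U (\<lambda>x. L (f x))"
  using assms(3)
proof (induction m arbitrary: f)
  case 0
  then show ?case
    using linear_continuous_on_compose[OF _ assms(2)] by simp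
next
  case (Suc m)
  have d: "((\<lambda>x. L (f x)) has_derivative (\<lambda>v. L (frechet_derivative f (at x) v))) (at x)" if "x \<in> U" for x
    using Suc.prems that bounded_linear.has_derivative[of L f _ "at x"] assms(2)
    by (simp add: linear_conv_bounded_linear frechet_derivative_works)
  have "Ck_on m U (\<lambda>x. frechet_derivative (\<lambda>x. L (f x)) (at x) v)" for v
  proof (rule Ck_on_cong[OF assms(1)])
    show "Ck_on m U (\<lambda>x. L (frechet_derivative f (at x) v))"
      using Suc by simp
    fix x assume "x \<in> U"
    then show "L (frechet_derivative f (at x) v) = frechet_derivative (\<lambda>x. L (f x)) (at x) v"
      using frechet_derivative_at[OF d[of x]] by metis
  qed
  moreover have "(\<lambda>x. L (f x)) differentiable (at x)" if "x \<in> U" for x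
    using d[OF that] unfolding differentiable_def by blast
  ultimately show ?case
    by simp
qed

lemma Ck_on_linear_right:
  assumes "open U" "linear A" "Ck_on m U f"
  shows "Ck_on m (A -` U) (\<lambda>x. f (A x))"
  using assms(3)
proof (induction m arbitrary: f)
  case 0
  have "continuous_on (A -` U) A"
    using linear_continuous_on[of A] assms(2) by (simp add: linear_conv_bounded_linear)
  then show ?case
    using 0 continuous_on_compose2[of U f "A -` U" A] by auto
next
  case (Suc m)
  have opn: "open (A -` U)"
    using linear_continuous_on[of A UNIV] assms by (simp add: linear_conv_bounded_linear open_vimage)
  have d: "((\<lambda>x. f (A x)) has_derivative (\<lambda>v. frechet_derivative f (at (A x)) (A v))) (at x)"
    if "A x \<in> U" for x
    using Suc.prems that has_derivative_compose[of A A x UNIV f] assms(2)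
      bounded_linear_imp_has_derivative[of A "at x"]
    by (simp add: linear_conv_bounded_linear frechet_derivative_works)
  have "Ck_on m (A -` U) (\<lambda>x. frechet_derivative (\<lambda>x. f (A x)) (at x) v)" for v
  proof (rule Ck_on_cong[OF opn])
    show "Ck_on m (A -` U) (\<lambda>x. frechet_derivative f (at (A x)) (A v))"
      using Suc.IH[of "\<lambda>x. frechet_derivative f (at x) (A v)"] Suc.prems by simp
    fix x assume "x \<in> A -` U"
    then show "frechet_derivative f (at (A x)) (A v) = frechet_derivative (\<lambda>x. f (A x)) (at x) v"
      using frechet_derivative_at[OF d[of x]] by (metis vimageD)
  qed
  moreover have "(\<lambda>x. f (A x)) differentiable (at x)" if "x \<in> A -` U" for x
    using d[of x] that unfolding differentiable_def by blast
  ultimately show ?case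
    by simp
qed

lemma smooth_on_set_linear_left:
  assumes "linear L" "smooth_on_set S f"
  shows "smooth_on_set S (\<lambda>x. L (f x))"
  unfolding smooth_on_set_def
proof
  fix x assume "x \<in> S"
  then obtain U F where "open U" "x \<in> U" "\<forall>m. Ck_on m U F" "\<forall>y\<in>S \<inter> U. F y = f y"
    using assms(2) unfolding smooth_on_set_def by blast
  then show "\<exists>U F. open U \<and> x \<in> U \<and> (\<forall>m. Ck_on m U F) \<and> (\<forall>y\<in>S \<inter> U. F y = L (f y))"
    by (intro exI[of _ U] exI[of _ "\<lambda>x. L (F x)"]) (auto intro: Ck_on_linear_left[OF _ assms(1)])
qed

lemma smooth_on_set_linear_right:
  assumes "linear A" "A ` S \<subseteq> S" "smooth_on_set S f"
  shows "smooth_on_set S (\<lambda>x. f (A x))"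
  unfolding smooth_on_set_def
proof
  fix x assume "x \<in> S"
  then have "A x \<in> S"
    using assms(2) by blast
  then obtain U F where U: "open U" "A x \<in> U" "\<forall>m. Ck_on m U F" "\<forall>y\<in>S \<inter> U. F y = f y"
    using assms(3) unfolding smooth_on_set_def by blast
  have "open (A -` U)"
    using linear_continuous_on[of A UNIV] assms(1) U(1) by (simp add: linear_conv_bounded_linear open_vimage)
  then show "\<exists>U F. open U \<and> x \<in> U \<and> (\<forall>m. Ck_on m U F) \<and> (\<forall>y\<in>S \<inter> U. F y = f (A y))"
    using Ck_on_linear_right[OF U(1) assms(1)] U assms(2)
    by (intro exI[of _ "A -` U"] exI[of _ "\<lambda>x. F (A x)"]) auto
qed

lemma smooth_on_set_cong:
  assumes "smooth_on_set S f" "\<And>x. x \<in> S \<Longrightarrow> f x = g x"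
  shows "smooth_on_set S g"
  using assms unfolding smooth_on_set_def by (metis IntD1)

text \<open>\<open>D\<close> is the derivative of a local extension to the ambient space. It depends
  on the extension, but on velocities of curves in \<open>S\<close> it is determined by
  \<open>f\<close>, and it is linear on the whole ambient space.\<close>

lemma smooth_on_set_curve_derivative:
  assumes "smooth_on_set S f" "p \<in> S"
  obtains D where "linear D"
    "\<And>c Y. (\<And>t. c t \<in> S) \<Longrightarrow> c 0 = p \<Longrightarrow> (c has_vector_derivative Y) (at 0) \<Longrightarrow>
      ((\<lambda>t::real. f (c t)) has_vector_derivative D Y) (at 0)"
proof -
  obtain U F where U: "open U" "p \<in> U" "\<forall>m. Ck_on m U F" "\<forall>y\<in>S \<inter> U. F y = f y"
    using assms unfolding smooth_on_set_def by blast
  define D where "D = frechet_derivative F (at p)"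
  have "Ck_on (Suc 0) U F"
    using U(3) by blast
  then have D: "(F has_derivative D) (at p)"
    using U(2) by (simp add: D_def frechet_derivative_works)
  show ?thesis
  proof (rule that)
    show "linear D"
      using D has_derivative_linear by blast
    fix c :: "real \<Rightarrow> 'a" and Y
    assume c: "\<And>t. c t \<in> S" "c 0 = p" "(c has_vector_derivative Y) (at 0)"
    have "((F \<circ> c) has_vector_derivative D Y) (at 0)"
      using vector_derivative_diff_chain_within[of c Y 0 UNIV F D] c D
      by (auto intro: has_derivative_at_withinI)
    \<comment> \<open>By continuity the curve stays for small t in the neighbourhood on which the
      extension agrees with \<open>f\<close>.\<close>
    moreover have "\<forall>\<^sub>F t in at 0. (F \<circ> c) t = f (c t)"
    proof -
      have "c \<midarrow>0\<rightarrow> p"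
        using has_vector_derivative_continuous[OF c(3)] c(2) by (simp add: isCont_def)
      then have "\<forall>\<^sub>F t in at 0. c t \<in> U"
        using U(1,2) by (rule topological_tendstoD)
      then show ?thesis
        by eventually_elim (use U(4) c(1) in auto)
    qed
    ultimately show "((\<lambda>t. f (c t)) has_vector_derivative D Y) (at 0)"
      unfolding has_vector_derivative_def
      using has_derivative_transform_eventually[of "F \<circ> c" _ 0 UNIV "\<lambda>t. f (c t)"] U c by auto
  qed
qed

section \<open>The differential of a representation of the special unitary group\<close>

lemma su_bracket: "X \<in> su \<Longrightarrow> Y \<in> su \<Longrightarrow> X ** Y - Y ** X \<in> su" for X Y :: "complex^'m^'m"
  by (simp add: su_def adj_diff adj_mult trace_commutator matrix_mult_minus_left matrix_mult_minus_right)

lemma su_conj: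
  assumes "g \<in> SU" "Y \<in> su"
  shows "g ** Y ** adj g \<in> su"
proof -
  have "adj (g ** Y ** adj g) = - (g ** Y ** adj g)"
    using assms by (simp add: su_def adj_mult matrix_mul_assoc matrix_mult_minus_left matrix_mult_minus_right)
  moreover have "trace (g ** Y ** adj g) = trace (Y ** adj g ** g)"
    using trace_mul_sym[of g "Y ** adj g"] by (simp add: matrix_mul_assoc)
  then have "trace (g ** Y ** adj g) = 0"
    using assms unitary_groupD(1)[OF SU_unitary[OF assms(1)]]
    by (simp add: matrix_mul_assoc[symmetric] su_def)
  ultimately show ?thesis
    by (simp add: su_def)
qed

lemma has_vector_derivative_mexp_0: "((\<lambda>t. mexp (t *\<^sub>R Y)) has_vector_derivative Y) (at 0)"
  for Y :: "complex^'m^'m"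
  using has_vector_derivative_mexp[of Y 0] by simp

locale smooth_rep =
  fixes \<pi> :: "complex^'m^'m \<Rightarrow> complex^'d^'d"
  assumes rep: "SU_rep \<pi>"
begin

lemma rep_mat1: "\<pi> (mat 1) = mat 1"
  and rep_mult: "g \<in> SU \<Longrightarrow> h \<in> SU \<Longrightarrow> \<pi> (g ** h) = \<pi> g ** \<pi> h"
  using rep by (auto simp: SU_rep_def)

lemma rep_adj: "g \<in> SU \<Longrightarrow> \<pi> (adj g) ** \<pi> g = mat 1"
  using rep_mult[of "adj g" g] SU_adj[of g] unitary_groupD(1)[of g]
  by (auto simp: rep_mat1 SU_unitary)

text \<open>The differential at the identity, chosen as a real linear map on all matrices. Only its
  values on \<open>su\<close> are meaningful; they are determined by the curve property.\<close>

definition dpi where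
  "dpi = (SOME D. linear D \<and> (\<forall>c Y. (\<forall>t. c t \<in> SU) \<longrightarrow> c 0 = mat 1 \<longrightarrow>
      (c has_vector_derivative Y) (at 0) \<longrightarrow>
      ((\<lambda>t::real. \<pi> (c t)) has_vector_derivative D Y) (at 0)))"

lemma linear_dpi: "linear dpi"
  and dpi_curve: "\<lbrakk>\<And>t. c t \<in> SU; c 0 = mat 1; (c has_vector_derivative Y) (at 0)\<rbrakk> \<Longrightarrow>
      ((\<lambda>t::real. \<pi> (c t)) has_vector_derivative dpi Y) (at 0)"
proof -
  have "smooth_on_set SU \<pi>"
    using rep by (simp add: SU_rep_def)
  from smooth_on_set_curve_derivative[OF this SU_mat1]
  have "\<exists>D. linear D \<and> (\<forall>c Y. (\<forall>t. c t \<in> SU) \<longrightarrow> c 0 = mat 1 \<longrightarrow>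
      (c has_vector_derivative Y) (at 0) \<longrightarrow>
      ((\<lambda>t::real. \<pi> (c t)) has_vector_derivative D Y) (at 0))"
    by metis
  from someI_ex[OF this, folded dpi_def]
  show "linear dpi" and "\<lbrakk>\<And>t. c t \<in> SU; c 0 = mat 1; (c has_vector_derivative Y) (at 0)\<rbrakk> \<Longrightarrow>
      ((\<lambda>t::real. \<pi> (c t)) has_vector_derivative dpi Y) (at 0)"
    by auto
qed

lemma dpi_mexp:
  "Y \<in> su \<Longrightarrow> ((\<lambda>t::real. \<pi> (mexp (t *\<^sub>R Y))) has_vector_derivative dpi Y) (at 0)"
  by (rule dpi_curve) (auto simp: mexp_SU su_scaleR has_vector_derivative_mexp_0)

lemma dpi_conj:
  assumes "g \<in> SU" "Y \<in> su"
  shows "dpi (g ** Y ** adj g) = \<pi> g ** dpi Y ** \<pi> (adj g)"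
proof (rule vector_derivative_unique)
  let ?c = "\<lambda>t::real. g ** mexp (t *\<^sub>R Y) ** adj g"
  have SU: "mexp (t *\<^sub>R Y) \<in> SU" for t
    using assms by (simp add: mexp_SU su_scaleR)
  have "(?c has_vector_derivative g ** Y ** adj g) (at 0)"
    using has_vector_derivative_matrix_mult[OF has_vector_derivative_matrix_mult[OF
          has_vector_derivative_const has_vector_derivative_mexp_0] has_vector_derivative_const,
        of g Y "adj g"]
    by (simp add: matrix_mult_zero_left matrix_mult_zero_right)
  then show "((\<lambda>t. \<pi> (?c t)) has_vector_derivative dpi (g ** Y ** adj g)) (at 0)"
    using assms SU unitary_groupD(2)[of g] by (intro dpi_curve) (auto simp: SU_mult SU_adj SU_unitary)
  have "((\<lambda>t. \<pi> g ** \<pi> (mexp (t *\<^sub>R Y)) ** \<pi> (adj g)) has_vector_derivative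
      \<pi> g ** dpi Y ** \<pi> (adj g)) (at 0)"
    using has_vector_derivative_matrix_mult[OF has_vector_derivative_matrix_mult[OF
          has_vector_derivative_const dpi_mexp] has_vector_derivative_const,
        of Y "\<pi> g" "\<pi> (adj g)"] assms
    by (simp add: matrix_mult_zero_left matrix_mult_zero_right)
  then show "((\<lambda>t. \<pi> (?c t)) has_vector_derivative \<pi> g ** dpi Y ** \<pi> (adj g)) (at 0)"
    using assms SU by (simp add: rep_mult SU_mult SU_adj)
qed

text \<open>This is the derivative at t = 0 of \<open>dpi_conj\<close> for g = exp(tX): the left
  side differentiates to the matrix commutator, the right side to the commutator of the
  operators.\<close>

lemma dpi_bracket:
  assumes "X \<in> su" "Y \<in> su"
  shows "dpi (X ** Y - Y ** X) = dpi X ** dpi Y - dpi Y ** dpi X"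
proof (rule vector_derivative_unique)
  have SU: "mexp (t *\<^sub>R X) \<in> SU" for t
    using assms by (simp add: mexp_SU su_scaleR)
  have adj: "adj (mexp (t *\<^sub>R X)) = mexp (t *\<^sub>R (- X))" for t
    using adj_mexp[of "t *\<^sub>R X"] su_scaleR[OF assms(1), of t] by (simp add: su_def)
  have "((\<lambda>t. mexp (t *\<^sub>R X) ** Y ** mexp (t *\<^sub>R (- X))) has_vector_derivative
      (X ** Y - Y ** X)) (at 0)"
    using has_vector_derivative_matrix_mult[OF has_vector_derivative_matrix_mult[OF
          has_vector_derivative_mexp_0 has_vector_derivative_const] has_vector_derivative_mexp_0,
        of X Y "- X"]
    by (simp add: matrix_mult_zero_left matrix_mult_zero_right matrix_mult_minus_right)
  from has_vector_derivative_linear[OF linear_dpi this]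
  show "((\<lambda>t. dpi (mexp (t *\<^sub>R X) ** Y ** mexp (t *\<^sub>R (- X)))) has_vector_derivative
      dpi (X ** Y - Y ** X)) (at 0)" .
  have "- X \<in> su"
    using su_scaleR[OF assms(1), of "-1"] by simp
  then have "((\<lambda>t. \<pi> (mexp (t *\<^sub>R X)) ** dpi Y ** \<pi> (mexp (t *\<^sub>R (- X)))) has_vector_derivative
      dpi X ** dpi Y - dpi Y ** dpi X) (at 0)"
    using has_vector_derivative_matrix_mult[OF has_vector_derivative_matrix_mult[OF
          dpi_mexp[OF assms(1)] has_vector_derivative_const] dpi_mexp, of "- X" "dpi Y"]
    by (simp add: matrix_mult_zero_left matrix_mult_zero_right matrix_mult_minus_right
        linear_neg[OF linear_dpi] rep_mat1)
  then show "((\<lambda>t. dpi (mexp (t *\<^sub>R X) ** Y ** mexp (t *\<^sub>R (- X)))) has_vector_derivative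
      dpi X ** dpi Y - dpi Y ** dpi X) (at 0)"
    using dpi_conj[OF SU assms(2)] by (simp add: adj)
qed

end

text \<open>The extension of \<open>dpi\<close> from su(n+1) to all complex matrices is complex linear and vanishes on
  the scalar matrices.\<close>

definition traceless :: "complex^'m^'m \<Rightarrow> complex^'m^'m" where
  "traceless M = M - cscale (trace M / of_nat CARD('m)) (mat 1)"

definition skew :: "complex^'m^'m \<Rightarrow> complex^'m^'m" where
  "skew M = (1 / 2) *\<^sub>R (M - adj M)"

lemma trace_mat1: "trace (mat 1 :: complex^'m^'m) = of_nat CARD('m)"
  by (simp add: trace_def mat_def)

lemma trace_traceless: "trace (traceless M) = 0"
  by (simp add: traceless_def trace_sub trace_cscale trace_mat1)

lemma traceless_add: "traceless (A + B) = traceless A + traceless B"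
  and traceless_cscale: "traceless (cscale c A) = cscale c (traceless A)"
  and traceless_mat1: "traceless (mat 1) = 0"
  by (simp_all add: traceless_def trace_add trace_cscale trace_mat1 add_divide_distrib
      cscale_add_left cscale_diff_right)

lemma traceless_su: "X \<in> su \<Longrightarrow> traceless X = X"
  by (simp add: traceless_def su_def)

lemma skew_add: "skew (A + B) = skew A + skew B"
  and skew_scaleR: "skew (r *\<^sub>R A) = r *\<^sub>R skew A"
  by (simp_all add: skew_def adj_add adj_scaleR algebra_simps)

lemma skew_su: "trace A = 0 \<Longrightarrow> skew A \<in> su"
  by (simp add: su_def skew_def adj_scaleR adj_diff trace_scaleR trace_sub trace_adj
      flip: scaleR_minus_right)

lemma skew_ident: "X \<in> su \<Longrightarrow> skew X = X"
  by (simp add: su_def skew_def flip: scaleR_2)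

lemma skew_i_ident: "X \<in> su \<Longrightarrow> skew (cscale (- \<i>) X) = 0"
  by (simp add: su_def skew_def adj_minus adj_cscale cscale_uminus_right cscale_uminus)

text \<open>The second summand is the Hermitian part (A + adj A)/2, written as i times a
  skew-Hermitian matrix so that \<open>dpi\<close> can be applied to both pieces.\<close>

lemma skew_decomp: "A = skew A + cscale \<i> (skew (cscale (- \<i>) A))"
  by (simp add: vec_eq_iff skew_def scaleR_conv_of_real[where 'a = complex] algebra_simps)

context smooth_rep
begin

definition delta :: "complex^'m^'m \<Rightarrow> complex^'d^'d" where
  "delta M = dpi (skew (traceless M)) + cscale \<i> (dpi (skew (cscale (- \<i>) (traceless M))))"

lemma delta_su: "X \<in> su \<Longrightarrow> delta X = dpi X"
  using linear_0[OF linear_dpi]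
  by (simp add: delta_def traceless_su skew_ident skew_i_ident)

lemma delta_mat1: "delta (mat 1) = 0"
proof -
  have "skew 0 = (0 :: complex^'m^'m)"
    by (simp add: skew_def vec_eq_iff)
  then show ?thesis
    by (simp add: delta_def traceless_mat1 linear_0[OF linear_dpi])
qed

lemma delta_add: "delta (A + B) = delta A + delta B"
  by (simp add: delta_def traceless_add cscale_add_right skew_add linear_add[OF linear_dpi])

lemma delta_scaleR: "delta (r *\<^sub>R A) = r *\<^sub>R delta A"
proof -
  have "traceless (r *\<^sub>R A) = r *\<^sub>R traceless A"
    using traceless_cscale[of "of_real r"] by simp
  then show ?thesis
    by (simp add: delta_def cscale_scaleR skew_scaleR linear_scale[OF linear_dpi] scaleR_add_right
        del: cscale_simps(5))
qed

text \<open>Multiplication by i exchanges the two skew-Hermitian components of a matrix, up to one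
  sign.\<close>

lemma delta_i: "delta (cscale \<i> A) = cscale \<i> (delta A)"
proof -
  have "skew (cscale \<i> B) = - skew (cscale (- \<i>) B)" for B :: "complex^'m^'m"
    by (simp add: vec_eq_iff skew_def scaleR_conv_of_real[where 'a = complex] algebra_simps)
  then show ?thesis
    by (simp add: delta_def traceless_cscale linear_neg[OF linear_dpi] cscale_add_right cscale_uminus)
qed

lemma delta_cscale: "delta (cscale c A) = cscale c (delta A)"
proof -
  have e: "cscale c B = Re c *\<^sub>R B + Im c *\<^sub>R cscale \<i> B" for B :: "complex^'z^'y"
    by (simp add: vec_eq_iff complex_eq_iff)
  show ?thesis
    by (simp only: e delta_add delta_scaleR delta_i)
qed

lemma linear_delta: "linear delta"
  by (rule linearI) (simp_all add: delta_add delta_scaleR)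

lemmas delta_linear_simps = delta_add delta_cscale delta_scaleR linear_0[OF linear_delta]
  linear_neg[OF linear_delta] linear_diff[OF linear_delta] linear_sum[OF linear_delta]

lemma delta_traceless: "delta (traceless M) = delta M"
  by (simp add: traceless_def delta_linear_simps delta_mat1)

lemma matrix_decomp_su:
  obtains X Y where "X \<in> su" "Y \<in> su" "traceless M = X + cscale \<i> Y"
    "delta M = dpi X + cscale \<i> (dpi Y)"
proof
  show "skew (traceless M) \<in> su" "skew (cscale (- \<i>) (traceless M)) \<in> su"
    by (simp_all add: skew_su trace_traceless trace_cscale del: cscale_uminus)
qed (rule skew_decomp, rule delta_def)

lemma delta_conj:
  assumes "g \<in> SU"
  shows "delta (g ** M ** adj g) = \<pi> g ** delta M ** \<pi> (adj g)"
proof -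
  obtain X Y where XY: "X \<in> su" "Y \<in> su" "traceless M = X + cscale \<i> Y"
    "delta M = dpi X + cscale \<i> (dpi Y)"
    using matrix_decomp_su .
  have "delta (g ** M ** adj g) = delta (g ** traceless M ** adj g)"
    using unitary_groupD(2)[OF SU_unitary[OF assms]]
    by (simp add: traceless_def matrix_mult_diff_left matrix_mult_diff_right cscale_mult_left
        cscale_mult_right delta_linear_simps delta_mat1)
  also have "\<dots> = delta (g ** X ** adj g) + cscale \<i> (delta (g ** Y ** adj g))"
    by (simp add: XY matrix_mult_add_left matrix_mult_add_right cscale_mult_left cscale_mult_right
        delta_linear_simps)
  also have "\<dots> = \<pi> g ** delta M ** \<pi> (adj g)"
    using XY assms by (simp add: delta_su su_conj dpi_conj matrix_mult_add_left
        matrix_mult_add_right cscale_mult_left cscale_mult_right)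
  finally show ?thesis .
qed

lemma delta_bracket: "delta (A ** B - B ** A) = delta A ** delta B - delta B ** delta A"
proof -
  obtain X Y where XY: "X \<in> su" "Y \<in> su" "traceless A = X + cscale \<i> Y"
    "delta A = dpi X + cscale \<i> (dpi Y)"
    using matrix_decomp_su .
  obtain X' Y' where XY': "X' \<in> su" "Y' \<in> su" "traceless B = X' + cscale \<i> Y'"
    "delta B = dpi X' + cscale \<i> (dpi Y')"
    using matrix_decomp_su .
  \<comment> \<open>Scalar matrices are central, so the commutator does not change when both
    matrices are made traceless.\<close>
  have "A ** B - B ** A = traceless A ** traceless B - traceless B ** traceless A"
    by (simp add: traceless_def matrix_mult_diff_left matrix_mult_diff_right cscale_mult_left
        cscale_mult_right cscale_diff_right mult.commute algebra_simps)
  also have "\<dots> = (X ** X' - X' ** X) - (Y ** Y' - Y' ** Y) + cscale \<i> ((X ** Y' - Y' ** X) + (Y ** X' - X' ** Y))"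
    by (simp add: XY XY' matrix_mult_add_left matrix_mult_add_right cscale_mult_left
        cscale_mult_right cscale_add_right cscale_diff_right cscale_uminus)
  finally have "delta (A ** B - B ** A) = dpi (X ** X' - X' ** X) - dpi (Y ** Y' - Y' ** Y)
      + cscale \<i> (dpi (X ** Y' - Y' ** X) + dpi (Y ** X' - X' ** Y))"
    using XY(1,2) XY'(1,2)
    by (simp add: delta_add delta_cscale linear_diff[OF linear_delta, of "X ** X' - X' ** X"]
        delta_su[OF su_bracket])
  also have "\<dots> = delta A ** delta B - delta B ** delta A"
    using XY(1,2) XY'(1,2)
    by (simp add: XY(4) XY'(4) dpi_bracket matrix_mult_add_left matrix_mult_add_right cscale_mult_left
        cscale_mult_right cscale_add_right cscale_diff_right cscale_uminus)
  finally show ?thesis .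
qed

end

section \<open>The Casimir operator\<close>

definition unit_mat :: "'m \<Rightarrow> 'm \<Rightarrow> complex^'m^'m" where
  "unit_mat i j = (\<chi> k l. if k = i \<and> l = j then 1 else 0)"

lemma unit_mat_nth: "unit_mat i j $ k $ l = (if k = i \<and> l = j then 1 else 0)"
  by (simp add: unit_mat_def)

lemma unit_mat_mult: "unit_mat i j ** unit_mat k l = (if j = k then unit_mat i l else 0)"
proof -
  have "(\<Sum>m\<in>UNIV. unit_mat i j $ a $ m * unit_mat k l $ m $ b) =
      (\<Sum>m\<in>UNIV. if m = j then (if a = i \<and> j = k \<and> b = l then 1 else 0) else 0)" for a b
    by (intro sum.cong) (auto simp: unit_mat_nth)
  then show ?thesis
    by (auto simp: vec_eq_iff matrix_matrix_mult_def unit_mat_nth)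
qed

lemma matrix_unit_expansion: "M = (\<Sum>i\<in>UNIV. \<Sum>j\<in>UNIV. cscale (M $ i $ j) (unit_mat i j))"
proof -
  have "(\<Sum>i\<in>UNIV. \<Sum>j\<in>UNIV. cscale (M $ i $ j) (unit_mat i j)) $ a $ b = M $ a $ b" for a b
  proof -
    have "(\<Sum>i\<in>UNIV. \<Sum>j\<in>UNIV. M $ i $ j * unit_mat i j $ a $ b) =
        (\<Sum>i\<in>UNIV. if i = a then \<Sum>j\<in>UNIV. if j = b then M $ a $ b else 0 else 0)"
      by (intro sum.cong) (auto simp: unit_mat_nth if_distrib[of "(*) _"] cong: if_cong)
    also have "\<dots> = M $ a $ b"
      by simp
    finally show ?thesis
      by simp
  qed
  note entry = this
  show ?thesis
    by (intro vec_eq_iff[THEN iffD2] allI) (rule entry[symmetric])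
qed

lemma mat1_unit: "mat 1 = (\<Sum>i\<in>UNIV. unit_mat i i :: complex^'m^'m)"
proof -
  have "(\<Sum>i\<in>UNIV. unit_mat i i $ a $ b) = (\<Sum>i\<in>UNIV. if i = a then (if a = b then 1 else 0) else 0)" for a b :: 'm
    by (intro sum.cong) (auto simp: unit_mat_nth)
  then show ?thesis
    by (simp add: vec_eq_iff mat_def)
qed

lemma matrix_vector_sum_left: "sum f S *v v = (\<Sum>i\<in>S. f i *v v)" for f :: "'i \<Rightarrow> complex^'m^'k"
  by (induction S rule: infinite_finite_induct) (simp_all add: matrix_vector_mult_add_rdistrib)

lemma sum_swap3:
  "(\<Sum>i\<in>I. \<Sum>a\<in>A. \<Sum>b\<in>B. f i a b) = (\<Sum>a\<in>A. \<Sum>b\<in>B. \<Sum>i\<in>I. f i a b)"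
  by (rule trans[OF sum.swap]) (intro sum.cong refl sum.swap)

lemma sum_swap4:
  "(\<Sum>i\<in>I. \<Sum>j\<in>J. \<Sum>a\<in>A. \<Sum>b\<in>B. f i j a b) = (\<Sum>a\<in>A. \<Sum>b\<in>B. \<Sum>i\<in>I. \<Sum>j\<in>J. f i j a b)"
  by (rule trans[OF sum.cong[OF refl sum_swap3] sum_swap3])

lemma matrix_mult_sum_sum: "sum f S ** sum g T = (\<Sum>a\<in>S. \<Sum>b\<in>T. f a ** g b)"
  for f :: "'i \<Rightarrow> complex^'m^'k" and g :: "'j \<Rightarrow> complex^'l^'m"
  by (subst matrix_mult_sum_left) (intro sum.cong refl matrix_mult_sum_right)

lemma cscale_sum_left: "cscale (sum f S) A = (\<Sum>i\<in>S. cscale (f i) A)"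
  by (simp add: vec_eq_iff sum_distrib_right)

context smooth_rep
begin

text \<open>The units (i,j) and (j,i) form dual bases for the trace form on all matrices. Since
  \<open>delta\<close> kills the identity, the scalar direction contributes nothing and this is the
  Casimir operator of the special unitary Lie algebra.\<close>

definition casimir :: "complex^'d^'d" where
  "casimir = (\<Sum>i\<in>UNIV. \<Sum>j\<in>UNIV. delta (unit_mat i j) ** delta (unit_mat j i))"

text \<open>Conjugation by g expands each unit with coefficients from g and its conjugate. Summing
  over the original indices contracts these coefficients by unitarity and restores the same
  sum.\<close>

lemma casimir_conj:
  assumes g: "g \<in> SU"
  shows "\<pi> g ** casimir ** \<pi> (adj g) = casimir"
proof -
  let ?E = "\<lambda>a. delta (unit_mat (fst a) (snd a))"
  have conj: "\<pi> g ** delta (unit_mat i j) ** \<pi> (adj g) =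
      (\<Sum>a\<in>UNIV. cscale (g $ fst a $ i * cnj (g $ snd a $ j)) (?E a))" for i j
  proof -
    have e: "(g ** unit_mat i j ** adj g) $ k $ l = g $ k $ i * cnj (g $ l $ j)" for k l
    proof -
      have "(\<Sum>q\<in>UNIV. (\<Sum>p\<in>UNIV. g $ k $ p * unit_mat i j $ p $ q) * cnj (g $ l $ q)) =
          (\<Sum>q\<in>UNIV. if q = j then (\<Sum>p\<in>UNIV. if p = i then g $ k $ i else 0) * cnj (g $ l $ j) else 0)"
        by (intro sum.cong) (auto simp: unit_mat_nth if_distrib[of "(*) _"] cong: if_cong)
      then show ?thesis
        by (simp add: matrix_matrix_mult_def)
    qed
    have "\<pi> g ** delta (unit_mat i j) ** \<pi> (adj g) = delta (g ** unit_mat i j ** adj g)"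
      using delta_conj[OF g] by simp
    also have "\<dots> = (\<Sum>k\<in>UNIV. \<Sum>l\<in>UNIV. cscale (g $ k $ i * cnj (g $ l $ j)) (delta (unit_mat k l)))"
      by (subst matrix_unit_expansion) (simp add: e delta_linear_simps del: cscale_simps)
    also have "\<dots> = (\<Sum>a\<in>UNIV. cscale (g $ fst a $ i * cnj (g $ snd a $ j)) (?E a))"
      by (simp add: sum.cartesian_product split_beta)
    finally show ?thesis .
  qed
  have orth: "(\<Sum>i\<in>UNIV. g $ k $ i * cnj (g $ l $ i)) = (if k = l then 1 else 0)" for k l
  proof -
    have "(g ** adj g) $ k $ l = (if k = l then 1 else 0)"
      using unitary_groupD(2)[OF SU_unitary[OF g]] by (simp add: mat_def)
    then show ?thesis
      by (simp add: matrix_matrix_mult_def)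
  qed
  have "\<pi> g ** casimir ** \<pi> (adj g) = (\<Sum>i\<in>UNIV. \<Sum>j\<in>UNIV.
      (\<pi> g ** delta (unit_mat i j) ** \<pi> (adj g)) ** (\<pi> g ** delta (unit_mat j i) ** \<pi> (adj g)))"
  proof -
    have "(\<pi> g ** A ** \<pi> (adj g)) ** (\<pi> g ** B ** \<pi> (adj g)) = \<pi> g ** (A ** B) ** \<pi> (adj g)" for A B
    proof -
      have "(\<pi> g ** A ** \<pi> (adj g)) ** (\<pi> g ** B ** \<pi> (adj g)) =
          \<pi> g ** A ** (\<pi> (adj g) ** \<pi> g) ** B ** \<pi> (adj g)"
        by (simp only: matrix_mul_assoc)
      then show ?thesis
        by (simp add: rep_adj[OF g] matrix_mul_assoc)
    qed
    then show ?thesis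
      by (simp add: casimir_def matrix_mult_sum_left matrix_mult_sum_right)
  qed
  also have "\<dots> = (\<Sum>i\<in>UNIV. \<Sum>j\<in>UNIV. \<Sum>a\<in>UNIV. \<Sum>b\<in>UNIV.
      cscale ((g $ fst a $ i * cnj (g $ snd b $ i)) * (g $ fst b $ j * cnj (g $ snd a $ j))) (?E a ** ?E b))"
    by (intro sum.cong refl)
      (simp add: conj matrix_mult_sum_sum cscale_mult_left cscale_mult_right mult_ac)
  also have "\<dots> = (\<Sum>a\<in>UNIV. \<Sum>b\<in>UNIV. \<Sum>i\<in>UNIV. \<Sum>j\<in>UNIV.
      cscale ((g $ fst a $ i * cnj (g $ snd b $ i)) * (g $ fst b $ j * cnj (g $ snd a $ j))) (?E a ** ?E b))"
    by (rule sum_swap4)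
  also have "\<dots> = (\<Sum>a\<in>UNIV. \<Sum>b\<in>UNIV. cscale ((\<Sum>i\<in>UNIV. g $ fst a $ i * cnj (g $ snd b $ i)) *
      (\<Sum>j\<in>UNIV. g $ fst b $ j * cnj (g $ snd a $ j))) (?E a ** ?E b))"
    by (simp only: sum_product cscale_sum_left)
  \<comment> \<open>Orthonormality of the rows leaves only the terms with fst a = snd b and fst b =
    snd a.\<close>
  also have "\<dots> = (\<Sum>a\<in>UNIV. \<Sum>b\<in>UNIV. if b = (snd a, fst a) then ?E a ** ?E b else 0)"
    unfolding orth by (intro sum.cong) (auto simp: prod_eq_iff)
  also have "\<dots> = casimir"
    by (simp add: casimir_def sum.cartesian_product split_beta)
  finally show ?thesis .
qed

lemma casimir_commute: "g \<in> SU \<Longrightarrow> casimir ** \<pi> g = \<pi> g ** casimir"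
proof -
  assume g: "g \<in> SU"
  then have "casimir ** \<pi> g = \<pi> g ** casimir ** (\<pi> (adj g) ** \<pi> g)"
    using casimir_conj[OF g] by (simp add: matrix_mul_assoc)
  then show ?thesis
    using rep_adj[OF g] by simp
qed

text \<open>The eigenspace for c is invariant and nonzero, hence everything. The given eigenvector
  takes the place of an argument for the existence of an eigenvalue.\<close>

lemma casimir_irreducible:
  assumes irr: "irreducible_rep \<pi>" and v: "v \<noteq> 0" "casimir *v v = c *s v"
  shows "casimir = cscale c (mat 1)"
proof -
  let ?W = "{w. casimir *v w = c *s w}"
  have "vec.subspace ?W"
    by (intro vec.subspaceI) (auto simp: matrix_vector_right_distrib vector_add_ldistrib
        vector_scalar_commute vector_smult_assoc mult.commute)
  moreover have "\<pi> g *v w \<in> ?W" if "g \<in> SU" "w \<in> ?W" for g w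
    using that casimir_commute[of g]
    by (simp add: matrix_vector_mul_assoc) (simp add: matrix_vector_mul_assoc[symmetric] vector_scalar_commute)
  ultimately have "?W = {0} \<or> ?W = UNIV"
    using irr unfolding irreducible_rep_def by blast
  then have "casimir *v w = cscale c (mat 1) *v w" for w
    using v by (auto simp: cscale_mult_vec)
  then show ?thesis
    by (simp add: matrix_eq)
qed

end

section \<open>Weights\<close>

lemma bij_nth_index: "bij_betw nth_index {1..CARD('m::{finite,linorder})} (UNIV :: 'm set)"
proof -
  let ?xs = "sorted_list_of_set (UNIV :: 'm set)"
  have "bij_betw (\<lambda>i. ?xs ! i) {..<length ?xs} (UNIV :: 'm set)"
    by (rule bij_betw_nth) auto
  moreover have "bij_betw (\<lambda>i. i - 1) {1..CARD('m)} {..<length ?xs}"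
    by (rule bij_betw_byWitness[of _ "\<lambda>i. i + 1"]) auto
  ultimately have "bij_betw ((\<lambda>i. ?xs ! i) \<circ> (\<lambda>i. i - 1)) {1..CARD('m)} (UNIV :: 'm set)"
    using bij_betw_trans by blast
  then show ?thesis
    by (simp add: nth_index_def[abs_def] o_def)
qed

lemma nth_index_inj:
  "i \<in> {1..CARD('m::{finite,linorder})} \<Longrightarrow> j \<in> {1..CARD('m)} \<Longrightarrow>
    nth_index i = (nth_index j :: 'm) \<longleftrightarrow> i = j"
  by (rule inj_on_eq_iff[OF bij_betw_imp_inj_on[OF bij_nth_index]])

lemma sum_nth_index:
  "(\<Sum>a\<in>UNIV. f a) = (\<Sum>i=1..CARD('m). f (nth_index i))" for f :: "'m::{finite,linorder} \<Rightarrow> 'b::comm_monoid_add"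
  using sum.reindex_bij_betw[OF bij_nth_index, of f] by simp

text \<open>The coordinates of a weight with respect to all the \<open>n + 1\<close> forms \<open>\<epsilon>\<^sub>i\<close>, normalised
  to have sum zero.\<close>

definition wcoord :: "nat \<Rightarrow> weight \<Rightarrow> nat \<Rightarrow> real" where
  "wcoord n b i = (if i \<le> n then b i else 0) - (\<Sum>m=1..n. b m) / (real n + 1)"

text \<open>With coordinates normalised to sum zero the formula is the same for all n + 1 forms,
  although the last one has coordinates -1, ..., -1 in the basis of the first n.\<close>

lemma weight_inner_eps:
  assumes "1 \<le> i" "i \<le> n + 1"
  shows "weight_inner n b (eps n i) = - 2 * wcoord n b i"
proof (cases "i = n + 1")
  case True
  then show ?thesis
    by (simp add: weight_inner_def wcoord_def eps_def sum_negf field_simps)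
next
  case False
  then have "i \<in> {1..n}"
    using assms by auto
  then have "(\<Sum>m=1..n. b m * eps n i m) = b i" "(\<Sum>m=1..n. eps n i m) = 1"
    using False by (simp_all add: eps_def if_distrib[of "(*) _"] cong: if_cong)
  then show ?thesis
    using \<open>i \<in> {1..n}\<close> by (simp add: weight_inner_def wcoord_def field_simps)
qed

lemma weight_inner_add: "weight_inner n b (\<lambda>m. c m + d m) = weight_inner n b c + weight_inner n b d"
  by (simp add: weight_inner_def sum.distrib algebra_simps add_divide_distrib)

lemma weight_inner_diff: "weight_inner n b (\<lambda>m. c m - d m) = weight_inner n b c - weight_inner n b d"
  by (simp add: weight_inner_def sum_subtractf algebra_simps diff_divide_distrib)

lemma weight_inner_sum: "weight_inner n b (\<lambda>m. \<Sum>r\<in>R. f r m) = (\<Sum>r\<in>R. weight_inner n b (f r))"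
proof (induction R rule: infinite_finite_induct)
  case (insert r R)
  then show ?case
    by (simp add: weight_inner_add)
qed (simp_all add: weight_inner_def)

lemma weight_inner_root:
  assumes "1 \<le> i" "i \<le> n + 1" "1 \<le> j" "j \<le> n + 1"
  shows "weight_inner n b (root_weight n (i, j)) = - 2 * (wcoord n b i - wcoord n b j)"
  using weight_inner_diff[of n b "eps n i" "eps n j"] assms
  by (simp add: root_weight_def weight_inner_eps)

text \<open>In the normalised coordinates the form becomes -2 times the standard inner product; the
  subtracted square of the sum is the effect of the normalisation.\<close>

lemma weight_inner_self: "weight_inner n b b = - 2 * (\<Sum>i=1..n+1. (wcoord n b i)\<^sup>2)"
proof -
  define s where "s = (\<Sum>m=1..n. b m)"
  have "(\<Sum>i=1..n+1. (wcoord n b i)\<^sup>2) = (\<Sum>i=1..n. (b i - s / (real n + 1))\<^sup>2) + (s / (real n + 1))\<^sup>2"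
    by (simp add: wcoord_def s_def)
  also have "(\<Sum>i=1..n. (b i - s / (real n + 1))\<^sup>2) =
      (\<Sum>i=1..n. b i * b i) - 2 * (s / (real n + 1)) * s + real n * (s / (real n + 1))\<^sup>2"
  proof -
    have "(\<Sum>i=1..n. (b i - x)\<^sup>2) = (\<Sum>i=1..n. b i * b i) - 2 * x * s + real n * x\<^sup>2" for x
    proof -
      have "(b i - x)\<^sup>2 = b i * b i - 2 * x * b i + x\<^sup>2" for i
        by (simp add: power2_eq_square algebra_simps)
      then show ?thesis
        by (simp add: sum.distrib sum_subtractf s_def sum_distrib_left)
    qed
    then show ?thesis .
  qed
  also have "\<dots> + (s / (real n + 1))\<^sup>2 = (\<Sum>i=1..n. b i * b i) - s * s / (real n + 1)"
  proof -
    define x where "x = s / (real n + 1)"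
    have s: "s = x * (real n + 1)"
      by (simp add: x_def)
    have "s * s / (real n + 1) = x * s"
      by (simp add: x_def)
    then show ?thesis
      unfolding x_def[symmetric] by (simp add: s power2_eq_square algebra_simps)
  qed
  finally show ?thesis
    by (simp add: weight_inner_def s_def)
qed

text \<open>The double sum is arranged to match the Casimir operator term by term: its (i,j) entry
  is the scalar by which E_ij E_ji acts on a highest weight vector.\<close>

lemma weight_inner_two_rho_su:
  "weight_inner n b (\<lambda>m. two_rho_su n m + b m) =
    - 2 * (\<Sum>i=1..n+1. \<Sum>j=1..n+1. if i = j then (wcoord n b i)\<^sup>2
      else if i < j then wcoord n b i - wcoord n b j else 0)"
proof -
  have "weight_inner n b (two_rho_su n) =
      (\<Sum>r\<in>pos_roots_su n. weight_inner n b (root_weight n r))"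
    unfolding two_rho_su_def[abs_def] by (rule weight_inner_sum)
  also have "\<dots> = (\<Sum>(i, j)\<in>pos_roots_su n. - 2 * (wcoord n b i - wcoord n b j))"
    by (intro sum.cong) (auto simp: pos_roots_su_def weight_inner_root)
  also have "\<dots> = (\<Sum>(i, j)\<in>{1..n+1} \<times> {1..n+1}. if i < j then - 2 * (wcoord n b i - wcoord n b j) else 0)"
    by (intro sum.mono_neutral_cong_left) (auto simp: pos_roots_su_def split: if_splits)
  also have "\<dots> = - 2 * (\<Sum>i=1..n+1. \<Sum>j=1..n+1. if i < j then wcoord n b i - wcoord n b j else 0)"
    by (simp only: sum.cartesian_product sum_distrib_left) (intro sum.cong, auto)
  finally have 1: "weight_inner n b (two_rho_su n) =
    - 2 * (\<Sum>i=1..n+1. \<Sum>j=1..n+1. if i < j then wcoord n b i - wcoord n b j else 0)" .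
  have "(\<Sum>i=1..n+1. (wcoord n b i)\<^sup>2) = (\<Sum>i=1..n+1. \<Sum>j=1..n+1. if i = j then (wcoord n b i)\<^sup>2 else 0)"
    by (intro sum.cong) auto
  then have "(\<Sum>i=1..n+1. \<Sum>j=1..n+1. if i < j then wcoord n b i - wcoord n b j else 0) + (\<Sum>i=1..n+1. (wcoord n b i)\<^sup>2)
     = (\<Sum>i=1..n+1. \<Sum>j=1..n+1. if i = j then (wcoord n b i)\<^sup>2
      else if i < j then wcoord n b i - wcoord n b j else 0)"
    by (simp only: sum.distrib[symmetric]) (intro sum.cong, auto)
  then show ?thesis
    unfolding weight_inner_add 1 weight_inner_self by argo
qed

lemma weight_inner_two_rho_k:
  "weight_inner n b (two_rho_k n) =
    - 2 * (\<Sum>i=2..n+1. \<Sum>j=2..n+1. if i < j then wcoord n b i - wcoord n b j else 0)"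
proof -
  have "weight_inner n b (two_rho_k n) =
      (\<Sum>r\<in>pos_roots_k n. weight_inner n b (root_weight n r))"
    unfolding two_rho_k_def[abs_def] by (rule weight_inner_sum)
  also have "\<dots> = (\<Sum>(i, j)\<in>pos_roots_k n. - 2 * (wcoord n b i - wcoord n b j))"
    by (intro sum.cong) (auto simp: pos_roots_k_def weight_inner_root)
  also have "\<dots> = (\<Sum>(i, j)\<in>{2..n+1} \<times> {2..n+1}. if i < j then - 2 * (wcoord n b i - wcoord n b j) else 0)"
    by (intro sum.mono_neutral_cong_left) (auto simp: pos_roots_k_def split: if_splits)
  also have "\<dots> = - 2 * (\<Sum>i=2..n+1. \<Sum>j=2..n+1. if i < j then wcoord n b i - wcoord n b j else 0)"
    by (simp only: sum.cartesian_product sum_distrib_left) (intro sum.cong, auto)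
  finally show ?thesis .
qed

text \<open>The functional \<open>b \<mapsto> \<Sum>\<^sub>m (n + 1 - m) b\<^sub>m\<close> is positive on the positive roots.\<close>

lemma no_negative_root_combination:
  fixes c :: "nat \<times> nat \<Rightarrow> nat"
  assumes r: "r \<in> pos_roots_su n"
    and eq: "\<And>m. m \<in> {1..n} \<Longrightarrow>
      - root_weight n r m = (\<Sum>s\<in>pos_roots_su n. of_nat (c s) * root_weight n s m)"
  shows False
proof -
  define h where "h b = (\<Sum>m=1..n. (real n + 1 - real m) * b m)" for b :: weight
  have eps: "h (eps n i) = real n + 1 - real i" if "1 \<le> i" "i \<le> n" for i
    using that by (simp add: h_def eps_def if_distrib[of "(*) _"] cong: if_cong)
  have eps_last: "h (eps n (n + 1)) \<le> 0"
    unfolding h_def eps_def by (rule sum_nonpos) auto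
  have pos: "h (root_weight n s) > 0" if "s \<in> pos_roots_su n" for s
  proof -
    obtain i j where "s = (i, j)"
      by (cases s)
    then have s: "s = (i, j)" "1 \<le> i" "i < j" "j \<le> n + 1"
      using that by (auto simp: pos_roots_su_def)
    have "h (root_weight n s) = h (eps n i) - h (eps n j)"
      by (simp add: s root_weight_def h_def algebra_simps sum_subtractf sum.distrib)
    then show ?thesis
      using s eps[of i] eps[of j] eps_last by (cases "j = n + 1") auto
  qed
  have "- h (root_weight n r) = (\<Sum>m=1..n. (real n + 1 - real m) * - root_weight n r m)"
    by (simp add: h_def sum_negf)
  also have "\<dots> = (\<Sum>m=1..n. (real n + 1 - real m) * (\<Sum>s\<in>pos_roots_su n. of_nat (c s) * root_weight n s m))"
    using eq by (intro sum.cong refl) simp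
  also have "\<dots> = (\<Sum>s\<in>pos_roots_su n. of_nat (c s) * h (root_weight n s))"
    unfolding h_def sum_distrib_left by (subst sum.swap) (simp add: mult_ac)
  also have "\<dots> \<ge> 0"
    using pos by (intro sum_nonneg) (simp add: less_imp_le)
  finally show False
    using pos[OF r] by simp
qed

lemma weight_form_linear:
  "weight_form b (cscale c H) = c * weight_form b H"
  "weight_form b (t *\<^sub>R H) = of_real t * weight_form b H"
  by (simp_all add: weight_form_def sum_distrib_left mult_ac scaleR_conv_of_real[where 'a = complex])

lemma cartan_scaleR: "H \<in> cartan \<Longrightarrow> t *\<^sub>R H \<in> cartan"
  by (simp add: cartan_def su_scaleR)

lemma weight_form_eps:
  fixes H :: "complex^'n::{finite,linorder} option^'n option"
  assumes "trace H = 0" "1 \<le> i" "i \<le> CARD('n) + 1"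
  shows "weight_form (eps CARD('n) i) H = H $ nth_index i $ nth_index i"
proof (cases "i = CARD('n) + 1")
  case True
  have "(\<Sum>m=1..CARD('n). H $ nth_index m $ nth_index m) + H $ nth_index i $ nth_index i = 0"
    using assms(1) by (simp add: trace_def sum_nth_index card_UNIV_option True)
  then show ?thesis
    using True by (simp add: weight_form_def eps_def sum_negf add_eq_0_iff)
next
  case False
  then have "weight_form (eps CARD('n) i) H = (\<Sum>m=1..CARD('n). if m = i then H $ nth_index i $ nth_index i else 0)"
    unfolding weight_form_def by (intro sum.cong) (auto simp: eps_def)
  also have "\<dots> = H $ nth_index i $ nth_index i"
    using False assms by auto
  finally show ?thesis .
qed

text \<open>The diagonal unit has to be made traceless before a weight can be evaluated on it; the
  subtracted multiple of the identity is what normalises the coordinates in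
  \<open>wcoord\<close>.\<close>

lemma weight_form_unit:
  assumes "1 \<le> i" "i \<le> CARD('n) + 1"
  shows "weight_form b (traceless (unit_mat (nth_index i) (nth_index i) ::
    complex^'n::{finite,linorder} option^'n option)) = of_real (wcoord CARD('n) b i)"
proof -
  let ?N = "of_nat CARD('n) + 1 :: complex"
  have tr: "trace (unit_mat a a :: complex^'n option^'n option) = 1" for a
    by (simp add: trace_def unit_mat_nth)
  have "weight_form b (traceless (unit_mat (nth_index i) (nth_index i) :: complex^'n option^'n option))
      = (\<Sum>m=1..CARD('n). (if m = i then of_real (b m) else 0) - of_real (b m) / ?N)"
    unfolding weight_form_def
  proof (rule sum.cong)
    fix m assume m: "m \<in> {1..CARD('n)}"
    have "nth_index m = (nth_index i :: 'n option) \<longleftrightarrow> m = i"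
      using m assms by (intro nth_index_inj) (auto simp: card_UNIV_option)
    then show "of_real (b m) * traceless (unit_mat (nth_index i) (nth_index i) :: complex^'n option^'n option)
          $ nth_index m $ nth_index m = (if m = i then of_real (b m) else 0) - of_real (b m) / ?N"
      by (simp add: traceless_def tr unit_mat_nth mat_def card_UNIV_option algebra_simps)
  qed simp
  also have "\<dots> = of_real (wcoord CARD('n) b i)"
    using assms by (simp add: wcoord_def sum_subtractf sum_divide_distrib)
  finally show ?thesis .
qed

section \<open>The highest weight vector and the Casimir scalar\<close>

locale highest_weight_rep = smooth_rep \<pi>
  for \<pi> :: "complex^'n::{finite,linorder} option^'n option \<Rightarrow> complex^'d^'d" +
  fixes lam :: weight
  assumes highest: "highest_weight \<pi> lam"
begin

definition hvec :: "complex^'d" where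
  "hvec = (SOME v. v \<noteq> 0 \<and> (\<forall>H\<in>cartan. \<pi> (mexp H) *v v = exp (weight_form lam H) *s v))"

lemma hvec_nonzero: "hvec \<noteq> 0"
  and hvec_weight: "H \<in> cartan \<Longrightarrow> \<pi> (mexp H) *v hvec = exp (weight_form lam H) *s hvec"
proof -
  have "\<exists>v. v \<noteq> 0 \<and> (\<forall>H\<in>cartan. \<pi> (mexp H) *v v = exp (weight_form lam H) *s v)"
    using highest by (simp add: highest_weight_def weight_of_def)
  from someI_ex[OF this, folded hvec_def]
  show "hvec \<noteq> 0" "H \<in> cartan \<Longrightarrow> \<pi> (mexp H) *v hvec = exp (weight_form lam H) *s hvec"
    by auto
qed

lemma delta_cartan_hvec:
  assumes H: "H \<in> cartan"
  shows "delta H *v hvec = weight_form lam H *s hvec"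
proof (rule vector_derivative_unique)
  have su: "H \<in> su"
    using H by (simp add: cartan_def)
  show "((\<lambda>t. \<pi> (mexp (t *\<^sub>R H)) *v hvec) has_vector_derivative delta H *v hvec) (at 0)"
    using has_vector_derivative_matrix_vector_mult[OF dpi_mexp[OF su] has_vector_derivative_const, of hvec]
    by (simp add: delta_su[OF su])
  have "((\<lambda>t. exp (weight_form lam H * of_real t)) has_vector_derivative weight_form lam H) (at 0)"
    by (rule has_vector_derivative_real_field) (auto intro!: derivative_eq_intros)
  then have "((\<lambda>t. exp (weight_form lam H * of_real t) *s hvec) has_vector_derivative weight_form lam H *s hvec) (at 0)"
    by (intro has_vector_derivative_vecI) (simp add: has_vector_derivative_mult_left)
  then show "((\<lambda>t. \<pi> (mexp (t *\<^sub>R H)) *v hvec) has_vector_derivative weight_form lam H *s hvec) (at 0)"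
    by (simp add: hvec_weight[OF cartan_scaleR[OF H]] weight_form_linear mult.commute)
qed

text \<open>A traceless diagonal unit is Hermitian, so i times it lies in \<open>cartan\<close>, and
  complex linearity of \<open>delta\<close> and \<open>weight_form\<close> removes the i
  again.\<close>

lemma delta_diag_hvec:
  assumes "1 \<le> i" "i \<le> CARD('n) + 1"
  shows "delta (unit_mat (nth_index i) (nth_index i)) *v hvec = of_real (wcoord CARD('n) lam i) *s hvec"
proof -
  let ?T = "traceless (unit_mat (nth_index i) (nth_index i)) :: complex^'n option^'n option"
  have "adj ?T = ?T"
    by (auto simp: vec_eq_iff traceless_def trace_def unit_mat_nth mat_def)
  then have "cscale \<i> ?T \<in> su"
    by (simp add: su_def adj_cscale cscale_uminus trace_cscale trace_traceless)
  moreover have "?T $ a $ b = 0" if "a \<noteq> b" for a b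
    using that by (auto simp: traceless_def unit_mat_nth mat_def)
  ultimately have H: "cscale \<i> ?T \<in> cartan"
    by (simp add: cartan_def)
  have "delta (unit_mat (nth_index i) (nth_index i)) = cscale (- \<i>) (delta (cscale \<i> ?T))"
    by (simp add: delta_cscale delta_traceless)
  then have "delta (unit_mat (nth_index i) (nth_index i)) *v hvec = - \<i> *s (weight_form lam (cscale \<i> ?T) *s hvec)"
    using delta_cartan_hvec[OF H] by (simp only: cscale_mult_vec)
  then show ?thesis
    using weight_form_unit[OF assms, of lam] by (simp add: weight_form_linear vector_smult_assoc)
qed

text \<open>If the image were nonzero it would be a weight vector of weight lam plus a positive
  root. Maximality of \<open>lam\<close> would then write the negative of that root as a natural
  combination of positive roots.\<close>

lemma delta_raising_hvec:
  assumes ij: "1 \<le> i" "i < j" "j \<le> CARD('n) + 1"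
  shows "delta (unit_mat (nth_index i) (nth_index j)) *v hvec = 0"
proof (rule ccontr)
  let ?E = "unit_mat (nth_index i) (nth_index j) :: complex^'n option^'n option"
  let ?b = "\<lambda>m. lam m + root_weight CARD('n) (i, j) m"
  assume nz: "delta ?E *v hvec \<noteq> 0"
  have "\<pi> (mexp H) *v (delta ?E *v hvec) = exp (weight_form ?b H) *s (delta ?E *v hvec)"
    if H: "H \<in> cartan" for H
  proof -
    have su: "H \<in> su" and diag: "\<And>a b. a \<noteq> b \<Longrightarrow> H $ a $ b = 0"
      using H by (auto simp: cartan_def)
    note SU = mexp_SU[OF su]
    have "cnj (H $ a $ a) = - H $ a $ a" for a
    proof -
      have "adj H $ a $ a = (- H) $ a $ a"
        using su by (simp add: su_def)
      then show ?thesis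
        by simp
    qed
    then have c: "exp (cnj (H $ a $ a)) = exp (- H $ a $ a)" for a
      by simp
    have conj: "mexp H ** ?E ** adj (mexp H) = cscale (exp (H $ nth_index i $ nth_index i - H $ nth_index j $ nth_index j)) ?E"
    proof -
      have "(\<Sum>q\<in>UNIV. (\<Sum>p\<in>UNIV. (if k = p then exp (H $ k $ k) else 0) * ?E $ p $ q) *
              cnj (if l = q then exp (H $ l $ l) else 0)) =
          (\<Sum>q\<in>UNIV. if q = l then (\<Sum>p\<in>UNIV. if p = k then exp (H $ k $ k) * ?E $ k $ l else 0) *
              exp (- H $ l $ l) else 0)" for k l
        by (intro sum.cong) (auto simp: exp_cnj c if_distrib[of "\<lambda>x. x * _"] cong: if_cong)
      then show ?thesis
        by (simp add: vec_eq_iff matrix_matrix_mult_def mexp_diagonal[OF diag] exp_cnj unit_mat_nth)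
          (auto simp: exp_diff exp_minus field_simps)
    qed
    \<comment> \<open>Inserting the inverse pair on the right turns left multiplication into a
      conjugation, which \<open>delta_conj\<close> evaluates through the diagonal matrix
      exp(H).\<close>
    have "\<pi> (mexp H) ** delta ?E = \<pi> (mexp H) ** delta ?E ** \<pi> (adj (mexp H)) ** \<pi> (mexp H)"
      using rep_adj[OF SU] by (simp add: matrix_mul_assoc[symmetric])
    also have "\<dots> = cscale (exp (H $ nth_index i $ nth_index i - H $ nth_index j $ nth_index j)) (delta ?E) ** \<pi> (mexp H)"
      using delta_conj[OF SU, of ?E] by (simp add: conj delta_cscale)
    finally have "\<pi> (mexp H) *v (delta ?E *v hvec) =
        cscale (exp (H $ nth_index i $ nth_index i - H $ nth_index j $ nth_index j)) (delta ?E) *v (\<pi> (mexp H) *v hvec)"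
      by (simp only: matrix_vector_mul_assoc)
    also have "\<dots> = (exp (H $ nth_index i $ nth_index i - H $ nth_index j $ nth_index j) * exp (weight_form lam H)) *s (delta ?E *v hvec)"
      by (simp only: hvec_weight[OF H] cscale_mult_vec vector_scalar_commute vector_smult_assoc mult.commute)
    also have "H $ nth_index i $ nth_index i - H $ nth_index j $ nth_index j =
        weight_form (eps CARD('n) i) H - weight_form (eps CARD('n) j) H"
      using su ij by (simp add: weight_form_eps su_def)
    also have "exp (weight_form (eps CARD('n) i) H - weight_form (eps CARD('n) j) H) * exp (weight_form lam H) =
        exp (weight_form ?b H)"
      by (simp add: exp_add[symmetric] weight_form_def root_weight_def algebra_simps sum.distrib sum_subtractf)
    finally show ?thesis .
  qed
  then have "weight_of \<pi> ?b"
    using nz unfolding weight_of_def by blast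
  then obtain c :: "nat \<times> nat \<Rightarrow> nat" where c: "\<forall>m\<in>{1..CARD('n)}. lam m - ?b m =
      (\<Sum>r\<in>pos_roots_su CARD('n). of_nat (c r) * root_weight CARD('n) r m)"
    using highest unfolding highest_weight_def by blast
  show False
  proof (rule no_negative_root_combination[of "(i, j)" "CARD('n)" c])
    show "(i, j) \<in> pos_roots_su CARD('n)"
      using ij by (simp add: pos_roots_su_def)
    show "- root_weight CARD('n) (i, j) m = (\<Sum>s\<in>pos_roots_su CARD('n). of_nat (c s) * root_weight CARD('n) s m)"
      if "m \<in> {1..CARD('n)}" for m
      using c[rule_format, OF that] by simp
  qed
qed

lemma casimir_hvec:
  "casimir *v hvec = of_real (- weight_inner CARD('n) lam (\<lambda>m. two_rho_su CARD('n) m + lam m) / 2) *s hvec"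
proof -
  let ?\<mu> = "wcoord CARD('n) lam"
  let ?E = "\<lambda>i j. delta (unit_mat (nth_index i) (nth_index j))"
  let ?t = "\<lambda>i j. if i = j then (?\<mu> i)\<^sup>2 else if i < j then ?\<mu> i - ?\<mu> j else 0"
  have trm: "(?E i j ** ?E j i) *v hvec = of_real (?t i j) *s hvec"
    if i: "i \<in> {1..CARD('n) + 1}" and j: "j \<in> {1..CARD('n) + 1}" for i j
  proof -
    consider "i = j" | "i < j" | "j < i"
      by linarith
    then show ?thesis
    proof cases
      case 1
      then show ?thesis
        using i by (simp add: matrix_vector_mul_assoc[symmetric] delta_diag_hvec vector_scalar_commute
            vector_smult_assoc power2_eq_square)
    next
      case 2
      \<comment> \<open>Commuting the raising unit to the right, where it annihilates
        \<open>hvec\<close>, leaves only the difference of two diagonal units.\<close>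
      have "?E i j ** ?E j i = ?E i i - ?E j j + ?E j i ** ?E i j"
        using delta_bracket[of "unit_mat (nth_index i) (nth_index j)" "unit_mat (nth_index j) (nth_index i)"]
        by (simp add: unit_mat_mult delta_linear_simps algebra_simps)
      then have "(?E i j ** ?E j i) *v hvec = ?E i i *v hvec - ?E j j *v hvec + ?E j i *v (?E i j *v hvec)"
        by (simp add: matrix_vector_mult_add_rdistrib matrix_vector_mult_diff_rdistrib matrix_vector_mul_assoc)
      then show ?thesis
        using i j 2 by (simp add: delta_diag_hvec delta_raising_hvec vec_eq_iff algebra_simps)
    next
      case 3
      then show ?thesis
        using i j by (simp add: matrix_vector_mul_assoc[symmetric] delta_raising_hvec)
    qed
  qed
  have "casimir *v hvec = (\<Sum>i=1..CARD('n)+1. \<Sum>j=1..CARD('n)+1. (?E i j ** ?E j i) *v hvec)"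
  proof -
    have "(\<Sum>a\<in>UNIV. f a) = (\<Sum>i=1..CARD('n)+1. f (nth_index i))" for f :: "'n option \<Rightarrow> complex^'d"
      using sum_nth_index[of f] by (simp add: card_UNIV_option)
    then show ?thesis
      by (simp only: casimir_def matrix_vector_sum_left)
  qed
  also have "\<dots> = (\<Sum>i=1..CARD('n)+1. \<Sum>j=1..CARD('n)+1. of_real (?t i j) *s hvec)"
    by (intro sum.cong refl trm)
  also have "\<dots> = of_real (\<Sum>i=1..CARD('n)+1. \<Sum>j=1..CARD('n)+1. ?t i j) *s hvec"
    by (simp only: vec.scale_sum_left of_real_sum)
  also have "(\<Sum>i=1..CARD('n)+1. \<Sum>j=1..CARD('n)+1. ?t i j) =
      - weight_inner CARD('n) lam (\<lambda>m. two_rho_su CARD('n) m + lam m) / 2"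
  proof -
    have "x = - (- 2 * x) / 2" for x :: real
      by simp
    then show ?thesis
      unfolding weight_inner_two_rho_su .
  qed
  finally show ?thesis .
qed

lemma casimir_eq:
  assumes "irreducible_rep \<pi>"
  shows "casimir = cscale (of_real (- weight_inner CARD('n) lam (\<lambda>m. two_rho_su CARD('n) m + lam m) / 2)) (mat 1)"
  by (rule casimir_irreducible[OF assms hvec_nonzero casimir_hvec])

end

section \<open>Polynomial functions\<close>

text \<open>A class without reference to the degree, closed under multiplication by coordinates and
  under \<open>partial_deriv\<close>, so that it contains all intermediate values of the Dirac
  operators.\<close>

inductive poly_fun :: "(complex^'n \<Rightarrow> complex) \<Rightarrow> bool" where
  poly_fun_const: "poly_fun (\<lambda>z. c)"
| poly_fun_coord: "poly_fun (\<lambda>z. z $ r)"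
| poly_fun_add: "poly_fun f \<Longrightarrow> poly_fun g \<Longrightarrow> poly_fun (\<lambda>z. f z + g z)"
| poly_fun_mult: "poly_fun f \<Longrightarrow> poly_fun g \<Longrightarrow> poly_fun (\<lambda>z. f z * g z)"

lemma poly_fun_cmult: "poly_fun f \<Longrightarrow> poly_fun (\<lambda>z. c * f z)"
  by (rule poly_fun_mult[OF poly_fun_const])

lemma poly_fun_sum: "(\<And>i. i \<in> I \<Longrightarrow> poly_fun (f i)) \<Longrightarrow> poly_fun (\<lambda>z. \<Sum>i\<in>I. f i z)"
  by (induction I rule: infinite_finite_induct) (auto intro: poly_fun.intros)

lemma poly_fun_prod: "(\<And>i. i \<in> I \<Longrightarrow> poly_fun (f i)) \<Longrightarrow> poly_fun (\<lambda>z. \<Prod>i\<in>I. f i z)"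
  by (induction I rule: infinite_finite_induct) (auto intro: poly_fun.intros)

lemma poly_fun_power: "poly_fun f \<Longrightarrow> poly_fun (\<lambda>z. f z ^ m)"
  by (induction m) (auto intro: poly_fun.intros)

lemma hom_poly_poly_fun: "f \<in> hom_poly l \<Longrightarrow> poly_fun f"
  unfolding hom_poly_def
  by (auto intro!: poly_fun_sum poly_fun_cmult poly_fun_prod poly_fun_power poly_fun_coord)

lemma vec_upd_same [simp]: "(\<chi> s. if s = r then z $ r else z $ s) = z"
  by (simp add: vec_eq_iff)

lemma poly_fun_field_differentiable:
  assumes "poly_fun f"
  shows "(\<lambda>w. f (\<chi> s. if s = r then w else z $ s)) field_differentiable (at w)"
  using assms
proof induction
  case (poly_fun_coord s)
  then show ?case
    by (cases "s = r") simp_all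
qed (auto intro: field_differentiable_add field_differentiable_mult)

lemma poly_fun_has_field_derivative:
  assumes "poly_fun f"
  shows "((\<lambda>w. f (\<chi> s. if s = r then w else z $ s)) has_field_derivative partial_deriv r f z) (at (z $ r))"
  unfolding partial_deriv_def
  using poly_fun_field_differentiable[OF assms] DERIV_deriv_iff_field_differentiable by blast

lemma partial_derivI:
  "((\<lambda>w. f (\<chi> s. if s = r then w else z $ s)) has_field_derivative d) (at (z $ r)) \<Longrightarrow> partial_deriv r f z = d"
  unfolding partial_deriv_def by (rule DERIV_imp_deriv)

lemma partial_deriv_const: "partial_deriv r (\<lambda>z. c) = (\<lambda>z. 0)"
  by (intro ext partial_derivI) simp

lemma partial_deriv_coord: "partial_deriv r (\<lambda>z. z $ s) = (\<lambda>z. if r = s then 1 else 0)"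
  by (intro ext partial_derivI) (auto intro!: derivative_eq_intros)

lemma partial_deriv_add:
  assumes "poly_fun f" "poly_fun g"
  shows "partial_deriv r (\<lambda>z. f z + g z) = (\<lambda>z. partial_deriv r f z + partial_deriv r g z)"
  by (intro ext partial_derivI) (intro derivative_intros poly_fun_has_field_derivative assms)

lemma partial_deriv_mult:
  assumes "poly_fun f" "poly_fun g"
  shows "partial_deriv r (\<lambda>z. f z * g z) = (\<lambda>z. f z * partial_deriv r g z + partial_deriv r f z * g z)"
  using DERIV_mult'[OF poly_fun_has_field_derivative[OF assms(1)] poly_fun_has_field_derivative[OF assms(2)]]
  by (intro ext partial_derivI) simp

lemma partial_deriv_cmult:
  assumes "poly_fun f"
  shows "partial_deriv r (\<lambda>z. c * f z) = (\<lambda>z. c * partial_deriv r f z)"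
  using partial_deriv_mult[OF poly_fun_const[of c] assms] by (simp add: partial_deriv_const)

lemma partial_deriv_sum:
  assumes "\<And>i. i \<in> I \<Longrightarrow> poly_fun (f i)"
  shows "partial_deriv r (\<lambda>z. \<Sum>i\<in>I. f i z) = (\<lambda>z. \<Sum>i\<in>I. partial_deriv r (f i) z)"
  using assms
  by (induction I rule: infinite_finite_induct)
    (simp_all add: partial_deriv_const partial_deriv_add poly_fun_sum)

lemma poly_fun_partial_deriv: "poly_fun f \<Longrightarrow> poly_fun (partial_deriv r f)"
proof (induction rule: poly_fun.induct)
  case (poly_fun_coord s)
  show ?case
    unfolding partial_deriv_coord by (rule poly_fun_const)
qed (auto simp: partial_deriv_const partial_deriv_add partial_deriv_mult intro: poly_fun.intros)

text \<open>The parameter of the curve is real, but polynomial functions involve no conjugates, so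
  the complex partial derivatives determine the derivative along any curve.\<close>

lemma poly_fun_chain:
  assumes "poly_fun f" "(c has_vector_derivative c') (at t)"
  shows "((\<lambda>t. f (c t)) has_vector_derivative (\<Sum>r\<in>UNIV. c' $ r * partial_deriv r f (c t))) (at t)"
  using assms(1)
proof induction
  case (poly_fun_const a)
  show ?case
    by (simp add: partial_deriv_const)
next
  case (poly_fun_coord s)
  have "(\<Sum>r\<in>UNIV. c' $ r * partial_deriv r (\<lambda>z. z $ s) (c t)) = c' $ s"
    by (simp add: partial_deriv_coord if_distrib cong: if_cong)
  then show ?case
    using has_vector_derivative_nth[OF assms(2)] by simp
next
  case (poly_fun_add f g)
  then show ?case
    using has_vector_derivative_add[OF poly_fun_add.IH]
    by (simp add: partial_deriv_add sum.distrib algebra_simps)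
next
  case (poly_fun_mult f g)
  then show ?case
    using has_vector_derivative_mult[OF poly_fun_mult.IH]
    by (simp add: partial_deriv_mult sum.distrib algebra_simps sum_distrib_left sum_distrib_right)
qed

lemma hom_poly_scale:
  assumes "f \<in> hom_poly l"
  shows "f (c *s z) = c ^ l * f z"
proof -
  obtain k where f: "f = (\<lambda>z. \<Sum>a | sum a UNIV = l. k a * (\<Prod>r\<in>UNIV. (z $ r) ^ a r))"
    using assms unfolding hom_poly_def by blast
  have "(\<Prod>r\<in>UNIV. ((c *s z) $ r) ^ a r) = c ^ l * (\<Prod>r\<in>UNIV. (z $ r) ^ a r)" if "sum a UNIV = l" for a
    using that by (auto simp: power_mult_distrib prod.distrib power_sum)
  then show ?thesis
    by (simp add: f sum_distrib_left mult_ac)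
qed

text \<open>Both sides are the derivative of f(tz) = t^l f(z) at t = 1.\<close>

lemma hom_poly_euler:
  assumes "f \<in> hom_poly l"
  shows "(\<Sum>r\<in>UNIV. z $ r * partial_deriv r f z) = of_nat l * f z"
proof (rule vector_derivative_unique)
  have "((\<lambda>t. of_real t *s z) has_vector_derivative z) (at 1)"
    by (rule has_vector_derivative_vecI) (auto intro!: derivative_eq_intros has_vector_derivative_real_field)
  from poly_fun_chain[OF hom_poly_poly_fun[OF assms] this]
  show "((\<lambda>t. f (of_real t *s z)) has_vector_derivative (\<Sum>r\<in>UNIV. z $ r * partial_deriv r f z)) (at 1)"
    by simp
  have "((\<lambda>t. t ^ l * f z) has_field_derivative of_nat l * f z) (at (of_real 1))"
    by (auto intro!: derivative_eq_intros)
  from has_vector_derivative_real_field[OF this]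
  show "((\<lambda>t. f (of_real t *s z)) has_vector_derivative of_nat l * f z) (at 1)"
    by (simp add: hom_poly_scale[OF assms])
qed

text \<open>Applying d_s to Euler's identity produces one extra d_s f from the coordinate z_s, hence
  l - 1, a subtraction in the complex numbers that is also right for l = 0.\<close>

lemma hom_poly_euler_partial:
  assumes "f \<in> hom_poly l"
  shows "(\<Sum>r\<in>UNIV. z $ r * partial_deriv s (partial_deriv r f) z) = (of_nat l - 1) * partial_deriv s f z"
proof -
  note pf = hom_poly_poly_fun[OF assms]
  have "partial_deriv s (\<lambda>z. \<Sum>r\<in>UNIV. z $ r * partial_deriv r f z) z = of_nat l * partial_deriv s f z"
    using hom_poly_euler[OF assms] by (simp add: partial_deriv_cmult[OF pf])
  moreover have "partial_deriv s (\<lambda>z. \<Sum>r\<in>UNIV. z $ r * partial_deriv r f z) z =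
      (\<Sum>r\<in>UNIV. z $ r * partial_deriv s (partial_deriv r f) z) + partial_deriv s f z"
    by (simp add: partial_deriv_sum partial_deriv_mult partial_deriv_coord pf poly_fun_partial_deriv
        poly_fun_mult poly_fun_coord sum.distrib if_distrib[of "\<lambda>x. x * _"] cong: if_cong)
  ultimately show ?thesis
    by (simp add: algebra_simps)
qed

lemma hom_poly_add: "f \<in> hom_poly l \<Longrightarrow> g \<in> hom_poly l \<Longrightarrow> (\<lambda>z. f z + g z) \<in> hom_poly l"
proof -
  assume "f \<in> hom_poly l" "g \<in> hom_poly l"
  then obtain c d where "f = (\<lambda>z. \<Sum>a | sum a UNIV = l. c a * (\<Prod>r\<in>UNIV. (z $ r) ^ a r))"
    "g = (\<lambda>z. \<Sum>a | sum a UNIV = l. d a * (\<Prod>r\<in>UNIV. (z $ r) ^ a r))"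
    unfolding hom_poly_def by blast
  then show ?thesis
    unfolding hom_poly_def
    by (intro CollectI exI[of _ "\<lambda>a. c a + d a"]) (simp add: sum.distrib algebra_simps)
qed

lemma hom_poly_zero: "(\<lambda>z. 0) \<in> hom_poly l"
  unfolding hom_poly_def by (intro CollectI exI[of _ "\<lambda>a. 0"]) simp

lemma hom_poly_sum: "(\<And>i. i \<in> I \<Longrightarrow> f i \<in> hom_poly l) \<Longrightarrow> (\<lambda>z. \<Sum>i\<in>I. f i z) \<in> hom_poly l"
  by (induction I rule: infinite_finite_induct) (auto intro: hom_poly_add hom_poly_zero)

section \<open>The embedding of U(n)\<close>

lemma qtilde_nth [simp]:
  "qtilde A $ None $ None = inverse (det A)" "qtilde A $ None $ Some s = 0"
  "qtilde A $ Some r $ None = 0" "qtilde A $ Some r $ Some s = A $ r $ s"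
  by (simp_all add: qtilde_def)

lemma vec_option_eq_iff: "v = w \<longleftrightarrow> v $ None = w $ None \<and> (\<forall>r. v $ Some r = w $ Some r)"
  by (metis option.exhaust vec_eq_iff)

text \<open>Row \<open>None\<close> has a single possibly nonzero entry, so the surviving
  permutations fix \<open>None\<close> and are transported from those of the original index type.
  The product is left uncancelled so that it also covers det A = 0, where the inverse is 0.\<close>

lemma det_qtilde: "det (qtilde A) = inverse (det A) * det A"
proof -
  let ?M = "qtilde A"
  let ?T = "\<lambda>p. of_int (sign p) * (\<Prod>i\<in>UNIV. ?M $ i $ p i)"
  let ?h = "map_permutation UNIV (Some :: 'a \<Rightarrow> 'a option)"
  have inj: "inj (Some :: 'a \<Rightarrow> 'a option)"
    by simp
  have h: "?h q = (\<lambda>x. if x \<in> range Some then Some (q (inv_into UNIV Some x)) else x)" for q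
    by (auto simp: map_permutation_def restrict_id_def fun_eq_iff)
  have h_Some: "?h q (Some r) = Some (q r)" for q r
    using inv_f_f[OF inj] by (simp add: h)
  have h_None: "?h q None = None" for q
    by (simp add: h image_iff)
  have "det ?M = (\<Sum>p | p permutes UNIV. ?T p)"
    by (simp add: det_def)
  also have "\<dots> = (\<Sum>p | p permutes range Some. ?T p)"
  proof (rule sum.mono_neutral_right)
    show "{p. p permutes range (Some :: 'a \<Rightarrow> 'a option)} \<subseteq> {p. p permutes UNIV}"
      by (auto intro: permutes_subset)
    show "\<forall>p\<in>{p. p permutes UNIV} - {p. p permutes range Some}. ?T p = 0"
    proof
      fix p assume p: "p \<in> {p. p permutes UNIV} - {p. p permutes range (Some :: 'a \<Rightarrow> 'a option)}"
      have "p None \<noteq> None"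
      proof
        assume "p None = None"
        then have "p x = x" if "x \<notin> range Some" for x
          using that by (cases x) auto
        then have "p permutes range Some"
          using p by (simp add: permutes_def)
        then show False
          using p by simp
      qed
      then have "?M $ None $ p None = 0"
        by (cases "p None") simp_all
      then have "(\<Prod>i\<in>UNIV. ?M $ i $ p i) = 0"
        by (intro prod_zero bexI[of _ None]) simp_all
      then show "?T p = 0"
        by simp
    qed
  qed simp
  also have "\<dots> = (\<Sum>q | q permutes UNIV. ?T (?h q))"
  proof -
    have "bij_betw ?h {q. q permutes UNIV} {p. p permutes range Some}"
      using bij_betw_permutations[OF inj_on_imp_bij_betw[OF inj]] by (simp only: h[abs_def])
    from sum.reindex_bij_betw[OF this, of ?T] show ?thesis
      by simp
  qed
  also have "\<dots> = (\<Sum>q | q permutes UNIV. inverse (det A) * (of_int (sign q) * (\<Prod>r\<in>UNIV. A $ r $ q r)))"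
  proof (rule sum.cong)
    fix q :: "'a \<Rightarrow> 'a" assume "q \<in> {q. q permutes UNIV}"
    then have "sign (?h q) = sign q"
      using sign_map_permutation[OF inj] by simp
    moreover have "(\<Prod>i\<in>UNIV. ?M $ i $ ?h q i) = inverse (det A) * (\<Prod>r\<in>UNIV. A $ r $ q r)"
      by (simp add: UNIV_option_conv prod.reindex h_Some h_None)
    ultimately show "?T (?h q) = inverse (det A) * (of_int (sign q) * (\<Prod>r\<in>UNIV. A $ r $ q r))"
      by simp
  qed simp
  also have "\<dots> = inverse (det A) * det A"
    by (simp add: det_def sum_distrib_left)
  finally show ?thesis .
qed

lemma adj_qtilde: "A \<in> unitary_group \<Longrightarrow> adj (qtilde A) = qtilde (adj A)"
  by (auto simp: vec_option_eq_iff det_adj)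

lemma qtilde_SU:
  assumes "A \<in> unitary_group"
  shows "qtilde A \<in> SU"
proof -
  note nz = det_unitary_nonzero[OF assms]
  have "(adj A ** A) $ r $ s = mat 1 $ r $ s" for r s
    using unitary_groupD(1)[OF assms] by simp
  then have "(\<Sum>t\<in>UNIV. cnj (A $ t $ r) * A $ t $ s) = (if r = s then 1 else 0)" for r s
    by (simp add: matrix_matrix_mult_def mat_def)
  moreover have "cnj (det A) * det A = 1"
    using det_unitary_adj[OF assms] nz by (simp add: det_adj)
  then have "inverse (cnj (det A)) * inverse (det A) = 1"
    by (metis inverse_1 inverse_mult_distrib)
  ultimately have "adj (qtilde A) ** qtilde A = mat 1"
    by (simp add: vec_option_eq_iff matrix_matrix_mult_def sum_option_UNIV mat_def)
  then show ?thesis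
    using nz by (simp add: SU_def unitary_group_def det_qtilde)
qed

section \<open>Traces with respect to a basis\<close>

text \<open>Contraction with an inverse Gram matrix is independent of the basis. The inverse matrix
  defines a family \<open>Y\<close> dual to \<open>x\<close>; expanding \<open>Y a\<close> in the
  second system and summing over a reassembles \<open>f i\<close>. The form is symmetric in one
  application and alternating in the other, so the order of its arguments matters
  throughout.\<close>

lemma dual_basis_sum:
  fixes x :: "'b::finite \<Rightarrow> 'v::real_vector" and \<omega> :: "'v \<Rightarrow> 'v \<Rightarrow> real"
    and \<Psi> :: "'v \<Rightarrow> 'v \<Rightarrow> 'w::real_vector"
  assumes \<omega>: "bilinear \<omega>" and \<Psi>: "bilinear \<Psi>"
    and indep: "\<And>c a. (\<Sum>a\<in>UNIV. c a *\<^sub>R x a) = 0 \<Longrightarrow> c a = 0"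
    and span: "\<And>v. \<exists>c. v = (\<Sum>a\<in>UNIV. c a *\<^sub>R x a)"
    and nondeg: "\<And>v. (\<And>u. \<omega> u v = 0) \<Longrightarrow> v = 0"
    and dual: "\<And>y. (\<Sum>i\<in>I. \<omega> y (f i) *\<^sub>R e i) = y"
  shows "(\<Sum>a\<in>UNIV. \<Sum>b\<in>UNIV. matrix_inv (\<chi> c d. \<omega> (x c) (x d)) $ a $ b *\<^sub>R \<Psi> (x a) (x b)) =
    (\<Sum>i\<in>I. \<Psi> (f i) (e i))"
proof -
  have lin: "linear (\<omega> u)" "linear (\<lambda>u. \<omega> u v)" "linear (\<Psi> u)" "linear (\<lambda>u. \<Psi> u v)" for u v
    using \<omega> \<Psi> by (simp_all add: bilinear_def)
  have \<omega>_sum: "\<omega> u (\<Sum>i\<in>J. c i *\<^sub>R g i) = (\<Sum>i\<in>J. c i * \<omega> u (g i))"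
    "\<omega> (\<Sum>i\<in>J. c i *\<^sub>R g i) v = (\<Sum>i\<in>J. c i * \<omega> (g i) v)"
    for u v c and g :: "'i \<Rightarrow> 'v" and J
    using lin by (simp_all add: linear_sum[OF lin(1)] linear_sum[OF lin(2)] linear_scale[OF lin(1)] linear_scale[OF lin(2)])
  have \<Psi>_sum: "\<Psi> u (\<Sum>i\<in>J. c i *\<^sub>R g i) = (\<Sum>i\<in>J. c i *\<^sub>R \<Psi> u (g i))"
    "\<Psi> (\<Sum>i\<in>J. c i *\<^sub>R g i) v = (\<Sum>i\<in>J. c i *\<^sub>R \<Psi> (g i) v)"
    for u v c and g :: "'i \<Rightarrow> 'v" and J
    by (simp_all add: linear_sum[OF lin(3)] linear_sum[OF lin(4)] linear_scale[OF lin(3)] linear_scale[OF lin(4)])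
  let ?G = "(\<chi> c d. \<omega> (x c) (x d)) :: real^'b^'b"
  let ?W = "matrix_inv ?G"
  have "inj ((*v) ?G)"
  proof (rule linear_injective_0[THEN iffD2, OF matrix_vector_mul_linear], intro allI impI)
    fix w assume "?G *v w = 0"
    then have "(\<Sum>d\<in>UNIV. w $ d * \<omega> (x c) (x d)) = 0" for c
      by (simp add: vec_eq_iff matrix_vector_mult_def mult.commute)
    then have 0: "\<omega> (x c) (\<Sum>d\<in>UNIV. w $ d *\<^sub>R x d) = 0" for c
      by (simp add: \<omega>_sum)
    have "(\<Sum>d\<in>UNIV. w $ d *\<^sub>R x d) = 0"
    proof (rule nondeg)
      fix u
      obtain c where "u = (\<Sum>a\<in>UNIV. c a *\<^sub>R x a)"
        using span by blast
      then show "\<omega> u (\<Sum>d\<in>UNIV. w $ d *\<^sub>R x d) = 0"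
        by (simp only: \<omega>_sum(2) 0) simp
    qed
    then have "w $ d = 0" for d
      by (rule indep)
    then show "w = 0"
      by (simp add: vec_eq_iff)
  qed
  then obtain H where H: "H ** ?G = mat 1"
    using matrix_left_invertible_injective[of ?G] by blast
  then have "?G ** H = mat 1"
    using matrix_left_right_inverse by blast
  with H have "?G ** H = mat 1 \<and> H ** ?G = mat 1"
    by blast
  then have "?G ** ?W = mat 1 \<and> ?W ** ?G = mat 1"
    unfolding matrix_inv_def by (rule someI)
  then have "(?W ** ?G) $ a $ c = mat 1 $ a $ c" for a c
    by simp
  then have W: "(\<Sum>b\<in>UNIV. ?W $ a $ b * \<omega> (x b) (x c)) = (if a = c then 1 else 0)" for a c
    by (simp add: matrix_matrix_mult_def mat_def)
  define Y where "Y a = (\<Sum>b\<in>UNIV. ?W $ a $ b *\<^sub>R x b)" for a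
  have Y: "\<omega> (Y a) (x c) = (if a = c then 1 else 0)" for a c
    unfolding Y_def by (simp only: \<omega>_sum(2) W)
  have expand: "v = (\<Sum>a\<in>UNIV. \<omega> (Y a) v *\<^sub>R x a)" for v
  proof -
    obtain c where c: "v = (\<Sum>a\<in>UNIV. c a *\<^sub>R x a)"
      using span by blast
    have "\<omega> (Y a) v = c a" for a
      unfolding c by (simp add: \<omega>_sum(1) Y if_distrib cong: if_cong)
    then show ?thesis
      using c by simp
  qed
  have "(\<Sum>a\<in>UNIV. \<Sum>b\<in>UNIV. ?W $ a $ b *\<^sub>R \<Psi> (x a) (x b)) = (\<Sum>a\<in>UNIV. \<Psi> (x a) (Y a))"
    by (simp add: Y_def \<Psi>_sum)
  also have "\<dots> = (\<Sum>a\<in>UNIV. \<Psi> (x a) (\<Sum>i\<in>I. \<omega> (Y a) (f i) *\<^sub>R e i))"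
    by (simp only: dual)
  also have "\<dots> = (\<Sum>a\<in>UNIV. \<Sum>i\<in>I. \<omega> (Y a) (f i) *\<^sub>R \<Psi> (x a) (e i))"
    by (simp only: \<Psi>_sum)
  also have "\<dots> = (\<Sum>i\<in>I. \<Sum>a\<in>UNIV. \<omega> (Y a) (f i) *\<^sub>R \<Psi> (x a) (e i))"
    by (rule sum.swap)
  also have "\<dots> = (\<Sum>i\<in>I. \<Psi> (\<Sum>a\<in>UNIV. \<omega> (Y a) (f i) *\<^sub>R x a) (e i))"
    by (simp only: \<Psi>_sum)
  also have "\<dots> = (\<Sum>i\<in>I. \<Psi> (f i) (e i))"
    by (simp only: expand[symmetric])
  finally show ?thesis .
qed

lemma q_add: "q (x + y) = q x + q y"
  and q_scaleR: "q (r *\<^sub>R x) = r *\<^sub>R q x"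
  by (simp_all add: vec_option_eq_iff q_def)

lemma linear_q: "linear q"
  by (rule linearI) (simp_all add: q_add q_scaleR)

lemma inj_q: "inj q"
  by (rule injI) (metis inv_q)

lemma p_basisD:
  assumes X: "p_basis X"
  shows "X a = q (inv q (X a))"
    and "(\<Sum>a\<in>UNIV. c a *\<^sub>R inv q (X a)) = 0 \<Longrightarrow> c a = 0"
    and "\<exists>c. v = (\<Sum>a\<in>UNIV. c a *\<^sub>R inv q (X a))"
proof -
  have inj: "inj X" and indep: "independent (range X)" and span: "span (range X) = range q"
    using X by (simp_all add: p_basis_def)
  show X_eq: "X a = q (inv q (X a))" for a
  proof -
    have "X a \<in> range q"
      using span_base[of "X a" "range X"] span by auto
    then show ?thesis
      by (simp add: f_inv_into_f)
  qed
  have q_sum: "q (\<Sum>a\<in>UNIV. c a *\<^sub>R inv q (X a)) = (\<Sum>a\<in>UNIV. c a *\<^sub>R X a)" for c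
    using X_eq by (simp add: linear_sum[OF linear_q] q_scaleR)
  {
    assume "(\<Sum>a\<in>UNIV. c a *\<^sub>R inv q (X a)) = 0"
    then have "(\<Sum>a\<in>UNIV. c a *\<^sub>R X a) = 0"
      using q_sum[of c] linear_0[OF linear_q] by metis
    then have "(\<Sum>y\<in>range X. c (inv X y) *\<^sub>R y) = 0"
      using inj by (simp add: sum.reindex)
    then have "c (inv X (X a)) = 0"
      using independentD[OF indep, of "range X" "\<lambda>y. c (inv X y)" "X a"] by simp
    then show "c a = 0"
      using inj by simp
  }
  have "q v \<in> span (range X)"
    using span by simp
  then obtain u where "q v = (\<Sum>y\<in>range X. u y *\<^sub>R y)"
    using span_finite[of "range X"] by auto
  then have "q v = (\<Sum>a\<in>UNIV. u (X a) *\<^sub>R X a)"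
    using inj by (simp add: sum.reindex)
  then have "q v = q (\<Sum>a\<in>UNIV. u (X a) *\<^sub>R inv q (X a))"
    by (simp add: q_sum)
  then show "\<exists>c. v = (\<Sum>a\<in>UNIV. c a *\<^sub>R inv q (X a))"
    using injD[OF inj_q] by metis
qed

section \<open>The Dirac operators on linear families of polynomials\<close>

definition clv :: "real \<Rightarrow> complex^'n \<Rightarrow> (complex^'n \<Rightarrow> complex) \<Rightarrow> (complex^'n \<Rightarrow> complex)" where
  "clv hbar \<beta> f z = 1 / (2 * of_real hbar) * (\<Sum>r\<in>UNIV. z $ r * cnj (\<beta> $ r)) * f z
     - (\<Sum>r\<in>UNIV. \<beta> $ r * partial_deriv r f z)"

lemma cl_eq_clv: "cl hbar X = clv hbar (inv q X)"
  by (intro ext) (simp add: cl_def clv_def Let_def)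

lemma clv_add_left: "clv hbar (\<alpha> + \<beta>) f z = clv hbar \<alpha> f z + clv hbar \<beta> f z"
  by (simp add: clv_def sum.distrib algebra_simps)

lemma clv_scaleR_left: "clv hbar (t *\<^sub>R \<beta>) f z = t *\<^sub>R clv hbar \<beta> f z"
  by (simp add: clv_def scaleR_conv_of_real[where 'a = complex] sum_distrib_left algebra_simps)

lemma clv_add_right:
  "poly_fun f \<Longrightarrow> poly_fun g \<Longrightarrow> clv hbar \<beta> (\<lambda>z. f z + g z) z = clv hbar \<beta> f z + clv hbar \<beta> g z"
  by (simp add: clv_def partial_deriv_add sum.distrib algebra_simps add_divide_distrib)

lemma clv_cmult_right: "poly_fun f \<Longrightarrow> clv hbar \<beta> (\<lambda>z. c * f z) z = c * clv hbar \<beta> f z"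
  by (simp add: clv_def partial_deriv_cmult sum_distrib_left algebra_simps)

lemma clv_axis: "clv hbar (axis r c) f z = 1 / (2 * of_real hbar) * z $ r * cnj c * f z - c * partial_deriv r f z"
proof -
  have "(\<Sum>s\<in>UNIV. z $ s * cnj (axis r c $ s)) = (\<Sum>s\<in>UNIV. if s = r then z $ r * cnj c else 0)"
    "(\<Sum>s\<in>UNIV. axis r c $ s * partial_deriv s f z) = (\<Sum>s\<in>UNIV. if s = r then c * partial_deriv r f z else 0)"
    by (intro sum.cong; auto simp: axis_def)+
  then show ?thesis
    by (simp add: clv_def)
qed

text \<open>The degree is left free because creation raises it by one and annihilation lowers it by
  one; homogeneity enters only with \<open>equivariant\<close>.\<close>

definition lin_poly :: "(complex^'d^'d \<Rightarrow> complex^'n \<Rightarrow> complex) \<Rightarrow> bool" where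
  "lin_poly T \<longleftrightarrow> (\<forall>A. poly_fun (T A)) \<and> (\<forall>A B z. T (A + B) z = T A z + T B z) \<and>
     (\<forall>c A z. T (cscale c A) z = c * T A z)"

lemma lin_polyD:
  assumes "lin_poly T"
  shows "poly_fun (T A)" "T (A + B) z = T A z + T B z" "T (cscale c A) z = c * T A z"
    "T (- A) z = - T A z" "T (A - B) z = T A z - T B z" "T (t *\<^sub>R A) z = of_real t * T A z"
    "T 0 z = 0"
proof -
  show a: "poly_fun (T A)" "\<And>A B. T (A + B) z = T A z + T B z"
    and c: "\<And>c A. T (cscale c A) z = c * T A z"
    using assms by (auto simp: lin_poly_def)
  show "T (t *\<^sub>R A) z = of_real t * T A z"
    using c[of "of_real t"] by simp
  show "T 0 z = 0"
    using c[of 0 0] by simp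
  show m: "T (- A) z = - T A z" for A
    using c[of "-1" A] by (simp add: cscale_uminus)
  show "T (A - B) z = T A z - T B z"
    using a(2)[of A "- B"] m by simp
qed

lemma lin_poly_sum:
  assumes "lin_poly T"
  shows "T (sum f S) z = (\<Sum>i\<in>S. T (f i) z)"
  by (induction S rule: infinite_finite_induct) (simp_all add: lin_polyD[OF assms])

lemma lin_poly_mult: "lin_poly T \<Longrightarrow> lin_poly (\<lambda>A. T (B ** A))"
  by (simp add: lin_poly_def matrix_mult_add_right cscale_mult_right)

lemma lin_poly_add: "lin_poly T \<Longrightarrow> lin_poly S \<Longrightarrow> lin_poly (\<lambda>A z. T A z + S A z)"
  by (auto simp: lin_poly_def algebra_simps intro: poly_fun_add)

lemma lin_poly_cmult: "lin_poly T \<Longrightarrow> lin_poly (\<lambda>A z. c * T A z)"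
  by (auto simp: lin_poly_def algebra_simps intro: poly_fun_cmult)

lemma lin_poly_setsum: "(\<And>i. i \<in> I \<Longrightarrow> lin_poly (T i)) \<Longrightarrow> lin_poly (\<lambda>A z. \<Sum>i\<in>I. T i A z)"
proof (induction I rule: infinite_finite_induct)
  case (insert i I)
  then show ?case
    using lin_poly_add[of "T i" "\<lambda>A z. \<Sum>i\<in>I. T i A z"] by simp
qed (simp_all add: lin_poly_def poly_fun_const)

lemma lin_poly_coord_mult: "lin_poly T \<Longrightarrow> lin_poly (\<lambda>A z. z $ r * T A z)"
  by (auto simp: lin_poly_def algebra_simps intro: poly_fun_mult poly_fun_coord)

lemma lin_poly_partial_deriv: "lin_poly T \<Longrightarrow> lin_poly (\<lambda>A. partial_deriv r (T A))"
proof -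
  assume T: "lin_poly T"
  have "T (A + B) = (\<lambda>z. T A z + T B z)" "T (cscale c A) = (\<lambda>z. c * T A z)" for A B c
    using lin_polyD[OF T] by auto
  then show ?thesis
    using lin_polyD(1)[OF T]
    by (simp add: lin_poly_def poly_fun_partial_deriv partial_deriv_add partial_deriv_cmult)
qed

lemma suD: "Y \<in> su \<Longrightarrow> adj Y = - Y"
  by (simp add: su_def)

lemma q_su: "q \<beta> \<in> su"
  by (simp add: su_def vec_option_eq_iff q_def trace_def sum_option_UNIV)

section \<open>Contractions over the tangent space in a real orthonormal basis\<close>

definition real_unit :: "'n \<times> bool \<Rightarrow> complex^'n" where
  "real_unit i = axis (fst i) (if snd i then 1 else \<i>)"

lemma sum_prod_bool: "(\<Sum>i\<in>UNIV. f i) = (\<Sum>r\<in>UNIV. f (r, True) + f (r, False))"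
  for f :: "'n::finite \<times> bool \<Rightarrow> 'c::comm_monoid_add"
proof -
  have "(\<Sum>i\<in>UNIV. f i) = (\<Sum>r\<in>UNIV. \<Sum>b\<in>UNIV. f (r, b))"
    by (simp add: sum.cartesian_product)
  then show ?thesis
    by (simp add: UNIV_bool add.commute)
qed

definition herm :: "complex^'n \<Rightarrow> complex^'n \<Rightarrow> complex" where
  "herm x y = (\<Sum>r\<in>UNIV. x $ r * cnj (y $ r))"

lemma herm_axis: "herm x (axis r c) = x $ r * cnj c"
proof -
  have "herm x (axis r c) = (\<Sum>s\<in>UNIV. if s = r then x $ r * cnj c else 0)"
    unfolding herm_def by (intro sum.cong) (auto simp: axis_def)
  then show ?thesis
    by simp
qed

lemma herm_linear:
  "herm (x + x') y = herm x y + herm x' y" "herm x (y + y') = herm x y + herm x y'"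
  "herm (t *\<^sub>R x) y = t *\<^sub>R herm x y" "herm x (t *\<^sub>R y) = t *\<^sub>R herm x y"
  "herm x (c *s y) = cnj c * herm x y" "herm (c *s x) y = c * herm x y"
  by (simp_all add: herm_def sum.distrib algebra_simps scaleR_sum_right sum_distrib_left)

lemma herm_self: "Re (herm x x) = 0 \<Longrightarrow> x = 0"
proof -
  assume "Re (herm x x) = 0"
  moreover have "Re (herm x x) = (\<Sum>r\<in>UNIV. (cmod (x $ r))\<^sup>2)"
    by (simp add: herm_def cmod_power2) (simp add: power2_eq_square)
  ultimately show ?thesis
    by (simp add: sum_nonneg_eq_0_iff vec_eq_iff)
qed

lemma real_unit_expansion: "(\<Sum>i\<in>UNIV. Re (herm y (real_unit i)) *\<^sub>R real_unit i) = y"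
  by (simp add: sum_prod_bool real_unit_def herm_axis)
    (simp add: vec_eq_iff axis_def complex_eq_iff sum.distrib if_distrib[of "(*\<^sub>R) _"]
      if_distrib[of Re] if_distrib[of Im] cong: if_cong)

lemma trace_Btilde_sum:
  fixes \<Psi> :: "complex^'n \<Rightarrow> complex^'n \<Rightarrow> complex"
  assumes X: "p_basis X" and \<Psi>: "bilinear \<Psi>"
  shows "(\<Sum>a\<in>UNIV. \<Sum>b\<in>UNIV. matrix_inv (\<chi> c d. Btilde (X c) (X d)) $ a $ b *\<^sub>R \<Psi> (inv q (X a)) (inv q (X b))) =
    (\<Sum>r\<in>UNIV. \<Psi> (axis r 1) (axis r 1) + \<Psi> (axis r \<i>) (axis r \<i>))"
proof -
  have "Btilde (X c) (X d) = Re (herm (inv q (X c)) (inv q (X d)))" for c d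
    using Btilde_q[of "inv q (X c)" "inv q (X d)"] p_basisD(1)[OF X, symmetric] by (simp add: herm_def)
  moreover have "(\<Sum>a\<in>UNIV. \<Sum>b\<in>UNIV. matrix_inv (\<chi> c d. Re (herm (inv q (X c)) (inv q (X d)))) $ a $ b
      *\<^sub>R \<Psi> (inv q (X a)) (inv q (X b))) = (\<Sum>i\<in>UNIV. \<Psi> (real_unit i) (real_unit i))"
  proof (rule dual_basis_sum[where x = "\<lambda>a. inv q (X a)", OF _ \<Psi>])
    show "(\<Sum>a\<in>UNIV. c a *\<^sub>R inv q (X a)) = 0 \<Longrightarrow> c a = 0"
      "\<exists>c. v = (\<Sum>a\<in>UNIV. c a *\<^sub>R inv q (X a))" for c a v
      using p_basisD(2,3)[OF X] by blast+
    show "bilinear (\<lambda>x y. Re (herm x y))"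
      by (auto simp: bilinear_def herm_linear intro!: linearI)
    show "v = 0" if "\<And>u. Re (herm u v) = 0" for v :: "complex^'n"
      using that herm_self by blast
  qed (simp_all add: real_unit_expansion)
  ultimately show ?thesis
    by (simp add: sum_prod_bool real_unit_def)
qed

text \<open>With respect to Omega the real orthonormal basis is dual to its image under
  multiplication by i, because -Im of the Hermitian product of y with i u is the real part of that
  of y with u. The argument -1 is i times i.\<close>

lemma trace_Omega_sum:
  fixes \<Psi> :: "complex^'n \<Rightarrow> complex^'n \<Rightarrow> complex"
  assumes X: "p_basis X" and \<Psi>: "bilinear \<Psi>"
  shows "(\<Sum>a\<in>UNIV. \<Sum>b\<in>UNIV. matrix_inv (\<chi> c d. Omega (X c) (X d)) $ a $ b *\<^sub>R \<Psi> (inv q (X a)) (inv q (X b))) =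
    (\<Sum>r\<in>UNIV. \<Psi> (axis r \<i>) (axis r 1) + \<Psi> (axis r (- 1)) (axis r \<i>))"
proof -
  have "Omega (X c) (X d) = - Im (herm (inv q (X c)) (inv q (X d)))" for c d
    using Omega_q[of "inv q (X c)" "inv q (X d)"] p_basisD(1)[OF X, symmetric] by (simp add: herm_def)
  moreover have "(\<Sum>a\<in>UNIV. \<Sum>b\<in>UNIV. matrix_inv (\<chi> c d. - Im (herm (inv q (X c)) (inv q (X d)))) $ a $ b
      *\<^sub>R \<Psi> (inv q (X a)) (inv q (X b))) = (\<Sum>i\<in>UNIV. \<Psi> (\<i> *s real_unit i) (real_unit i))"
  proof (rule dual_basis_sum[where x = "\<lambda>a. inv q (X a)", OF _ \<Psi>])
    show "(\<Sum>a\<in>UNIV. c a *\<^sub>R inv q (X a)) = 0 \<Longrightarrow> c a = 0"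
      "\<exists>c. v = (\<Sum>a\<in>UNIV. c a *\<^sub>R inv q (X a))" for c a v
      using p_basisD(2,3)[OF X] by blast+
    show "bilinear (\<lambda>x y. - Im (herm x y))"
      by (auto simp: bilinear_def herm_linear intro!: linearI)
    \<comment> \<open>Testing against i v gives minus the squared norm of v.\<close>
    show "v = 0" if "\<And>u. - Im (herm u v) = 0" for v :: "complex^'n"
      using that[of "\<i> *s v"] by (intro herm_self) (simp add: herm_linear)
  qed (simp_all add: real_unit_expansion herm_linear)
  moreover have "\<i> *s axis r c = (axis r (\<i> * c) :: complex^'n)" for r c
    by (simp add: vec_eq_iff axis_def)
  ultimately show ?thesis
    by (simp add: sum_prod_bool real_unit_def)
qed

section \<open>The Dirac operators in terms of creation and annihilation\<close>

locale projective_rep = smooth_rep \<pi>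
  for \<pi> :: "complex^'n::finite option^'n option \<Rightarrow> complex^'d^'d"
begin

text \<open>Agreement on \<open>SU\<close> is enough, since left invariant derivatives follow curves
  inside the group. There \<open>adj g\<close> is the inverse of g.\<close>

definition represents :: "(complex^'d^'d \<Rightarrow> complex^'n \<Rightarrow> complex) \<Rightarrow>
    (complex^'n option^'n option \<Rightarrow> complex^'n \<Rightarrow> complex) \<Rightarrow> bool" where
  "represents T \<phi> \<longleftrightarrow> lin_poly T \<and> (\<forall>g\<in>SU. \<phi> g = T (\<pi> (adj g)))"

lemma representsD: "represents T \<phi> \<Longrightarrow> g \<in> SU \<Longrightarrow> \<phi> g z = T (\<pi> (adj g)) z"
  by (simp add: represents_def)

definition raise :: "'n \<Rightarrow> complex^'d^'d" where
  "raise r = delta (unit_mat (Some r) None)"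

definition lower :: "'n \<Rightarrow> complex^'d^'d" where
  "lower r = delta (unit_mat None (Some r))"

definition creat :: "real \<Rightarrow> (complex^'d^'d \<Rightarrow> complex^'n \<Rightarrow> complex) \<Rightarrow> (complex^'d^'d \<Rightarrow> complex^'n \<Rightarrow> complex)" where
  "creat hbar T A z = (\<Sum>r\<in>UNIV. 1 / (2 * of_real hbar) * (z $ r * T (raise r ** A) z))"

definition annih :: "(complex^'d^'d \<Rightarrow> complex^'n \<Rightarrow> complex) \<Rightarrow> (complex^'d^'d \<Rightarrow> complex^'n \<Rightarrow> complex)" where
  "annih T A z = (\<Sum>r\<in>UNIV. partial_deriv r (T (lower r ** A)) z)"

lemma lin_poly_creat: "lin_poly T \<Longrightarrow> lin_poly (creat hbar T)"
  unfolding creat_def[abs_def]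
  by (intro lin_poly_setsum lin_poly_cmult lin_poly_coord_mult lin_poly_mult)

lemma lin_poly_annih: "lin_poly T \<Longrightarrow> lin_poly (annih T)"
  unfolding annih_def[abs_def]
  by (intro lin_poly_setsum lin_poly_partial_deriv lin_poly_mult)

text \<open>The shape c (S + d T) is the one in which both Dirac operators are stated, with d = -1
  or d = 1 kept literally, so that their composites can be rewritten.\<close>

lemma creat_comb: "creat hbar (\<lambda>A z. c * (S A z + d * T A z)) A z = c * (creat hbar S A z + d * creat hbar T A z)"
  by (simp add: creat_def sum.distrib sum_distrib_left algebra_simps)

lemma annih_comb:
  assumes "lin_poly S" "lin_poly T"
  shows "annih (\<lambda>A z. c * (S A z + d * T A z)) A z = c * (annih S A z + d * annih T A z)"
  by (simp add: annih_def partial_deriv_cmult partial_deriv_add poly_fun_add poly_fun_cmult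
      lin_polyD(1)[OF assms(1)] lin_polyD(1)[OF assms(2)] sum.distrib sum_distrib_left algebra_simps)

text \<open>Inverting g exp(tY) puts exp(-tY) on the left. This explains both the sign and why the
  derivative is a left multiplication of the argument of \<open>T\<close>.\<close>

lemma left_inv_deriv_represents:
  assumes T: "represents T \<phi>" and g: "g \<in> SU" and Y: "Y \<in> su"
  shows "left_inv_deriv Y \<phi> g z = - T (delta Y ** \<pi> (adj g)) z"
proof -
  have lp: "lin_poly T" and \<phi>: "\<And>h. h \<in> SU \<Longrightarrow> \<phi> h z = T (\<pi> (adj h)) z"
    using T by (simp_all add: represents_def)
  have mY: "- Y \<in> su"
    using su_scaleR[OF Y, of "-1"] by simp
  have eq: "\<phi> (g ** mexp (t *\<^sub>R Y)) z = T (\<pi> (mexp (t *\<^sub>R (- Y))) ** \<pi> (adj g)) z" for t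
  proof -
    have "t *\<^sub>R Y \<in> su" "t *\<^sub>R (- Y) \<in> su"
      using Y mY by (simp_all only: su_scaleR)
    then show ?thesis
      using g by (simp add: \<phi> SU_mult mexp_SU adj_mult adj_mexp[of "t *\<^sub>R Y"] suD rep_mult SU_adj)
  qed
  have "((\<lambda>t. \<pi> (mexp (t *\<^sub>R (- Y))) ** \<pi> (adj g)) has_vector_derivative dpi (- Y) ** \<pi> (adj g)) (at 0)"
    using has_vector_derivative_matrix_mult[OF dpi_mexp[OF mY] has_vector_derivative_const, of "\<pi> (adj g)"]
    by (simp add: matrix_mult_zero_right)
  then have "((\<lambda>t. T (\<pi> (mexp (t *\<^sub>R (- Y))) ** \<pi> (adj g)) z) has_vector_derivative
      T (dpi (- Y) ** \<pi> (adj g)) z) (at 0)"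
    by (rule has_vector_derivative_linear[rotated])
      (auto intro!: linearI simp: lin_polyD[OF lp] scaleR_conv_of_real[where 'a = complex])
  then have "left_inv_deriv Y \<phi> g z = T (dpi (- Y) ** \<pi> (adj g)) z"
    unfolding left_inv_deriv_def eq by (rule vector_derivative_at)
  also have "\<dots> = - T (delta Y ** \<pi> (adj g)) z"
    by (simp add: delta_su[OF Y] linear_neg[OF linear_dpi] matrix_mult_minus_left lin_polyD[OF lp])
  finally show ?thesis .
qed

text \<open>Up to sign, one Clifford multiplication after one derivative, as a form on pairs of
  tangent vectors. It is only real bilinear, because Clifford multiplication and \<open>q\<close>
  both involve conjugates.\<close>

definition dirac_form :: "real \<Rightarrow> (complex^'d^'d \<Rightarrow> complex^'n \<Rightarrow> complex) \<Rightarrow> complex^'d^'d \<Rightarrow> complex^'n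
    \<Rightarrow> complex^'n \<Rightarrow> complex^'n \<Rightarrow> complex" where
  "dirac_form hbar T A z \<alpha> \<beta> = clv hbar \<alpha> (T (delta (q \<beta>) ** A)) z"

lemma bilinear_dirac_form:
  assumes T: "lin_poly T"
  shows "bilinear (dirac_form hbar T A z)"
proof -
  have "T (delta (q (\<beta> + \<gamma>)) ** A) = (\<lambda>z. T (delta (q \<beta>) ** A) z + T (delta (q \<gamma>) ** A) z)"
    "T (delta (q (t *\<^sub>R \<beta>)) ** A) = (\<lambda>z. of_real t * T (delta (q \<beta>) ** A) z)" for \<beta> \<gamma> t
    by (simp_all add: fun_eq_iff q_add q_scaleR delta_add delta_scaleR matrix_mult_add_left
        matrix_mult_scaleR_left lin_polyD[OF T])
  then show ?thesis
    by (auto simp: bilinear_def dirac_form_def clv_add_left clv_scaleR_left clv_add_right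
        clv_cmult_right lin_polyD(1)[OF T] scaleR_conv_of_real[where 'a = complex] intro!: linearI)
qed

text \<open>The tangent vector q(c e_r) equals c E_r0 - cnj(c) E_0r, which separates the raising
  from the lowering part.\<close>

lemma dirac_form_axis:
  assumes T: "lin_poly T"
  shows "dirac_form hbar T A z (axis r b) (axis r c) =
    1 / (2 * of_real hbar) * z $ r * cnj b * (c * T (raise r ** A) z - cnj c * T (lower r ** A) z)
    - b * (c * partial_deriv r (T (raise r ** A)) z - cnj c * partial_deriv r (T (lower r ** A)) z)"
proof -
  have "q (axis r c) = cscale c (unit_mat (Some r) None) + cscale (- cnj c) (unit_mat None (Some r))"
    by (auto simp: vec_option_eq_iff q_def unit_mat_nth axis_def)
  then have "T (delta (q (axis r c)) ** A) = (\<lambda>z. c * T (raise r ** A) z + (- cnj c) * T (lower r ** A) z)"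
    by (simp add: fun_eq_iff delta_add delta_cscale matrix_mult_add_left cscale_mult_left
        lin_polyD[OF T] raise_def lower_def del: cscale_simps)
  moreover have "partial_deriv r (\<lambda>z. c * T (raise r ** A) z + (- cnj c) * T (lower r ** A) z) z =
      c * partial_deriv r (T (raise r ** A)) z + (- cnj c) * partial_deriv r (T (lower r ** A)) z"
    by (simp only: partial_deriv_add partial_deriv_cmult poly_fun_cmult lin_polyD(1)[OF T])
  ultimately show ?thesis
    by (simp add: dirac_form_def clv_axis)
qed

lemma cl_left_inv_deriv:
  assumes X: "p_basis X" and T: "represents T \<phi>" and g: "g \<in> SU"
  shows "cl hbar (X a) (left_inv_deriv (X b) \<phi> g) z =
    - dirac_form hbar T (\<pi> (adj g)) z (inv q (X a)) (inv q (X b))"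
proof -
  have lp: "lin_poly T"
    using T by (simp add: represents_def)
  have X_b: "X b = q (inv q (X b))"
    by (rule p_basisD(1)[OF X])
  then have "X b \<in> su"
    using q_su by metis
  then have "left_inv_deriv (X b) \<phi> g = (\<lambda>z. (- 1) * T (delta (q (inv q (X b))) ** \<pi> (adj g)) z)"
    using left_inv_deriv_represents[OF T g] X_b by (simp add: fun_eq_iff)
  then show ?thesis
    using clv_cmult_right[OF lin_polyD(1)[OF lp], of hbar _ "- 1"]
    by (simp only: cl_eq_clv dirac_form_def) simp
qed

text \<open>Between the two pairs belonging to r the products z_r T(E_0r A) and the derivatives of
  T(E_r0 A) cancel, while the other two kinds of terms double.\<close>

lemma represents_dirac:
  assumes X: "p_basis X" and T: "represents T \<phi>"
  shows "represents (\<lambda>A z. (- 2 * \<i>) * (creat hbar T A z + (- 1) * annih T A z)) (dirac hbar X \<phi>)"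
proof -
  have lp: "lin_poly T"
    using T by (simp add: represents_def)
  have "dirac hbar X \<phi> g z = (- 2 * \<i>) * (creat hbar T (\<pi> (adj g)) z + (- 1) * annih T (\<pi> (adj g)) z)"
    if g: "g \<in> SU" for g z
  proof -
    let ?\<Psi> = "dirac_form hbar T (\<pi> (adj g)) z"
    define h where "h = 1 / (2 * complex_of_real hbar)"
    have "dirac hbar X \<phi> g z = (\<Sum>a\<in>UNIV. \<Sum>b\<in>UNIV.
        matrix_inv (\<chi> c d. Omega (X c) (X d)) $ a $ b *\<^sub>R ?\<Psi> (inv q (X a)) (inv q (X b)))"
      by (simp add: dirac_def cl_left_inv_deriv[OF X T g] sum_negf scaleR_conv_of_real[where 'a = complex])
    also have "\<dots> = (\<Sum>r\<in>UNIV. ?\<Psi> (axis r \<i>) (axis r 1) + ?\<Psi> (axis r (- 1)) (axis r \<i>))"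
      by (rule trace_Omega_sum[OF X bilinear_dirac_form[OF lp]])
    also have "\<dots> = (- 2 * \<i>) * (creat hbar T (\<pi> (adj g)) z + (- 1) * annih T (\<pi> (adj g)) z)"
      unfolding creat_def annih_def sum_distrib_left sum.distrib[symmetric] dirac_form_axis[OF lp]
        h_def[symmetric]
      by (intro sum.cong refl) (simp add: algebra_simps)
    finally show ?thesis .
  qed
  then show ?thesis
    unfolding represents_def
    by (intro conjI ballI ext lin_poly_cmult lin_poly_add lin_poly_creat lin_poly_annih lp)
qed

text \<open>The same terms cancel as for \<open>dirac\<close>. The sign from differentiating an
  inverse survives here, whereas there it meets the sign in the definition of the operator.\<close>

lemma represents_dirac_J:
  assumes X: "p_basis X" and T: "represents T \<phi>"
  shows "represents (\<lambda>A z. (- 2) * (creat hbar T A z + 1 * annih T A z)) (dirac_J hbar X \<phi>)"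
proof -
  have lp: "lin_poly T"
    using T by (simp add: represents_def)
  have "dirac_J hbar X \<phi> g z = (- 2) * (creat hbar T (\<pi> (adj g)) z + 1 * annih T (\<pi> (adj g)) z)"
    if g: "g \<in> SU" for g z
  proof -
    let ?\<Psi> = "dirac_form hbar T (\<pi> (adj g)) z"
    define h where "h = 1 / (2 * complex_of_real hbar)"
    have "dirac_J hbar X \<phi> g z = - (\<Sum>a\<in>UNIV. \<Sum>b\<in>UNIV.
        matrix_inv (\<chi> c d. Btilde (X c) (X d)) $ a $ b *\<^sub>R ?\<Psi> (inv q (X a)) (inv q (X b)))"
      by (simp add: dirac_J_def cl_left_inv_deriv[OF X T g] sum_negf scaleR_conv_of_real[where 'a = complex])
    also have "(\<Sum>a\<in>UNIV. \<Sum>b\<in>UNIV.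
        matrix_inv (\<chi> c d. Btilde (X c) (X d)) $ a $ b *\<^sub>R ?\<Psi> (inv q (X a)) (inv q (X b))) =
        (\<Sum>r\<in>UNIV. ?\<Psi> (axis r 1) (axis r 1) + ?\<Psi> (axis r \<i>) (axis r \<i>))"
      by (rule trace_Btilde_sum[OF X bilinear_dirac_form[OF lp]])
    also have "- \<dots> = (- 2) * (creat hbar T (\<pi> (adj g)) z + 1 * annih T (\<pi> (adj g)) z)"
      unfolding creat_def annih_def sum_distrib_left sum.distrib[symmetric] dirac_form_axis[OF lp]
        h_def[symmetric] sum_negf[symmetric]
      by (intro sum.cong refl) (simp add: algebra_simps)
    finally show ?thesis .
  qed
  then show ?thesis
    unfolding represents_def
    by (intro conjI ballI ext lin_poly_cmult lin_poly_add lin_poly_creat lin_poly_annih lp)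
qed

text \<open>The squares of creation and of annihilation drop out of the commutator of the two Dirac
  operators, and the prefactors give -i * 4i * 2 = 8.\<close>

lemma P_op_represents:
  assumes X: "p_basis X" and T: "represents T \<phi>" and g: "g \<in> SU"
  shows "P_op hbar X \<phi> g z =
    8 * (creat hbar (annih T) (\<pi> (adj g)) z - annih (creat hbar T) (\<pi> (adj g)) z)"
proof -
  let ?A = "\<pi> (adj g)"
  have lp: "lin_poly T"
    using T by (simp add: represents_def)
  note lps = lin_poly_creat[OF lp, of hbar] lin_poly_annih[OF lp]
  note DJ = represents_dirac_J[OF X T, of hbar]
  note D = represents_dirac[OF X T, of hbar]
  note DDJ = represents_dirac[OF X DJ, of hbar]
  note DJD = represents_dirac_J[OF X D, of hbar]
  have DDJ_eq: "dirac hbar X (dirac_J hbar X \<phi>) g z = (- 2 * \<i>) * ((- 2) * (creat hbar (creat hbar T) ?A z + 1 * creat hbar (annih T) ?A z)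
      + (- 1) * ((- 2) * (annih (creat hbar T) ?A z + 1 * annih (annih T) ?A z)))"
    using representsD[OF DDJ g, of z] by (simp only: creat_comb annih_comb[OF lps])
  have DJD_eq: "dirac_J hbar X (dirac hbar X \<phi>) g z = (- 2) * ((- 2 * \<i>) * (creat hbar (creat hbar T) ?A z + (- 1) * creat hbar (annih T) ?A z)
      + 1 * ((- 2 * \<i>) * (annih (creat hbar T) ?A z + (- 1) * annih (annih T) ?A z)))"
    using representsD[OF DJD g, of z] by (simp only: creat_comb annih_comb[OF lps])
  show ?thesis
    unfolding P_op_def DDJ_eq DJD_eq by (simp add: algebra_simps)
qed

end

section \<open>The action of the complexified isotropy algebra\<close>

text \<open>The derivative of \<open>qtilde\<close> at the identity, extended complex linearly.\<close>

definition dqtilde :: "complex^'n^'n \<Rightarrow> complex^'n::finite option^'n option" where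
  "dqtilde Y = (\<chi> i j. case (i, j) of
      (None, None) \<Rightarrow> - trace Y
    | (Some r, Some s) \<Rightarrow> Y $ r $ s
    | _ \<Rightarrow> 0)"

lemma dqtilde_nth [simp]:
  "dqtilde Y $ None $ None = - trace Y" "dqtilde Y $ None $ Some s = 0"
  "dqtilde Y $ Some r $ None = 0" "dqtilde Y $ Some r $ Some s = Y $ r $ s"
  by (simp_all add: dqtilde_def)

lemma dqtilde_su: "adj Y = - Y \<Longrightarrow> dqtilde Y \<in> su"
proof -
  assume Y: "adj Y = - Y"
  have "cnj (Y $ s $ r) = - Y $ r $ s" for r s
    using arg_cong[OF Y, of "\<lambda>M. M $ r $ s"] by simp
  moreover have "cnj (trace Y) = - trace Y"
    using trace_adj[of Y] Y by (simp add: trace_uminus)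
  moreover have "trace (dqtilde Y) = 0"
    by (simp add: trace_def sum_option_UNIV)
  ultimately show ?thesis
    by (simp add: su_def vec_option_eq_iff)
qed

lemma dqtilde_decomp: "dqtilde M = dqtilde (skew M) + cscale \<i> (dqtilde (skew (cscale (- \<i>) M)))"
proof -
  have "trace M = trace (skew M) + \<i> * trace (skew (cscale (- \<i>) M))"
    using arg_cong[OF skew_decomp[of M], of trace] by (simp add: trace_add trace_cscale)
  moreover have "M $ r $ s = skew M $ r $ s + \<i> * skew (cscale (- \<i>) M) $ r $ s" for r s
    using arg_cong[OF skew_decomp[of M], of "\<lambda>M. M $ r $ s"] by simp
  ultimately show ?thesis
    by (simp add: vec_option_eq_iff)
qed

lemma partial_deriv_diff:
  assumes "poly_fun f" "poly_fun g"
  shows "partial_deriv r (\<lambda>z. f z - g z) = (\<lambda>z. partial_deriv r f z - partial_deriv r g z)"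
  using partial_deriv_add[OF assms(1) poly_fun_cmult[OF assms(2), of "- 1"]]
    partial_deriv_cmult[OF assms(2), of r "- 1"] by simp

lemma trace_unit_mat: "trace (unit_mat r s) = (if r = s then 1 else 0)"
  by (cases "r = s") (auto simp: trace_def unit_mat_nth intro!: sum.neutral)

lemma qtilde_mat1: "qtilde (mat 1) = mat 1"
  by (simp add: vec_option_eq_iff) (simp add: mat_def)

context projective_rep
begin

definition equivariant :: "int \<Rightarrow> nat \<Rightarrow> (complex^'d^'d \<Rightarrow> complex^'n \<Rightarrow> complex) \<Rightarrow> bool" where
  "equivariant k l T \<longleftrightarrow> lin_poly T \<and> (\<forall>A. T A \<in> hom_poly l) \<and>
     (\<forall>U\<in>unitary_group. \<forall>A z.
        T (\<pi> (qtilde U) ** A) z = det U powi (k - int l) * T A (matrix_inv U *v z))"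

text \<open>This is equivariance differentiated along exp(tY): the power of the determinant yields
  the trace term, and the inverse acting on z yields the negative linear vector field.\<close>

lemma equivariant_skew:
  assumes T: "equivariant k l T" and Y: "adj Y = - Y"
  shows "T (delta (dqtilde Y) ** A) z =
    of_int (k - int l) * trace Y * T A z - (\<Sum>r\<in>UNIV. (Y *v z) $ r * partial_deriv r (T A) z)"
proof (rule vector_derivative_unique)
  let ?c = "\<lambda>t::real. mexp (t *\<^sub>R Y)"
  have lp: "lin_poly T"
    using T by (simp add: equivariant_def)
  have tY: "adj (t *\<^sub>R Y) = - (t *\<^sub>R Y)" for t :: real
    using Y by (simp add: adj_scaleR)
  note U = mexp_unitary[OF tY]
  have det: "((\<lambda>t. det (?c t)) has_vector_derivative trace Y) (at 0)"
    by (rule has_vector_derivative_det[OF has_vector_derivative_mexp_0]) simp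
  have inv_det: "((\<lambda>t. inverse (det (?c t))) has_vector_derivative - trace Y) (at 0)"
  proof -
    have "(inverse has_field_derivative - 1) (at (det (?c 0)))"
      by (auto intro!: derivative_eq_intros)
    from field_vector_diff_chain_at[OF det this] show ?thesis
      by (simp add: o_def)
  qed
  have "((\<lambda>t. qtilde (?c t)) has_vector_derivative dqtilde Y) (at 0)"
  proof (rule has_vector_derivative_matrixI)
    fix i j
    show "((\<lambda>t. qtilde (?c t) $ i $ j) has_vector_derivative dqtilde Y $ i $ j) (at 0)"
      using inv_det has_vector_derivative_nth[OF has_vector_derivative_nth[OF has_vector_derivative_mexp_0[of Y]]]
      by (cases i; cases j) simp_all
  qed
  then have "((\<lambda>t. \<pi> (qtilde (?c t))) has_vector_derivative delta (dqtilde Y)) (at 0)"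
    unfolding delta_su[OF dqtilde_su[OF Y]]
    by (intro dpi_curve) (simp_all add: qtilde_SU U qtilde_mat1)
  then have "((\<lambda>t. \<pi> (qtilde (?c t)) ** A) has_vector_derivative delta (dqtilde Y) ** A) (at 0)"
    using has_vector_derivative_matrix_mult[OF _ has_vector_derivative_const]
    by (force simp: matrix_mult_zero_right)
  then show "((\<lambda>t. T (\<pi> (qtilde (?c t)) ** A) z) has_vector_derivative T (delta (dqtilde Y) ** A) z) (at 0)"
    by (rule has_vector_derivative_linear[rotated])
      (auto intro!: linearI simp: lin_polyD[OF lp] scaleR_conv_of_real[where 'a = complex])
  have d1: "((\<lambda>t. det (?c t) powi m) has_vector_derivative of_int m * trace Y) (at 0)" for m
  proof -
    have "((\<lambda>x. x powi m) has_field_derivative of_int m) (at (det (?c 0)))"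
      using has_derivative_power_int'[of "1 :: complex" m UNIV]
      by (simp add: has_field_derivative_def mult_commute_abs)
    from field_vector_diff_chain_at[OF det this] show ?thesis
      by (simp add: o_def mult.commute)
  qed
  have d2: "((\<lambda>t. T A (mexp (t *\<^sub>R (- Y)) *v z)) has_vector_derivative
      (\<Sum>r\<in>UNIV. ((- Y) *v z) $ r * partial_deriv r (T A) z)) (at 0)"
    using poly_fun_chain[OF lin_polyD(1)[OF lp] has_vector_derivative_matrix_vector_mult[OF
          has_vector_derivative_mexp_0[of "- Y"] has_vector_derivative_const], of A z]
    by simp
  have "((\<lambda>t. det (?c t) powi (k - int l) * T A (mexp (t *\<^sub>R (- Y)) *v z)) has_vector_derivative
      (\<Sum>r\<in>UNIV. ((- Y) *v z) $ r * partial_deriv r (T A) z) + of_int (k - int l) * trace Y * T A z) (at 0)"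
    using has_vector_derivative_mult[OF d1[of "k - int l"] d2] by simp
  moreover have "(- Y) *v z = - (Y *v z)"
    by (simp add: vec_eq_iff matrix_vector_mult_def sum_negf)
  moreover have "T (\<pi> (qtilde (?c t)) ** A) z = det (?c t) powi (k - int l) * T A (mexp (t *\<^sub>R (- Y)) *v z)" for t
    using T U[of t] unitary_groupD(3)[OF U[of t]] adj_mexp[OF tY[of t]] by (simp add: equivariant_def)
  ultimately show "((\<lambda>t. T (\<pi> (qtilde (?c t)) ** A) z) has_vector_derivative
      of_int (k - int l) * trace Y * T A z - (\<Sum>r\<in>UNIV. (Y *v z) $ r * partial_deriv r (T A) z)) (at 0)"
    by (simp add: sum_negf)
qed

text \<open>Both sides are complex linear in \<open>M\<close>, so the skew-Hermitian case extends to
  all matrices and in particular to single matrix units.\<close>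

lemma equivariant_dqtilde:
  assumes T: "equivariant k l T"
  shows "T (delta (dqtilde M) ** A) z =
    of_int (k - int l) * trace M * T A z - (\<Sum>r\<in>UNIV. (M *v z) $ r * partial_deriv r (T A) z)"
proof -
  let ?X = "skew M" and ?Y = "skew (cscale (- \<i>) M)"
  let ?R = "\<lambda>M. of_int (k - int l) * trace M * T A z - (\<Sum>r\<in>UNIV. (M *v z) $ r * partial_deriv r (T A) z)"
  have lp: "lin_poly T"
    using T by (simp add: equivariant_def)
  have adj: "adj (skew B) = - skew B" for B :: "complex^'n^'n"
    by (simp add: skew_def adj_scaleR adj_diff algebra_simps)
  have "T (delta (dqtilde M) ** A) z = T (delta (dqtilde ?X) ** A) z + \<i> * T (delta (dqtilde ?Y) ** A) z"
    by (subst dqtilde_decomp) (simp add: delta_add delta_cscale matrix_mult_add_left cscale_mult_left lin_polyD[OF lp])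
  also have "\<dots> = ?R ?X + \<i> * ?R ?Y"
    by (simp only: equivariant_skew[OF T adj])
  also have "\<dots> = ?R (?X + cscale \<i> ?Y)"
    by (simp add: trace_add trace_cscale matrix_vector_mult_add_rdistrib cscale_mult_vec sum.distrib
        sum_distrib_left algebra_simps)
  finally show ?thesis
    by (simp only: skew_decomp[of M, symmetric])
qed

text \<open>The scalar by which \<open>E\<^sub>0\<^sub>0\<close> acts: it is forced by the vanishing of \<open>delta\<close> on the
  identity matrix.\<close>

definition weight0 :: "int \<Rightarrow> nat \<Rightarrow> complex" where
  "weight0 k l = (of_nat l - of_nat CARD('n) * of_int (k - int l)) / (of_nat CARD('n) + 1)"

lemma equivariant_unit:
  assumes T: "equivariant k l T"
  shows "T (delta (unit_mat None None) ** A) z = weight0 k l * T A z"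
    and "T (delta (unit_mat (Some r) (Some s)) ** A) z =
      (if r = s then (of_int (k - int l) + weight0 k l) * T A z else 0) - z $ s * partial_deriv r (T A) z"
proof -
  let ?e = "unit_mat None None :: complex^'n option^'n option"
  let ?\<kappa> = "of_int (k - int l) :: complex"
  have lp: "lin_poly T" and hp: "T A \<in> hom_poly l"
    using T by (simp_all add: equivariant_def)
  have rs: "T (delta (unit_mat (Some r) (Some s)) ** A) z =
      (if r = s then ?\<kappa> * T A z + T (delta ?e ** A) z else 0) - z $ s * partial_deriv r (T A) z" for r s
  proof -
    \<comment> \<open>The embedded unit has the entry -1 at (None, None) when r = s; adding E_00
      compensates for it. This is why the action of E_00 has to be found first.\<close>
    have "unit_mat (Some r) (Some s) = dqtilde (unit_mat r s) + (if r = s then ?e else 0)"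
      by (auto simp: vec_option_eq_iff unit_mat_nth trace_unit_mat)
    then have "T (delta (unit_mat (Some r) (Some s)) ** A) z =
        T (delta (dqtilde (unit_mat r s)) ** A) z + (if r = s then T (delta ?e ** A) z else 0)"
      by (auto simp: delta_add linear_0[OF linear_delta] matrix_mult_add_left matrix_mult_zero_left lin_polyD[OF lp])
    moreover have "(unit_mat r s *v z) $ t = (if t = r then z $ s else 0)" for t
      by (simp add: matrix_vector_mult_def unit_mat_nth if_distrib[of "\<lambda>x. x * _"] cong: if_cong)
    then have "(\<Sum>t\<in>UNIV. (unit_mat r s *v z) $ t * partial_deriv t (T A) z) = z $ s * partial_deriv r (T A) z"
      by (simp add: if_distrib[of "\<lambda>x. x * _"] cong: if_cong)
    ultimately show ?thesis
      by (simp add: equivariant_dqtilde[OF T] trace_unit_mat)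
  qed
  \<comment> \<open>All diagonal units sum to the identity, which \<open>delta\<close> kills. With
    Euler's identity this is a linear equation for the unknown action of E_00.\<close>
  have "delta ?e + (\<Sum>r\<in>UNIV. delta (unit_mat (Some r) (Some r))) = 0"
    using delta_mat1 by (simp add: mat1_unit sum_option_UNIV delta_linear_simps)
  then have "T ((delta ?e + (\<Sum>r\<in>UNIV. delta (unit_mat (Some r) (Some r)))) ** A) z = 0"
    by (simp add: matrix_mult_zero_left lin_polyD[OF lp])
  then have "T (delta ?e ** A) z + (\<Sum>r\<in>UNIV. T (delta (unit_mat (Some r) (Some r)) ** A) z) = 0"
    by (simp add: matrix_mult_add_left matrix_mult_sum_left lin_polyD[OF lp] lin_poly_sum[OF lp])
  then have "T (delta ?e ** A) z +
      (of_nat CARD('n) * (?\<kappa> * T A z + T (delta ?e ** A) z) - of_nat l * T A z) = 0"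
    by (simp add: rs sum_subtractf hom_poly_euler[OF hp])
  then have "(of_nat CARD('n) + 1) * T (delta ?e ** A) z = (of_nat l - of_nat CARD('n) * ?\<kappa>) * T A z"
    by (simp add: algebra_simps)
  moreover have "(of_nat CARD('n) + 1 :: complex) \<noteq> 0"
    by (metis of_nat_Suc of_nat_neq_0 add.commute)
  ultimately show e: "T (delta ?e ** A) z = weight0 k l * T A z"
    unfolding weight0_def by (simp add: field_simps)
  show "T (delta (unit_mat (Some r) (Some s)) ** A) z =
      (if r = s then (?\<kappa> + weight0 k l) * T A z else 0) - z $ s * partial_deriv r (T A) z"
    by (simp add: rs e algebra_simps)
qed

lemma lower_raise: "lower s ** raise r = raise r ** lower s +
    ((if r = s then delta (unit_mat None None) else 0) - delta (unit_mat (Some r) (Some s)))"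
  using delta_bracket[of "unit_mat None (Some s)" "unit_mat (Some r) None"]
  by (auto simp: lower_def raise_def unit_mat_mult delta_linear_simps algebra_simps)

text \<open>The summand is z_r d_s (z_s d_r f). The first order terms are n copies of Euler's
  identity, and the second order terms give l (l - 1).\<close>

lemma euler_sums:
  fixes z :: "complex^'n"
  assumes "f \<in> hom_poly l"
  shows "(\<Sum>r\<in>UNIV. \<Sum>s\<in>UNIV. z $ r * (partial_deriv r f z + z $ s * partial_deriv s (partial_deriv r f) z)) =
    of_nat l * (of_nat CARD('n) + of_nat l - 1) * f z"
proof -
  have "(\<Sum>r\<in>UNIV. \<Sum>s\<in>UNIV. z $ r * (partial_deriv r f z + z $ s * partial_deriv s (partial_deriv r f) z)) =
      (\<Sum>r\<in>UNIV. \<Sum>s\<in>(UNIV :: 'n set). z $ r * partial_deriv r f z) +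
      (\<Sum>r\<in>UNIV. \<Sum>s\<in>UNIV. z $ s * (z $ r * partial_deriv s (partial_deriv r f) z))"
    by (simp only: distrib_left sum.distrib mult.left_commute)
  also have "(\<Sum>r\<in>UNIV. \<Sum>s\<in>(UNIV :: 'n set). z $ r * partial_deriv r f z) = of_nat CARD('n) * (of_nat l * f z)"
    by (simp only: sum_constant hom_poly_euler[OF assms] flip: sum_distrib_left)
  also have "(\<Sum>r\<in>UNIV. \<Sum>s\<in>UNIV. z $ s * (z $ r * partial_deriv s (partial_deriv r f) z)) =
      (\<Sum>s\<in>UNIV. z $ s * (\<Sum>r\<in>UNIV. z $ r * partial_deriv s (partial_deriv r f) z))"
    by (subst sum.swap) (simp only: sum_distrib_left)
  also have "\<dots> = (\<Sum>s\<in>UNIV. (of_nat l - 1) * (z $ s * partial_deriv s f z))"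
    by (simp only: hom_poly_euler_partial[OF assms] mult.left_commute)
  also have "\<dots> = (of_nat l - 1) * (of_nat l * f z)"
    by (simp only: hom_poly_euler[OF assms] flip: sum_distrib_left)
  finally show ?thesis
    by (simp add: algebra_simps)
qed

text \<open>One order of the operators involves E_0s E_r0, the other E_r0 E_0s. Exchanging these
  costs an isotropy term, after which the remaining double sums cancel. The sum on the right arises
  where annihilation differentiates the coordinate inserted by creation.\<close>

lemma creat_annih_commutator:
  assumes T: "equivariant k l T" and "hbar \<noteq> 0"
  shows "2 * of_real hbar * (creat hbar (annih T) A z - annih (creat hbar T) A z) =
    of_nat l * (of_nat CARD('n) + of_nat l - 1 - of_int (k - int l)) * T A z
    - (\<Sum>r\<in>UNIV. T (raise r ** lower r ** A) z)"
proof -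
  define \<kappa> :: complex where "\<kappa> = of_int (k - int l)"
  define h where "h = 1 / (2 * complex_of_real hbar)"
  have lp: "lin_poly T" and hp: "T A \<in> hom_poly l"
    using T by (simp_all add: equivariant_def)
  note pf = lin_polyD(1)[OF lp]
  have 1: "creat hbar (annih T) A z = h * (\<Sum>r\<in>UNIV. \<Sum>s\<in>UNIV. z $ r * partial_deriv s (T (lower s ** raise r ** A)) z)"
    by (simp add: creat_def annih_def sum_distrib_left matrix_mul_assoc flip: h_def)
  \<comment> \<open>For r = s the bracket is E_00 - E_rr, so the scalar \<open>weight0\<close> drops
    out.\<close>
  have comm: "T (lower s ** raise r ** A) = (\<lambda>z. T (raise r ** lower s ** A) z +
      ((if r = s then - \<kappa> else 0) * T A z + z $ s * partial_deriv r (T A) z))" for r s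
    by (simp add: fun_eq_iff lower_raise matrix_mult_add_left matrix_mult_diff_left
        matrix_mult_zero_left lin_polyD[OF lp] equivariant_unit[OF T] \<kappa>_def algebra_simps)
  have d: "partial_deriv s (T (lower s ** raise r ** A)) z = partial_deriv s (T (raise r ** lower s ** A)) z +
      ((if r = s then - \<kappa> else 0) * partial_deriv s (T A) z +
       (partial_deriv r (T A) z + z $ s * partial_deriv s (partial_deriv r (T A)) z))" for r s
    unfolding comm
    by (simp add: partial_deriv_add partial_deriv_cmult partial_deriv_mult partial_deriv_coord pf
        poly_fun_add poly_fun_mult poly_fun_const poly_fun_coord poly_fun_partial_deriv)
  have 2: "annih (creat hbar T) A z = h * (\<Sum>s\<in>UNIV. \<Sum>r\<in>UNIV.
      (if r = s then T (raise r ** lower r ** A) z else 0) + z $ r * partial_deriv s (T (raise r ** lower s ** A)) z)"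
  proof -
    have "partial_deriv s (creat hbar T (lower s ** A)) z = (\<Sum>r\<in>UNIV. h *
       ((if r = s then T (raise r ** lower r ** A) z else 0) + z $ r * partial_deriv s (T (raise r ** lower s ** A)) z))" for s
    proof -
      have "creat hbar T (lower s ** A) = (\<lambda>z. \<Sum>r\<in>UNIV. h * (z $ r * T (raise r ** lower s ** A) z))"
        by (simp add: fun_eq_iff creat_def h_def matrix_mul_assoc)
      then show ?thesis
        by (simp add: partial_deriv_sum partial_deriv_cmult partial_deriv_mult partial_deriv_coord pf
            poly_fun_cmult poly_fun_mult poly_fun_coord)
          (intro sum.cong refl, auto simp: algebra_simps)
    qed
    then show ?thesis
      by (simp add: annih_def sum_distrib_left)
  qed
  have sum1: "(\<Sum>r\<in>UNIV. \<Sum>s\<in>UNIV. z $ r * ((if r = s then - \<kappa> else 0) * partial_deriv s (T A) z)) = - \<kappa> * of_nat l * T A z"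
  proof -
    have "(\<Sum>s\<in>UNIV. z $ r * ((if r = s then - \<kappa> else 0) * partial_deriv s (T A) z)) =
        - \<kappa> * (z $ r * partial_deriv r (T A) z)" for r
      by (simp add: if_distrib[of "\<lambda>x. x * _"] if_distrib[of "(*) _"] cong: if_cong)
    then show ?thesis
      by (simp add: hom_poly_euler[OF hp] sum_negf flip: sum_distrib_left)
  qed
  have "creat hbar (annih T) A z = h * ((\<Sum>r\<in>UNIV. \<Sum>s\<in>UNIV. z $ r * partial_deriv s (T (raise r ** lower s ** A)) z)
      + (- \<kappa> * of_nat l * T A z + of_nat l * (of_nat CARD('n) + of_nat l - 1) * T A z))"
    unfolding 1 d distrib_left[of "z $ _"] sum.distrib sum1
    \<comment> \<open>The first and second order terms are recombined into the double sum of
      \<open>euler_sums\<close>.\<close>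
    unfolding distrib_left[symmetric] sum.distrib[symmetric] euler_sums[OF hp] by simp
  moreover have "annih (creat hbar T) A z = h * ((\<Sum>r\<in>UNIV. T (raise r ** lower r ** A) z) +
      (\<Sum>r\<in>UNIV. \<Sum>s\<in>UNIV. z $ r * partial_deriv s (T (raise r ** lower s ** A)) z))"
    unfolding 2 sum.distrib by (subst (2) sum.swap) simp
  ultimately have "creat hbar (annih T) A z - annih (creat hbar T) A z =
      h * (of_nat l * (of_nat CARD('n) + of_nat l - 1 - \<kappa>) * T A z - (\<Sum>r\<in>UNIV. T (raise r ** lower r ** A) z))"
    by (simp add: algebra_simps)
  moreover have "2 * of_real hbar * h = 1"
    using assms(2) by (simp add: h_def)
  ultimately show ?thesis
    by (simp only: mult.assoc[symmetric] \<kappa>_def mult_1_left)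
qed

text \<open>The pairs of indices are sorted by whether they contain \<open>None\<close>. The
  products E_0r E_r0 are reordered into a second copy of the sum of E_r0 E_0r, which explains the
  factor 2; every other product lies in the isotropy algebra and acts by a constant after Euler's
  identity.\<close>

lemma casimir_equivariant:
  fixes k l
  defines "\<kappa> \<equiv> of_int (k - int l) :: complex" and "e \<equiv> weight0 k l"
  assumes T: "equivariant k l T"
  shows "T (casimir ** A) z = 2 * (\<Sum>r\<in>UNIV. T (raise r ** lower r ** A) z) +
    ((of_nat CARD('n) + 1) * e + e\<^sup>2 - (\<kappa> + e) * (e + of_nat l)
      + of_nat l * (of_nat CARD('n) + of_nat l - 1)) * T A z"
proof -
  have lp: "lin_poly T" and hp: "T A \<in> hom_poly l"
    using T by (simp_all add: equivariant_def)
  note pf = lin_polyD(1)[OF lp]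
  note e0 = equivariant_unit(1)[OF T, folded e_def]
  note ers = equivariant_unit(2)[OF T, folded e_def \<kappa>_def]
  let ?E = "\<lambda>r s. delta (unit_mat (Some r) (Some s))"
  let ?e = "delta (unit_mat None None)"
  \<comment> \<open>These units sum to the identity minus E_00, so together they act by -e.\<close>
  have tr: "(\<Sum>r\<in>UNIV. T (?E r r ** A) z) = - e * T A z"
  proof -
    have "(\<Sum>r\<in>UNIV. T (?E r r ** A) z) = (of_nat CARD('n) * (\<kappa> + e) - of_nat l) * T A z"
      by (simp add: ers sum_subtractf hom_poly_euler[OF hp] algebra_simps)
    moreover have "(of_nat CARD('n) + 1 :: complex) \<noteq> 0"
      by (metis of_nat_Suc of_nat_neq_0 add.commute)
    then have "(of_nat CARD('n) + 1) * e = of_nat l - of_nat CARD('n) * \<kappa>"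
      by (simp add: e_def weight0_def \<kappa>_def)
    then have "of_nat CARD('n) * (\<kappa> + e) - of_nat l = - e"
      by (simp add: algebra_simps)
    ultimately show ?thesis
      by simp
  qed
  have "casimir = ?e ** ?e + (\<Sum>r\<in>UNIV. lower r ** raise r) + ((\<Sum>r\<in>UNIV. raise r ** lower r) +
      (\<Sum>r\<in>UNIV. \<Sum>s\<in>UNIV. ?E r s ** ?E s r))"
    by (simp add: casimir_def sum_option_UNIV sum.distrib lower_def raise_def)
  then have cas: "T (casimir ** A) z = T (?e ** (?e ** A)) z + (\<Sum>r\<in>UNIV. T (lower r ** raise r ** A) z) +
      ((\<Sum>r\<in>UNIV. T (raise r ** lower r ** A) z) + (\<Sum>r\<in>UNIV. \<Sum>s\<in>UNIV. T (?E r s ** (?E s r ** A)) z))"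
    by (simp add: matrix_mult_add_left matrix_mult_sum_left lin_polyD[OF lp] lin_poly_sum[OF lp] matrix_mul_assoc)
  have lr: "(\<Sum>r\<in>UNIV. T (lower r ** raise r ** A) z) = (\<Sum>r\<in>UNIV. T (raise r ** lower r ** A) z) +
      (of_nat CARD('n) * e * T A z + e * T A z)"
    by (simp add: lower_raise matrix_mult_add_left matrix_mult_diff_left lin_polyD[OF lp] sum.distrib
        sum_subtractf e0 tr)
  have "T (?E r s ** (?E s r ** A)) z = (if r = s then (\<kappa> + e) * T (?E r r ** A) z else 0)
      - (if r = s then (\<kappa> + e) * (z $ r * partial_deriv r (T A) z) else 0)
      + z $ s * (partial_deriv s (T A) z + z $ r * partial_deriv r (partial_deriv s (T A)) z)" for r s
  proof -
    \<comment> \<open>The outer unit differentiates the polynomial already produced by the inner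
      one; the coordinate in the latter is the source of the second term of the product
      rule.\<close>
    have TE: "T (?E s r ** A) = (\<lambda>z. (if r = s then \<kappa> + e else 0) * T A z - z $ r * partial_deriv s (T A) z)"
      by (auto simp: fun_eq_iff ers)
    have "partial_deriv r (\<lambda>z. c * T A z - z $ r * g z) z = c * partial_deriv r (T A) z - (g z + z $ r * partial_deriv r g z)"
      if "poly_fun g" for c g
      using that by (simp add: partial_deriv_diff partial_deriv_cmult partial_deriv_mult partial_deriv_coord
          pf poly_fun_cmult poly_fun_mult poly_fun_coord)
    then have "partial_deriv r (T (?E s r ** A)) z = (if r = s then \<kappa> + e else 0) * partial_deriv r (T A) z
        - (partial_deriv s (T A) z + z $ r * partial_deriv r (partial_deriv s (T A)) z)"
      unfolding TE using poly_fun_partial_deriv[OF pf] by blast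
    then have "T (?E r s ** (?E s r ** A)) z = (if r = s then (\<kappa> + e) * T (?E s r ** A) z else 0)
        - z $ s * ((if r = s then \<kappa> + e else 0) * partial_deriv r (T A) z
        - (partial_deriv s (T A) z + z $ r * partial_deriv r (partial_deriv s (T A)) z))"
      by (simp only: ers[where A = "?E s r ** A"])
    also have "\<dots> = (if r = s then (\<kappa> + e) * T (?E r r ** A) z else 0)
        - (if r = s then (\<kappa> + e) * (z $ r * partial_deriv r (T A) z) else 0)
        + z $ s * (partial_deriv s (T A) z + z $ r * partial_deriv r (partial_deriv s (T A)) z)"
      by (simp add: algebra_simps)
    finally show ?thesis .
  qed
  then have "(\<Sum>r\<in>UNIV. \<Sum>s\<in>UNIV. T (?E r s ** (?E s r ** A)) z) =
      (\<kappa> + e) * (\<Sum>r\<in>UNIV. T (?E r r ** A) z) - (\<kappa> + e) * (\<Sum>r\<in>UNIV. z $ r * partial_deriv r (T A) z)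
      + (\<Sum>r\<in>UNIV. \<Sum>s\<in>UNIV. z $ s * (partial_deriv s (T A) z + z $ r * partial_deriv r (partial_deriv s (T A)) z))"
    by (simp only: sum.distrib sum_subtractf sum_distrib_left sum.delta finite UNIV_I if_True sum.delta')
  also have "(\<Sum>r\<in>UNIV. \<Sum>s\<in>UNIV. z $ s * (partial_deriv s (T A) z + z $ r * partial_deriv r (partial_deriv s (T A)) z))
      = of_nat l * (of_nat CARD('n) + of_nat l - 1) * T A z"
    by (subst sum.swap) (rule euler_sums[OF hp])
  finally have rs: "(\<Sum>r\<in>UNIV. \<Sum>s\<in>UNIV. T (?E r s ** (?E s r ** A)) z) =
      (\<kappa> + e) * (- e * T A z) - (\<kappa> + e) * (of_nat l * T A z) + of_nat l * (of_nat CARD('n) + of_nat l - 1) * T A z"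
    by (simp only: tr hom_poly_euler[OF hp])
  show ?thesis
    unfolding cas lr rs e0 by (simp add: algebra_simps power2_eq_square)
qed

end

section \<open>The pairing of the weights of the isotropy representation\<close>

text \<open>Both \<beta> and \<gamma> are constant from the second coordinate on, so among the
  positive roots of the isotropy algebra only those ending in index n + 1 pair nontrivially with
  them.\<close>

lemma weight_inner_two_rho_k_const:
  assumes n: "n \<ge> 1" and b: "\<And>m. m \<in> {2..n} \<Longrightarrow> b m = x"
  shows "weight_inner n b (\<lambda>m. two_rho_k n m + b m) = - 2 * (real n - 1) * x
    - 2 * ((b 1)\<^sup>2 + (real n - 1) * x\<^sup>2 - (b 1 + (real n - 1) * x)\<^sup>2 / (real n + 1))"
proof -
  have split: "{1..n} = insert 1 {2..n}"
    using n by auto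
  have 1: "(\<Sum>m=1..n. b m) = b 1 + (real n - 1) * x" "(\<Sum>m=1..n. b m * b m) = (b 1)\<^sup>2 + (real n - 1) * x\<^sup>2"
  proof -
    have "(\<Sum>m=2..n. b m) = (\<Sum>m=2..n. x)" "(\<Sum>m=2..n. b m * b m) = (\<Sum>m=2..n. x * x)"
      by (intro sum.cong refl; simp add: b)+
    then show "(\<Sum>m=1..n. b m) = b 1 + (real n - 1) * x" "(\<Sum>m=1..n. b m * b m) = (b 1)\<^sup>2 + (real n - 1) * x\<^sup>2"
      unfolding split using n by (simp_all add: power2_eq_square of_nat_diff)
  qed
  \<comment> \<open>For i < j <= n the two coordinates agree; for j = n + 1 the difference is
    \<open>x\<close>, since the last index carries only the normalisation.\<close>
  have "(\<Sum>i=2..n+1. \<Sum>j=2..n+1. if i < j then wcoord n b i - wcoord n b j else 0) =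
      (\<Sum>i=2..n+1. \<Sum>j=2..n+1. if j = n + 1 then (if i \<in> {2..n} then x else 0) else 0)"
    by (intro sum.cong refl) (auto simp: wcoord_def b)
  also have "\<dots> = (\<Sum>i=2..n+1. if i \<in> {2..n} then x else 0)"
    using n by (intro sum.cong refl) simp
  also have "\<dots> = (\<Sum>i=2..n. x)"
    by (rule sum.mono_neutral_cong_right) auto
  also have "\<dots> = (real n - 1) * x"
    using n by (simp add: of_nat_diff)
  finally have "weight_inner n b (two_rho_k n) = - 2 * (real n - 1) * x"
    by (simp only: weight_inner_two_rho_k mult.assoc)
  moreover have "weight_inner n b b = - 2 * ((b 1)\<^sup>2 + (real n - 1) * x\<^sup>2 - (b 1 + (real n - 1) * x)\<^sup>2 / (real n + 1))"
    unfolding weight_inner_def 1 by (simp add: power2_eq_square)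
  ultimately show ?thesis
    by (simp only: weight_inner_add)
qed

text \<open>With the pairings made explicit this is an identity of rational functions. On the right
  k occurs only in \<gamma>, whose first coefficient is 2l + (n+1)/4 - k/2; \<beta> supplies the
  correction that is free of k.\<close>

lemma isotropy_weights_identity:
  fixes k :: int and l n :: nat
  defines "\<kappa> \<equiv> real_of_int k - real l" 
  defines "e \<equiv> (real l - real n * \<kappa>) / (real n + 1)"
  assumes n: "n \<ge> 1"
  shows "4 * (real l * (real n + real l - 1 - \<kappa>))
      + 2 * ((real n + 1) * e + e\<^sup>2 - (\<kappa> + e) * (e + real l) + real l * (real n + real l - 1))
    = weight_inner n (beta_weight n l) (\<lambda>m. two_rho_k n m + beta_weight n l m)
      - 4 * weight_inner n (gamma_weight n k l) (\<lambda>m. two_rho_k n m + gamma_weight n k l m)"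
proof -
  define b1 where "b1 = 2 * real l + (real n + 1) / 2"
  define c1 where "c1 = b1 - (2 * real_of_int k + real n + 1) / 4"
  have \<beta>: "weight_inner n (beta_weight n l) (\<lambda>m. two_rho_k n m + beta_weight n l m) = - 2 * (real n - 1) * real l
    - 2 * (b1\<^sup>2 + (real n - 1) * (real l)\<^sup>2 - (b1 + (real n - 1) * real l)\<^sup>2 / (real n + 1))"
    using weight_inner_two_rho_k_const[OF n, of "beta_weight n l" "real l"]
    by (simp add: beta_weight_def b1_def)
  have \<gamma>: "weight_inner n (gamma_weight n k l) (\<lambda>m. two_rho_k n m + gamma_weight n k l m) = - 2 * (real n - 1) * real l
    - 2 * (c1\<^sup>2 + (real n - 1) * (real l)\<^sup>2 - (c1 + (real n - 1) * real l)\<^sup>2 / (real n + 1))"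
    using weight_inner_two_rho_k_const[OF n, of "gamma_weight n k l" "real l"] n
    by (simp add: gamma_weight_def beta_weight_def eps_def b1_def c1_def)
  define N where "N = real n + 1"
  have N: "N \<noteq> 0" "real n = N - 1"
    by (simp_all add: N_def)
  show ?thesis
    unfolding \<beta> \<gamma> e_def \<kappa>_def c1_def b1_def N(2) using N(1)
    by (simp add: field_simps power2_eq_square)
qed

section \<open>The fields of pure tensors\<close>

context projective_rep
begin

text \<open>One map \<open>T\<close> absorbs a whole finite sum of pure tensors, so no decomposition
  of a field and no multiplicity has to be considered.\<close>

lemma tensor_fields_equivariant:
  assumes \<phi>: "\<phi> \<in> tensor_fields k l \<pi>"
  obtains T where "equivariant k l T" "represents T \<phi>"
proof -
  obtain N :: nat and v L where L: "\<And>i. i < N \<Longrightarrow> L i \<in> Hom_K k l \<pi>"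
    and \<phi>_eq: "\<phi> = (\<lambda>g z. \<Sum>i<N. L i (\<pi> (matrix_inv g) *v v i) z)"
    using \<phi> unfolding tensor_fields_def by blast
  define T where "T A z = (\<Sum>i<N. L i (A *v v i) z)" for A :: "complex^'d^'d" and z
  have hom: "L i w \<in> hom_poly l" and add: "L i (w + w') z = L i w z + L i w' z"
    and scale: "L i (c *s w) z = c * L i w z"
    and equiv: "U \<in> unitary_group \<Longrightarrow> L i (\<pi> (qtilde U) *v w) z = det U powi (k - int l) * L i w (matrix_inv U *v z)"
    if "i < N" for i w w' c z U
    using L[OF that] unfolding Hom_K_def by auto
  have hp: "T A \<in> hom_poly l" for A
    unfolding T_def[abs_def] by (intro hom_poly_sum hom) simp
  have "lin_poly T"
    unfolding lin_poly_def
    by (auto simp: hom_poly_poly_fun[OF hp] T_def matrix_vector_mult_add_rdistrib cscale_mult_vec add scale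
        sum.distrib sum_distrib_left)
  moreover from this hp have "equivariant k l T"
    unfolding equivariant_def by (auto simp: T_def equiv sum_distrib_left simp flip: matrix_vector_mul_assoc)
  moreover have "\<phi> g = T (\<pi> (adj g))" if "g \<in> SU" for g
    using unitary_groupD(3)[OF SU_unitary[OF that]] by (simp add: \<phi>_eq T_def fun_eq_iff)
  ultimately show ?thesis
    using that by (auto simp: represents_def)
qed

text \<open>Passing to inverses moves the isotropy element to the left of the argument of
  \<open>T\<close> as its adjoint. This inverts the determinant, hence the opposite exponent, and
  turns the inverse acting on z into \<open>A\<close> itself.\<close>

lemma equivariant_spinor_field:
  assumes T: "equivariant k l T" and \<phi>: "represents T \<phi>"
  shows "\<phi> \<in> spinor_fields k l"
proof -
  have lp: "lin_poly T"
    using T by (simp add: equivariant_def)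
  have "smooth_on_set SU (\<lambda>g. \<phi> g z)" for z
  proof (rule smooth_on_set_cong)
    have "linear (\<lambda>A. T A z)"
      by (auto intro!: linearI simp: lin_polyD[OF lp] scaleR_conv_of_real[where 'a = complex])
    moreover have "smooth_on_set SU (\<lambda>g. \<pi> (adj g))"
    proof (rule smooth_on_set_linear_right[OF linear_adj])
      show "adj ` SU \<subseteq> SU"
        using SU_adj by blast
      show "smooth_on_set SU \<pi>"
        using rep by (simp add: SU_rep_def)
    qed
    ultimately show "smooth_on_set SU (\<lambda>g. T (\<pi> (adj g)) z)"
      by (rule smooth_on_set_linear_left)
  qed (simp add: representsD[OF \<phi>])
  moreover have "\<phi> (g ** qtilde A) z = det A powi (int l - k) * \<phi> g (A *v z)"
    if g: "g \<in> SU" and A: "A \<in> unitary_group" for g A z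
  proof -
    have "\<phi> (g ** qtilde A) z = T (\<pi> (qtilde (adj A)) ** \<pi> (adj g)) z"
      using g A by (simp add: representsD[OF \<phi>] SU_mult qtilde_SU adj_mult adj_qtilde rep_mult SU_adj unitary_groupD(4))
    also have "\<dots> = det (adj A) powi (k - int l) * T (\<pi> (adj g)) (A *v z)"
      using T unitary_groupD(4)[OF A] unitary_groupD(3)[OF unitary_groupD(4)[OF A]]
      by (simp add: equivariant_def)
    also have "det (adj A) powi (k - int l) = det A powi (int l - k)"
    proof -
      have "det (adj A) powi (k - int l) = det A powi (- (k - int l))"
        by (simp only: det_unitary_adj[OF A] power_int_inverse power_int_minus)
      then show ?thesis
        by (simp only: minus_diff_eq)
    qed
    finally show ?thesis
      by (simp add: representsD[OF \<phi> g])
  qed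
  moreover have "\<phi> g \<in> hom_poly l" if "g \<in> SU" for g
    using T \<phi> that by (simp add: equivariant_def represents_def)
  ultimately show ?thesis
    by (simp add: spinor_fields_def)
qed

text \<open>The sum of E_r0 E_0r is eliminated between the commutator formula and the Casimir
  formula; it enters with weight 4 in the first and with factor 2 in the second, which leaves -2
  c.\<close>

lemma P_op_equivariant:
  fixes k l
  defines "\<kappa> \<equiv> of_int (k - int l) :: complex" and "e \<equiv> weight0 k l"
  assumes X: "p_basis X" and h: "hbar > 0" and T: "equivariant k l T" and \<phi>: "represents T \<phi>"
    and cas: "casimir = cscale c (mat 1)" and g: "g \<in> SU"
  shows "P_op hbar X \<phi> g z = 1 / of_real hbar * (4 * (of_nat l * (of_nat CARD('n) + of_nat l - 1 - \<kappa>))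
      + 2 * ((of_nat CARD('n) + 1) * e + e\<^sup>2 - (\<kappa> + e) * (e + of_nat l)
      + of_nat l * (of_nat CARD('n) + of_nat l - 1)) - 2 * c) * \<phi> g z"
proof -
  let ?A = "\<pi> (adj g)"
  define S where "S = (\<Sum>r\<in>UNIV. T (raise r ** lower r ** ?A) z)"
  define a where "a = (of_nat CARD('n) + 1) * e + e\<^sup>2 - (\<kappa> + e) * (e + of_nat l)
      + of_nat l * (of_nat CARD('n) + of_nat l - 1)"
  define b where "b = of_nat l * (of_nat CARD('n) + of_nat l - 1 - \<kappa>)"
  define D where "D = creat hbar (annih T) ?A z - annih (creat hbar T) ?A z"
  have lp: "lin_poly T"
    using T by (simp add: equivariant_def)
  have "T (casimir ** ?A) z = c * T ?A z"
    by (simp add: cas cscale_mult_left lin_polyD[OF lp])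
  then have S: "2 * S = (c - a) * T ?A z"
    using casimir_equivariant[OF T, of ?A z, folded S_def \<kappa>_def e_def, folded a_def] by (simp add: algebra_simps)
  have D: "2 * of_real hbar * D = b * T ?A z - S"
    using creat_annih_commutator[OF T, of hbar ?A z, folded S_def \<kappa>_def D_def, folded b_def] h by simp
  have "of_real hbar * P_op hbar X \<phi> g z = 4 * (2 * of_real hbar * D)"
    using P_op_represents[OF X \<phi> g, of hbar z, folded D_def] by simp
  also have "\<dots> = 4 * b * T ?A z - 2 * (2 * S)"
    unfolding D by (simp add: algebra_simps)
  also have "\<dots> = (4 * b + 2 * a - 2 * c) * \<phi> g z"
    unfolding S representsD[OF \<phi> g] by (simp add: algebra_simps)
  finally show ?thesis
    using h unfolding a_def[symmetric] b_def[symmetric] by (simp add: field_simps)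
qed

end

theorem lemma4p10:
  fixes hbar :: real and k :: int and l :: nat
    and \<pi> :: "complex^'n::{finite,linorder} option^'n option \<Rightarrow> complex^'d^'d"
    and lam :: weight
    and X :: "'b::finite \<Rightarrow> complex^'n option^'n option"
  assumes "hbar > 0"
    and "p_basis X"
    and "irreducible_rep \<pi>"
    and "highest_weight \<pi> lam"
  shows "tensor_fields k l \<pi> \<subseteq> spinor_fields k l \<and>
    (\<forall>\<phi>\<in>tensor_fields k l \<pi>. \<forall>g\<in>SU. \<forall>z.
      P_op hbar X \<phi> g z =
        of_real (1 / hbar *
          (weight_inner CARD('n) lam (\<lambda>m. two_rho_su CARD('n) m + lam m)
           + weight_inner CARD('n) (beta_weight CARD('n) l) (\<lambda>m. two_rho_k CARD('n) m + beta_weight CARD('n) l m)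
           - 4 * weight_inner CARD('n) (gamma_weight CARD('n) k l) (\<lambda>m. two_rho_k CARD('n) m + gamma_weight CARD('n) k l m)))
        * \<phi> g z)"
proof -
  interpret highest_weight_rep \<pi> lam
    using assms by unfold_locales (simp_all add: irreducible_rep_def)
  interpret projective_rep \<pi>
    by unfold_locales
  let ?n = "CARD('n)"
  let ?w = "weight_inner ?n lam (\<lambda>m. two_rho_su ?n m + lam m)"
  \<comment> \<open>The value -w/2 turns the term -2 c of \<open>P_op_equivariant\<close> into the
    pairing \<open>?w\<close> itself.\<close>
  let ?c = "of_real (- ?w / 2) :: complex"
  let ?v = "weight_inner ?n (beta_weight ?n l) (\<lambda>m. two_rho_k ?n m + beta_weight ?n l m)
      - 4 * weight_inner ?n (gamma_weight ?n k l) (\<lambda>m. two_rho_k ?n m + gamma_weight ?n k l m)"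
  have "?n \<ge> 1"
    using zero_less_card_finite[where 'a = 'n] by linarith
  note weights = isotropy_weights_identity[OF this, of l k]
  have P: "P_op hbar X \<phi> g z = of_real (1 / hbar * (?w + ?v)) * \<phi> g z"
    if \<phi>: "\<phi> \<in> tensor_fields k l \<pi>" and g: "g \<in> SU" for \<phi> g z
  proof -
    obtain T where T: "equivariant k l T" "represents T \<phi>"
      using tensor_fields_equivariant[OF \<phi>] .
    have "complex_of_nat ?n + 1 \<noteq> 0"
      by (metis of_nat_Suc of_nat_neq_0 add.commute)
    then show ?thesis
      unfolding P_op_equivariant[OF assms(2,1) T casimir_eq[OF assms(3)] g] weights[symmetric] weight0_def
      by simp
  qed
  have "tensor_fields k l \<pi> \<subseteq> spinor_fields k l"
  proof
    fix \<phi> assume \<phi>: "\<phi> \<in> tensor_fields k l \<pi>"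
    obtain T where "equivariant k l T" "represents T \<phi>"
      using tensor_fields_equivariant[OF \<phi>] .
    then show "\<phi> \<in> spinor_fields k l"
      by (rule equivariant_spinor_field)
  qed
  then show ?thesis
    using P by (simp add: add_diff_eq)
qed

end
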